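(* Let $(\chi_n)_{n\ge 2}$ be a sequence of positive reals with $\chi_n\to\infty$ as $n\to\infty$, put $\rho_n=\chi_n\log n$, and assume $0<\rho_n<n$ for every $n\ge 2$. Fix $\kappa\in(0,1)$ and set $$\varepsilon_n=\frac{2}{\chi_n^{1/8}},\qquad \varepsilon'_n=\frac{1}{\sqrt{\rho_n}\,(1-\kappa)}.$$ For $\varepsilon,\varepsilon'>0$ define the complex domains $$D^{(1)}_{\varepsilon,\varepsilon'}=\{z\in\mathbb C:\ \varepsilon'<|z|<1-\varepsilon\},\qquad D^{(2)}_{\varepsilon,\varepsilon'}=\{z\in\mathbb C:\ 1+\varepsilon<|z|<1/\varepsilon'\},$$ and, for $i=1,2$, the event $$\Phi^{(i)}_{n}=\Big\{\text{there exists } v\in D^{(i)}_{\varepsilon_n,\varepsilon'_n}\text{ such that } \big(\tilde Z^{(n)}(v)\big)^{-1}=0\Big\}.$$ Then for $i=1$ and $i=2$, $$\sum_{n\ge 2} P_{n}\big(\Phi^{(i)}_{n}\big)<\infty .$$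
   Context: For each $n$, let $\{a_{ij}: 1\le i<j\le n\}$ be jointly independent random variables on a probability space with law $P_n$, each equal to $1$ with probability $\rho_n/n$ and $0$ with probability $1-\rho_n/n$ (the Erdős–Rényi random graph $G(n,\rho_n/n)$). Let $A$ be the $n\times n$ symmetric adjacency matrix with $A_{ij}=a_{ij}$ for $i<j$, $A_{ij}=a_{ji}$ for $i>j$, $A_{ii}=0$; let $B$ be the diagonal matrix with $B_{ii}=\sum_{k=1}^n A_{ik}$ (vertex degrees); let $r=\frac12\sum_{i,j=1}^n A_{ij}-n+1$. The normalized (reciprocal) Ihara zeta function is defined for $v\in\mathbb C$ by $$\big(\tilde Z^{(n)}(v)\big)^{-1}=\Big(1-\frac{v^2}{\rho_n}\Big)^{r-1}\det\Big(I+\frac{v^2}{\rho_n}(B-I)-\frac{v}{\sqrt{\rho_n}}A\Big),$$ i.e. the right-hand side of Ihara's formula $(1-u^2)^{r-1}\det(I+u^2(B-I)-uA)$ evaluated at $u=v/\sqrt{\rho_n}$ (used as the definition even if the graph is disconnected). *)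

theory Defs
  imports Complex_Main "Jordan_Normal_Form.Determinant"
begin

text \<open>Erdos-Renyi random graph on vertex set {0..<n}: a graph is an edge set
  E \<subseteq> pairs n (each unordered pair {i,j} encoded by (i,j) with i<j).\<close>

definition pairs :: "nat \<Rightarrow> (nat \<times> nat) set" where
  "pairs n = {(i, j). i < j \<and> j < n}"

definition er_prob :: "nat \<Rightarrow> real \<Rightarrow> ((nat \<times> nat) set \<Rightarrow> bool) \<Rightarrow> real" where
  "er_prob n p Q =
     (\<Sum>E\<in>Pow (pairs n). if Q E then p ^ card E * (1 - p) ^ (card (pairs n) - card E) else 0)"

definition adj_mat :: "nat \<Rightarrow> (nat \<times> nat) set \<Rightarrow> complex mat" where
  "adj_mat n E = mat n n (\<lambda>(i, j). if (i, j) \<in> E \<or> (j, i) \<in> E then 1 else 0)"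

definition deg_mat :: "nat \<Rightarrow> (nat \<times> nat) set \<Rightarrow> complex mat" where
  "deg_mat n E = mat n n (\<lambda>(i, j). if i = j then (\<Sum>k<n. adj_mat n E $$ (i, k)) else 0)"

definition cyc_rank :: "nat \<Rightarrow> (nat \<times> nat) set \<Rightarrow> int" where
  "cyc_rank n E = (\<Sum>i<n. \<Sum>j<n. (if (i, j) \<in> E \<or> (j, i) \<in> E then 1 else 0)) div 2 - int n + 1"

text \<open>Normalized reciprocal Ihara zeta function.\<close>
definition zeta_inv :: "nat \<Rightarrow> real \<Rightarrow> (nat \<times> nat) set \<Rightarrow> complex \<Rightarrow> complex" where
  "zeta_inv n \<rho> E v =
     (let u = v / complex_of_real (sqrt \<rho>) in
      (1 - v\<^sup>2 / complex_of_real \<rho>) powi (cyc_rank n E - 1) *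
      det (1\<^sub>m n + (u\<^sup>2) \<cdot>\<^sub>m (deg_mat n E - 1\<^sub>m n) - u \<cdot>\<^sub>m adj_mat n E))"

definition D1 :: "real \<Rightarrow> real \<Rightarrow> complex set" where
  "D1 \<epsilon> \<epsilon>' = {z. \<epsilon>' < cmod z \<and> cmod z < 1 - \<epsilon>}"

definition D2 :: "real \<Rightarrow> real \<Rightarrow> complex set" where
  "D2 \<epsilon> \<epsilon>' = {z. 1 + \<epsilon> < cmod z \<and> cmod z < 1 / \<epsilon>'}"

end

theory Submission
  imports Defs "HOL-Library.FuncSet" "HOL-Analysis.Function_Topology" "HOL-Analysis.Convex"
    "HOL-Real_Asymp.Real_Asymp"
begin

text \<open>
  Write \<open>X = A - p J\<close> off the diagonal, with \<open>p = \<rho> / n\<close> and \<open>J\<close> the all-ones matrix. A kernel vector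
  of the Ihara matrix at \<open>v\<close>, paired with itself, gives a quadratic equation for \<open>v\<close> with real
  coefficients and product of the roots close to 1, because all degrees are close to \<open>\<rho>\<close>; hence
  \<open>v\<close> is real or has modulus close to 1. For real \<open>v\<close> a two-sided bound on the quadratic form of
  \<open>X\<close> by nearly \<open>2 sqrt \<rho>\<close> makes the matrix definite up to the rank one part \<open>p J\<close>, and Cauchy-Schwarz
  against the all-ones vector excludes a kernel.

  The sharp constant 2 comes from the weighted non-backtracking matrix of \<open>X\<close>: by an Ihara-Bass
  identity and a continuity argument, the bound on \<open>X\<close> follows once some \<open>l\<close>-th power of that
  matrix has Frobenius norm below \<open>(sqrt \<rho> (1 + q)) ^ l\<close>, where \<open>q = \<chi> powr (- 1 / 8)\<close>. The second moment of the
  Frobenius norm is a sum over closed walks which backtrack only at two times and cover every edge at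
  least twice. Rather than encoding such walks, one compares their weights with the law of a
  random walk on histories that prefers the forced moves: this law has total mass 1, and each walk
  gets almost its full weight, up to a factor paid for by the number of independent cycles.
\<close>

section \<open>Closed walks covering every edge twice\<close>

text \<open>The scales are tied by \<open>\<rho> * q ^ 8 = ln n\<close>. For
  \<open>lam = sqrt \<rho> * (1 + q)\<close> the bound \<open>lam + \<rho> / (lam - 1)\<close>
  exceeds \<open>2 * sqrt \<rho>\<close> by a relative error of order \<open>q\<^sup>2\<close>,
  whereas \<open>1 / w + w\<close> exceeds 2 by \<open>(w - 1)\<^sup>2 / w\<close>, with
  \<open>(w - 1)\<^sup>2 > 4 * q\<^sup>2\<close> on both domains; this is why \<epsilon> is
  \<open>2 * q\<close>. Degree fluctuations must then be of lower order than
  \<open>q\<^sup>2\<close>. The choice \<open>q ^ 3\<close> is affordable, since the Chernoff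
  exponent is of order \<open>\<rho> * q ^ 6 = ln n / q\<^sup>2\<close>. The obstacle is the length
  of the walks: the gain \<open>(1 + q) ^ (2 * l)\<close> beats powers of \<open>n\<close> only for
  \<open>l\<close> of order \<open>ln n / q\<close>, so no constant factor may be lost per step. The
  comparison with a random walk meets this: passing through a vertex of degree two for the second
  time is nearly free, and only independent cycles and third traversals cost something. A cycle
  costs \<open>L ^ 6\<close> up to a constant but gains \<open>1 / n\<close>; a third traversal
  costs \<open>2 * b + 1\<close> but gains \<open>1 / sqrt \<rho>\<close>.\<close>

definition edge_of :: "nat \<Rightarrow> nat \<Rightarrow> nat \<times> nat" where
  "edge_of a b = (min a b, max a b)"

definition walk_edge :: "(nat \<Rightarrow> nat) \<Rightarrow> nat \<Rightarrow> nat \<times> nat" where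
  "walk_edge x t = edge_of (x t) (x (Suc t))"

definition incident :: "nat \<Rightarrow> nat \<times> nat \<Rightarrow> bool" where
  "incident v e \<longleftrightarrow> fst e = v \<or> snd e = v"

lemma edge_of_eq_iff: "edge_of a b = edge_of c d \<longleftrightarrow> (a = c \<and> b = d) \<or> (a = d \<and> b = c)"
  unfolding edge_of_def by (auto simp: min_def max_def split: if_splits)

lemma edge_of_commute: "edge_of a b = edge_of b a"
  by (simp add: edge_of_eq_iff)

lemma incident_edge_of: "incident v (edge_of a b) \<longleftrightarrow> v = a \<or> v = b"
  unfolding incident_def edge_of_def by (auto simp: min_def max_def)

text \<open>The forced moves: neighbours of the current vertex in the graph explored so far, without the
  previous vertex, except at the turning time \<open>l\<close>, where backtracking is allowed.\<close>

definition old_opts :: "nat \<Rightarrow> (nat \<Rightarrow> nat) \<Rightarrow> nat \<Rightarrow> nat set" where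
  "old_opts l x i = {z. edge_of (x i) z \<in> walk_edge x ` {..<i} \<and> (0 < i \<and> i \<noteq> l \<longrightarrow> z \<noteq> x (i - 1))}"

text \<open>If there are forced moves, they share \<open>1 - 1 / (2 * L)\<close>, the fresh vertices
  share \<open>1 / (4 * L)\<close>, and each of the at most \<open>L\<close> visited vertices gets
  \<open>1 / (4 * L\<^sup>2)\<close>, which adds up to at most 1. A loss of
  \<open>1 - 1 / (2 * L)\<close> in each of \<open>L\<close> steps is only a constant factor
  overall.\<close>

definition walk_kernel :: "nat \<Rightarrow> nat \<Rightarrow> nat \<Rightarrow> (nat \<Rightarrow> nat) \<Rightarrow> nat \<Rightarrow> nat \<Rightarrow> real" where
  "walk_kernel n L l x i z =
     (if z \<in> old_opts l x i then (1 - 1 / (2 * real L)) / real (card (old_opts l x i))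
      else if z \<notin> x ` {..i} then
        (if old_opts l x i = {} then 1 - 1 / (2 * real L) else 1 / (4 * real L)) / real n
      else 1 / (4 * (real L)\<^sup>2))"

lemma old_opts_subset: "old_opts l x i \<subseteq> x ` {..i}"
proof
  fix z assume "z \<in> old_opts l x i"
  then obtain t where t: "t < i" "edge_of (x i) z = walk_edge x t"
    unfolding old_opts_def by auto
  then have "z = x t \<or> z = x (Suc t)"
    unfolding walk_edge_def edge_of_eq_iff by auto
  moreover have "x t \<in> x ` {..i}" "x (Suc t) \<in> x ` {..i}" using t(1) by (intro imageI; simp)+
  ultimately show "z \<in> x ` {..i}" by auto
qed

lemma finite_old_opts: "finite (old_opts l x i)"
  using finite_subset[OF old_opts_subset] by blast

lemma walk_kernel_nonneg: "L \<ge> 1 \<Longrightarrow> walk_kernel n L l x i z \<ge> 0"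
  unfolding walk_kernel_def by (auto simp: field_simps)

lemma walk_kernel_cong:
  assumes "\<And>j. j \<le> i \<Longrightarrow> x j = y j"
  shows "walk_kernel n L l x i z = walk_kernel n L l y i z"
proof -
  have 1: "walk_edge x ` {..<i} = walk_edge y ` {..<i}"
    by (rule image_cong) (auto simp: walk_edge_def assms)
  have 2: "x ` {..i} = y ` {..i}" by (rule image_cong) (auto simp: assms)
  have "old_opts l x i = old_opts l y i"
    unfolding old_opts_def 1 using assms by auto
  then show ?thesis unfolding walk_kernel_def 2 by simp
qed

lemma walk_kernel_sum:
  assumes i: "i < L" and n: "0 < n"
  shows "(\<Sum>z<n. walk_kernel n L l x i z) \<le> 1"
proof -
  let ?O = "old_opts l x i" and ?V = "x ` {..i}"
  have L: "real L \<ge> 1" using i by simp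
  define a where "a = (if ?O = {} then 0 else 1 - 1 / (2 * real L))"
  define c where "c = (if ?O = {} then 1 - 1 / (2 * real L) else 1 / (4 * real L))"
  have c0: "c \<ge> 0" unfolding c_def using L by (simp add: field_simps)
  have "(\<Sum>z<n. walk_kernel n L l x i z)
     \<le> (\<Sum>z<n. (if z \<in> ?O then (1 - 1 / (2 * real L)) / real (card ?O) else 0)
        + c / real n + (if z \<in> ?V then 1 / (4 * (real L)\<^sup>2) else 0))"
    by (rule sum_mono) (use c0 L in \<open>auto simp: walk_kernel_def c_def field_simps\<close>)
  also have "\<dots> = (\<Sum>z<n. if z \<in> ?O then (1 - 1 / (2 * real L)) / real (card ?O) else 0)
        + c + (\<Sum>z<n. if z \<in> ?V then 1 / (4 * (real L)\<^sup>2) else 0)"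
    using n by (simp add: sum.distrib)
  also have "(\<Sum>z<n. if z \<in> ?O then (1 - 1 / (2 * real L)) / real (card ?O) else 0)
      = real (card ({..<n} \<inter> ?O)) * ((1 - 1 / (2 * real L)) / real (card ?O))"
    by (simp add: sum.If_cases)
  also have "\<dots> \<le> a"
  proof (cases "?O = {}")
    case False
    then have pos: "card ?O > 0" using finite_old_opts by (simp add: card_gt_0_iff)
    have "real (card ({..<n} \<inter> ?O)) \<le> real (card ?O)"
      by (simp add: card_mono finite_old_opts)
    then have "real (card ({..<n} \<inter> ?O)) * ((1 - 1 / (2 * real L)) / real (card ?O))
       \<le> real (card ?O) * ((1 - 1 / (2 * real L)) / real (card ?O))"
      by (rule mult_right_mono) (use L in \<open>auto simp: field_simps\<close>)
    also have "\<dots> = a" using pos False unfolding a_def by simp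
    finally show ?thesis .
  qed (simp add: a_def)
  also have "(\<Sum>z<n. if z \<in> ?V then 1 / (4 * (real L)\<^sup>2) else 0)
      = real (card ({..<n} \<inter> ?V)) * (1 / (4 * (real L)\<^sup>2))"
    by (simp add: sum.If_cases)
  also have "\<dots> \<le> real L * (1 / (4 * (real L)\<^sup>2))"
  proof (rule mult_right_mono)
    have "card ({..<n} \<inter> ?V) \<le> card ?V" by (rule card_mono) auto
    also have "\<dots> \<le> Suc i" using card_image_le[of "{..i}" x] by simp
    finally show "real (card ({..<n} \<inter> ?V)) \<le> real L" using i by linarith
  qed simp
  also have "real L * (1 / (4 * (real L)\<^sup>2)) = 1 / (4 * real L)"
    using L by (simp add: power2_eq_square)
  finally have "(\<Sum>z<n. walk_kernel n L l x i z) \<le> a + c + 1 / (4 * real L)" by simp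
  also have "\<dots> \<le> 1" unfolding a_def c_def using L by (auto simp: field_simps)
  finally show ?thesis .
qed

section \<open>Total mass of path measures built from kernels\<close>

lemma sum_PiE_atMost_Suc:
  fixes g :: "(nat \<Rightarrow> nat) \<Rightarrow> real"
  shows "(\<Sum>x\<in>{..Suc k} \<rightarrow>\<^sub>E {..<n}. g x) = (\<Sum>x\<in>{..k} \<rightarrow>\<^sub>E {..<n}. \<Sum>z<n. g (x(Suc k := z)))"
proof -
  have *: "{..Suc k} = insert (Suc k) {..k}" by auto
  have "(\<Sum>x\<in>{..Suc k} \<rightarrow>\<^sub>E {..<n}. g x)
     = sum g ((\<lambda>(z, x). x(Suc k := z)) ` ({..<n} \<times> ({..k} \<rightarrow>\<^sub>E {..<n})))"
    unfolding * PiE_insert_eq ..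
  also have "\<dots> = (\<Sum>(z, x)\<in>{..<n} \<times> ({..k} \<rightarrow>\<^sub>E {..<n}). g (x(Suc k := z)))"
    by (subst sum.reindex) (auto intro!: inj_combinator simp: case_prod_beta)
  also have "\<dots> = (\<Sum>z<n. \<Sum>x\<in>{..k} \<rightarrow>\<^sub>E {..<n}. g (x(Suc k := z)))"
    by (simp add: sum.cartesian_product)
  finally show ?thesis by (subst (asm) sum.swap)
qed

text \<open>By \<open>dep\<close> the weight of a step depends on the history only, so the last
  vertex can be summed out first. The factor \<open>n\<close> is the free choice of the starting
  vertex.\<close>

lemma subprob_path_mass:
  fixes Q :: "(nat \<Rightarrow> nat) \<Rightarrow> nat \<Rightarrow> nat \<Rightarrow> real"
  assumes dep: "\<And>x y i z. (\<And>j. j \<le> i \<Longrightarrow> x j = y j) \<Longrightarrow> Q x i z = Q y i z"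
    and nonneg: "\<And>x i z. Q x i z \<ge> 0"
    and sub: "\<And>x i. i < k \<Longrightarrow> (\<Sum>z<n. Q x i z) \<le> 1"
  shows "(\<Sum>x\<in>{..k} \<rightarrow>\<^sub>E {..<n}. \<Prod>i<k. Q x i (x (Suc i))) \<le> real n"
  using sub
proof (induction k)
  case 0
  have "card ({..0::nat} \<rightarrow>\<^sub>E {..<n}) = n" by (simp add: card_PiE)
  then show ?case by simp
next
  case (Suc k)
  have "(\<Sum>x\<in>{..Suc k} \<rightarrow>\<^sub>E {..<n}. \<Prod>i<Suc k. Q x i (x (Suc i)))
     = (\<Sum>x\<in>{..k} \<rightarrow>\<^sub>E {..<n}. \<Sum>z<n. (\<Prod>i<k. Q x i (x (Suc i))) * Q x k z)"
  proof (subst sum_PiE_atMost_Suc, intro sum.cong refl)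
    fix x :: "nat \<Rightarrow> nat" and z
    have "(\<Prod>i<k. Q (x(Suc k := z)) i ((x(Suc k := z)) (Suc i))) = (\<Prod>i<k. Q x i (x (Suc i)))"
      by (intro prod.cong refl) (auto intro!: dep)
    moreover have "Q (x(Suc k := z)) k z = Q x k z" by (rule dep) auto
    ultimately show "(\<Prod>i<Suc k. Q (x(Suc k := z)) i ((x(Suc k := z)) (Suc i)))
        = (\<Prod>i<k. Q x i (x (Suc i))) * Q x k z" by simp
  qed
  also have "\<dots> = (\<Sum>x\<in>{..k} \<rightarrow>\<^sub>E {..<n}. (\<Prod>i<k. Q x i (x (Suc i))) * (\<Sum>z<n. Q x k z))"
    by (simp add: sum_distrib_left)
  also have "\<dots> \<le> (\<Sum>x\<in>{..k} \<rightarrow>\<^sub>E {..<n}. (\<Prod>i<k. Q x i (x (Suc i))) * 1)"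
    by (intro sum_mono mult_left_mono Suc.prems prod_nonneg) (auto simp: nonneg)
  also have "\<dots> \<le> real n" using Suc by simp
  finally show ?case .
qed

lemma card_image_first_times:
  fixes f :: "nat \<Rightarrow> 'a"
  shows "card (f ` {..<k}) = card {i. i < k \<and> f i \<notin> f ` {..<i}}"
proof (induction k)
  case (Suc k)
  have *: "{i. i < Suc k \<and> f i \<notin> f ` {..<i}}
     = {i. i < k \<and> f i \<notin> f ` {..<i}} \<union> (if f k \<notin> f ` {..<k} then {k} else {})"
    by (auto simp: less_Suc_eq)
  show ?case
    unfolding * lessThan_Suc using Suc by (auto simp: insert_absorb)
qed simp

lemma obtain_second_time:
  fixes f :: "nat \<Rightarrow> 'a"
  assumes e: "e \<in> f ` {..<k}"
    and dbl: "\<And>t. t < k \<Longrightarrow> \<exists>s<k. s \<noteq> t \<and> f s = f t"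
  obtains i where "i < k" "f i = e" "card {t. t < i \<and> f t = f i} = 1"
proof -
  let ?P = "\<lambda>t. t < k \<and> f t = e"
  obtain t0 where "?P t0" using e by auto
  define a where "a = (LEAST t. ?P t)"
  have a: "?P a" unfolding a_def by (rule LeastI[of ?P, OF \<open>?P t0\<close>])
  have amin: "\<And>t. ?P t \<Longrightarrow> a \<le> t" unfolding a_def by (rule Least_le)
  obtain s where "?P s \<and> s \<noteq> a" using dbl[of a] a by auto
  define i where "i = (LEAST t. ?P t \<and> t \<noteq> a)"
  have i: "?P i \<and> i \<noteq> a"
    unfolding i_def by (rule LeastI[of "\<lambda>t. ?P t \<and> t \<noteq> a", OF \<open>?P s \<and> s \<noteq> a\<close>])
  have imin: "\<And>t. ?P t \<Longrightarrow> t \<noteq> a \<Longrightarrow> i \<le> t" unfolding i_def by (rule Least_le) auto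
  have "{t. t < i \<and> f t = f i} = {a}"
  proof (rule Set.set_eqI)
    fix t
    have "t < i \<Longrightarrow> f t = e \<Longrightarrow> t = a" using imin[of t] i by fastforce
    moreover have "a < i" using amin[of i] i by (metis le_neq_implies_less)
    ultimately show "t \<in> {t. t < i \<and> f t = f i} \<longleftrightarrow> t \<in> {a}" using a i by auto
  qed
  then show ?thesis using that[of i] i by simp
qed

section \<open>Combinatorics of a single doubled walk\<close>

text \<open>Models two non-backtracking paths with common ends, the second run in reverse.
  Backtracking therefore remains possible at the start and at the turning time
  \<open>l\<close>.\<close>

locale doubled_walk =
  fixes n l L :: nat and x :: "nat \<Rightarrow> nat"
  assumes l_pos: "0 < l" and L_def: "L = 2 * l"
    and x_less: "\<And>i. i \<le> L \<Longrightarrow> x i < n"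
    and noloop: "\<And>i. i < L \<Longrightarrow> x i \<noteq> x (Suc i)"
    and nonback: "\<And>i. 0 < i \<Longrightarrow> i < L \<Longrightarrow> i \<noteq> l \<Longrightarrow> x (i - 1) \<noteq> x (Suc i)"
    and closed: "x L = x 0"
    and doubled: "\<And>t. t < L \<Longrightarrow> \<exists>s<L. s \<noteq> t \<and> walk_edge x s = walk_edge x t"
begin

text \<open>In graph terms, \<open>b\<close> is the number of independent cycles of the visited graph and \<open>\<tau>\<close> counts
  the steps that traverse an edge for the third time or later. The subtraction in \<open>excess_deg\<close> is
  truncated: only the start and the turning point can have degree one.\<close>

definition "V = x ` {..L}"
definition "En = walk_edge x ` {..<L}"
definition "walk_deg v = card {e \<in> En. incident v e}"
definition "excess_deg v = walk_deg v - 2"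
definition "new i \<longleftrightarrow> x (Suc i) \<notin> x ` {..i}"
definition "seen i \<longleftrightarrow> walk_edge x i \<in> walk_edge x ` {..<i}"
definition "second i \<longleftrightarrow> card {t. t < i \<and> walk_edge x t = walk_edge x i} = 1"
definition "opts i = old_opts l x i"
definition "b = card En + 1 - card V"
definition "\<tau> = L - 2 * card En"

lemma finite_V: "finite V" and finite_En: "finite En"
  unfolding V_def En_def by auto

lemma L_pos: "0 < L" using l_pos L_def by simp

lemma opts_subset: "opts i \<subseteq> x ` {..i}" and finite_opts: "finite (opts i)"
  unfolding opts_def using old_opts_subset finite_old_opts by auto

lemma new_not_seen: "new i \<Longrightarrow> \<not> seen i"
proof
  assume "new i" "seen i"
  then obtain t where t: "t < i" "edge_of (x i) (x (Suc i)) = edge_of (x t) (x (Suc t))"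
    unfolding seen_def walk_edge_def by auto
  then have "x (Suc i) = x t \<or> x (Suc i) = x (Suc t)" unfolding edge_of_eq_iff by auto
  then show False using \<open>new i\<close> t(1) unfolding new_def by (auto simp: Suc_le_eq)
qed

lemma second_seen: "second i \<Longrightarrow> seen i"
proof -
  assume "second i"
  then obtain t where "{t. t < i \<and> walk_edge x t = walk_edge x i} = {t}"
    unfolding second_def by (auto simp: card_1_singleton_iff)
  then have "t < i" "walk_edge x t = walk_edge x i" by auto
  then show ?thesis unfolding seen_def by (metis imageI lessThan_iff)
qed

lemma card_V: "card V = Suc (card {i. i < L \<and> new i})"
proof -
  have "V = x ` {..<Suc L}" unfolding V_def lessThan_Suc_atMost ..
  then have "card V = card {i. i < Suc L \<and> x i \<notin> x ` {..<i}}"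
    using card_image_first_times[of x "Suc L"] by simp
  also have "{i. i < Suc L \<and> x i \<notin> x ` {..<i}} = insert 0 (Suc ` {i. i < L \<and> new i})"
  proof (rule Set.set_eqI)
    fix i
    show "i \<in> {i. i < Suc L \<and> x i \<notin> x ` {..<i}} \<longleftrightarrow> i \<in> insert 0 (Suc ` {i. i < L \<and> new i})"
      by (cases i) (simp_all add: new_def lessThan_Suc_atMost image_iff)
  qed
  also have "card \<dots> = Suc (card {i. i < L \<and> new i})"
    by (subst card_insert_disjoint) (auto simp: card_image)
  finally show ?thesis .
qed

lemma card_En: "card En = card {i. i < L \<and> \<not> seen i}"
  unfolding En_def seen_def by (rule card_image_first_times)

text \<open>A new edge either discovers a vertex or closes a cycle. The discovering edges form a
  spanning tree of the visited graph, so the others are counted by its cyclomatic number.\<close>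

lemma card_nf: "card {i. i < L \<and> \<not> new i \<and> \<not> seen i} = b"
proof -
  have "{i. i < L \<and> \<not> seen i} = {i. i < L \<and> new i} \<union> {i. i < L \<and> \<not> new i \<and> \<not> seen i}"
    using new_not_seen by auto
  then have "card En = card {i. i < L \<and> new i} + card {i. i < L \<and> \<not> new i \<and> \<not> seen i}"
    unfolding card_En by (simp add: card_Un_disjoint disjoint_iff)
  then show ?thesis unfolding b_def card_V by simp
qed

text \<open>Shows that the truncated subtraction in \<open>b_def\<close> is exact.\<close>

lemma card_En_V: "card En + 1 = card V + b"
  using card_nf card_V card_En
proof -
  have "card {i. i < L \<and> new i} \<le> card {i. i < L \<and> \<not> seen i}"
    using new_not_seen by (intro card_mono) auto
  then show ?thesis unfolding b_def card_V card_En by simp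
qed

lemma inj_second: "inj_on (walk_edge x) {i. i < L \<and> second i}"
proof (rule linorder_inj_onI)
  fix i j assume ij: "i < j" "i \<in> {i. i < L \<and> second i}" "j \<in> {i. i < L \<and> second i}"
  show "walk_edge x i \<noteq> walk_edge x j"
  proof
    assume eq: "walk_edge x i = walk_edge x j"
    obtain t where t: "t < i" "walk_edge x t = walk_edge x i"
      using second_seen[of i] ij unfolding seen_def by auto
    have "{t, i} \<subseteq> {t. t < j \<and> walk_edge x t = walk_edge x j}" using t ij(1) eq by auto
    then have "card {t, i} \<le> card {t. t < j \<and> walk_edge x t = walk_edge x j}" by (intro card_mono) auto
    then show False using ij(3) t(1) unfolding second_def by auto
  qed
qed auto

lemma card_second: "card {i. i < L \<and> second i} = card En"
proof -
  have "walk_edge x ` {i. i < L \<and> second i} = En"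
  proof
    show "En \<subseteq> walk_edge x ` {i. i < L \<and> second i}"
    proof
      fix e assume "e \<in> En"
      then obtain i where "i < L" "walk_edge x i = e" "card {t. t < i \<and> walk_edge x t = walk_edge x i} = 1"
        unfolding En_def by (rule obtain_second_time) (use doubled in auto)
      then show "e \<in> walk_edge x ` {i. i < L \<and> second i}" unfolding second_def by auto
    qed
  qed (auto simp: En_def)
  then show ?thesis using card_image[OF inj_second] by simp
qed

text \<open>In a doubled walk every edge has exactly one first and one second traversal, so all
  remaining steps are later ones.\<close>

lemma L_split: "L = 2 * card En + \<tau>"
  and card_third: "card {i. i < L \<and> seen i \<and> \<not> second i} = \<tau>"
proof -
  have "{..<L} = {i. i < L \<and> \<not> seen i} \<union> ({i. i < L \<and> second i} \<union> {i. i < L \<and> seen i \<and> \<not> second i})"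
    using second_seen by auto
  moreover have "card ({i. i < L \<and> \<not> seen i} \<union> ({i. i < L \<and> second i} \<union> {i. i < L \<and> seen i \<and> \<not> second i}))
      = card {i. i < L \<and> \<not> seen i}
      + card ({i. i < L \<and> second i} \<union> {i. i < L \<and> seen i \<and> \<not> second i})"
    by (rule card_Un_disjoint) (use second_seen in auto)
  ultimately have "card {..<L} = card {i. i < L \<and> \<not> seen i}
      + card ({i. i < L \<and> second i} \<union> {i. i < L \<and> seen i \<and> \<not> second i})"
    by metis
  also have "card ({i. i < L \<and> second i} \<union> {i. i < L \<and> seen i \<and> \<not> second i})
      = card {i. i < L \<and> second i} + card {i. i < L \<and> seen i \<and> \<not> second i}"
    by (rule card_Un_disjoint) auto
  finally have "L = 2 * card En + card {i. i < L \<and> seen i \<and> \<not> second i}"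
    using card_En card_second by simp
  then show "L = 2 * card En + \<tau>" "card {i. i < L \<and> seen i \<and> \<not> second i} = \<tau>"
    unfolding \<tau>_def by auto
qed

lemma card_V_pos: "0 < card V" using card_V by simp

lemma b_less: "b + 1 \<le> L"
proof -
  have "card V \<ge> 2" 
  proof -
    have "new 0" unfolding new_def using noloop[of 0] L_pos by auto
    then have "{0} \<subseteq> {i. i < L \<and> new i}" using L_pos by auto
    then have "card {0::nat} \<le> card {i. i < L \<and> new i}" by (intro card_mono) auto
    then show ?thesis using card_V by simp
  qed
  then have "b + 1 \<le> card En" using card_En_V by simp
  then show ?thesis using L_split by simp
qed

lemma handshake: "(\<Sum>v\<in>V. walk_deg v) = 2 * card En"
proof -
  have "(\<Sum>v\<in>V. walk_deg v) = (\<Sum>v\<in>V. \<Sum>e\<in>En. if incident v e then 1 else 0)"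
    unfolding walk_deg_def by (intro sum.cong refl) (simp add: sum.If_cases finite_En Int_def)
  also have "\<dots> = (\<Sum>e\<in>En. \<Sum>v\<in>V. if incident v e then 1 else 0)" by (rule sum.swap)
  also have "\<dots> = (\<Sum>e\<in>En. 2)"
  proof (rule sum.cong[OF refl])
    fix e assume "e \<in> En"
    then obtain t where t: "t < L" "e = edge_of (x t) (x (Suc t))" unfolding En_def walk_edge_def by auto
    have "V \<inter> {v. incident v e} = {x t, x (Suc t)}"
      unfolding t(2) incident_edge_of V_def using t(1) by auto
    then show "(\<Sum>v\<in>V. if incident v e then 1 else 0) = (2::nat)"
      using noloop[OF t(1)] by (simp add: sum.If_cases finite_V)
  qed
  finally show ?thesis by simp
qed

lemma walk_deg_ge_card:
  assumes "F \<subseteq> En" "\<And>e. e \<in> F \<Longrightarrow> incident v e"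
  shows "card F \<le> walk_deg v"
  unfolding walk_deg_def using assms finite_En by (intro card_mono) auto

lemma walk_deg_ge2:
  assumes "v \<in> V" "v \<noteq> x 0" "v \<noteq> x l"
  shows "2 \<le> walk_deg v"
proof -
  obtain t where t: "t \<le> L" "v = x t" using assms(1) unfolding V_def by auto
  have t': "0 < t" "t < L" "t \<noteq> l" using assms t closed by (auto intro: le_neq_trans Nat.gr0I)
  have "walk_edge x (t - 1) \<noteq> walk_edge x t"
    using nonback[OF t'] noloop[of t] t' unfolding walk_edge_def edge_of_eq_iff by auto
  then have "card {walk_edge x (t - 1), walk_edge x t} = 2" by simp
  moreover have "card {walk_edge x (t - 1), walk_edge x t} \<le> walk_deg v"
  proof (rule walk_deg_ge_card)
    show "{walk_edge x (t - 1), walk_edge x t} \<subseteq> En" unfolding En_def using t' by simp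
  qed (use t t' in \<open>auto simp: walk_edge_def incident_edge_of\<close>)
  ultimately show ?thesis by simp
qed

lemma walk_deg_ge1:
  assumes "v \<in> V"
  shows "1 \<le> walk_deg v"
proof -
  obtain t where t: "t \<le> L" "v = x t" using assms(1) unfolding V_def by auto
  obtain s where s: "s < L" "v = x s" 
    using t closed L_pos by (cases "t = L") (auto simp: le_less)
  have "card {walk_edge x s} \<le> walk_deg v"
    by (rule walk_deg_ge_card) (use s in \<open>auto simp: En_def walk_edge_def incident_edge_of\<close>)
  then show ?thesis by simp
qed

text \<open>By the handshake identity the untruncated sum of \<open>walk_deg v - 2\<close> is
  \<open>2 * b - 2\<close>. Truncation adds at most 1 for each of the vertices \<open>x 0\<close>
  and \<open>x l\<close>, the only ones that can have degree one.\<close>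

lemma sum_excess_deg: "(\<Sum>v\<in>V. excess_deg v) \<le> 2 * b"
proof -
  have "(\<Sum>v\<in>V. excess_deg v + 2) \<le> (\<Sum>v\<in>V. walk_deg v + ((if v = x 0 then 1 else 0) + (if v = x l then 1 else 0)))"
  proof (rule sum_mono)
    fix v assume "v \<in> V"
    then show "excess_deg v + 2 \<le> walk_deg v + ((if v = x 0 then 1 else 0) + (if v = x l then 1 else 0))"
      using walk_deg_ge2[of v] walk_deg_ge1[of v] unfolding excess_deg_def by auto
  qed
  also have "\<dots> \<le> 2 * card En + 2"
    by (simp add: sum.distrib handshake finite_V)
  finally have "(\<Sum>v\<in>V. excess_deg v) + 2 * card V \<le> 2 * card En + 2"
    by (simp only: sum.distrib) simp
  then show ?thesis using card_En_V by simp
qed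

lemma excess_deg_le: "v \<in> V \<Longrightarrow> excess_deg v \<le> 2 * b"
  using sum_excess_deg member_le_sum[of v V excess_deg] finite_V by force

lemma walk_deg_le: "v \<in> V \<Longrightarrow> walk_deg v \<le> 2 * b + 2"
  using excess_deg_le[of v] unfolding excess_deg_def by simp

text \<open>The edge of arrival is not among the options. Hence a vertex of degree two offers at
  most one forced move, which is what makes such steps free.\<close>

lemma card_opts_le:
  assumes i: "0 < i" "i < L" "i \<noteq> l"
  shows "card (opts i) + 1 \<le> walk_deg (x i)"
proof -
  let ?F = "edge_of (x i) ` opts i"
  have inj: "inj_on (edge_of (x i)) (opts i)"
    by (auto simp: inj_on_def edge_of_eq_iff)
  have notin: "walk_edge x (i - 1) \<notin> ?F"
    using i noloop[of "i - 1"] unfolding opts_def old_opts_def walk_edge_def by (auto simp: edge_of_eq_iff)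
  have "card (insert (walk_edge x (i - 1)) ?F) \<le> walk_deg (x i)"
  proof (rule walk_deg_ge_card)
    show "insert (walk_edge x (i - 1)) ?F \<subseteq> En"
      using i unfolding En_def opts_def old_opts_def by fastforce
    show "incident (x i) e" if "e \<in> insert (walk_edge x (i - 1)) ?F" for e
      using that i by (auto simp: walk_edge_def incident_edge_of)
  qed
  then show ?thesis using notin inj finite_opts by (simp add: card_image)
qed

lemma seen_opts:
  assumes "seen i" "i < L"
  shows "x (Suc i) \<in> opts i"
  using assms nonback[of i] unfolding seen_def opts_def old_opts_def by (auto simp: walk_edge_def)

text \<open>At the first such time, \<open>v\<close> already has two edges: the edge of arrival and
  the one leading to an option that is declined. Each of the counted steps adds a further edge at
  \<open>v\<close>.\<close>

lemma card_newbranch: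
  "card {i. i < L \<and> i \<noteq> l \<and> new i \<and> opts i \<noteq> {} \<and> x i = v} \<le> excess_deg v"
proof (cases "{i. i < L \<and> i \<noteq> l \<and> new i \<and> opts i \<noteq> {} \<and> x i = v} = {}")
  case False
  let ?S = "{i. i < L \<and> i \<noteq> l \<and> new i \<and> opts i \<noteq> {} \<and> x i = v}"
  define i where "i = Min ?S"
  have fin: "finite ?S" by simp
  have i: "i \<in> ?S" unfolding i_def by (rule Min_in[OF fin False])
  have imin: "\<And>j. j \<in> ?S \<Longrightarrow> i \<le> j" unfolding i_def by (rule Min_le[OF fin])
  obtain z where z: "z \<in> opts i" using i by auto
  have i0: "0 < i" using z unfolding opts_def old_opts_def by auto
  have zi: "edge_of (x i) z \<in> walk_edge x ` {..<i}" "z \<noteq> x (i - 1)"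
    using z i i0 unfolding opts_def old_opts_def by auto
  have ne: "walk_edge x (i - 1) \<noteq> edge_of (x i) z"
    using i0 zi(2) noloop[of "i - 1"] i unfolding walk_edge_def edge_of_eq_iff by auto
  have inj: "inj_on (walk_edge x) ?S"
  proof (rule linorder_inj_onI)
    fix j k assume jk: "j < k" "j \<in> ?S" "k \<in> ?S"
    then have "walk_edge x k \<notin> walk_edge x ` {..<k}" using new_not_seen[of k] unfolding seen_def by auto
    then show "walk_edge x j \<noteq> walk_edge x k" using jk(1) by (metis imageI lessThan_iff)
  qed auto
  let ?F = "{walk_edge x (i - 1), edge_of (x i) z} \<union> walk_edge x ` ?S"
  have disj: "{walk_edge x (i - 1), edge_of (x i) z} \<inter> walk_edge x ` ?S = {}"
  proof -
    have early: "e \<notin> walk_edge x ` {..<i}" if "e \<in> walk_edge x ` ?S" for e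
    proof -
      obtain j where j: "j \<in> ?S" "e = walk_edge x j" using \<open>e \<in> walk_edge x ` ?S\<close> by auto
      have "walk_edge x j \<notin> walk_edge x ` {..<j}" using new_not_seen[of j] j(1) unfolding seen_def by auto
      then show ?thesis using imin[OF j(1)] j(2) by auto
    qed
    have "walk_edge x (i - 1) \<in> walk_edge x ` {..<i}" using i0 by (intro imageI) simp
    then have "walk_edge x (i - 1) \<notin> walk_edge x ` ?S" "edge_of (x i) z \<notin> walk_edge x ` ?S"
      using early zi(1) by blast+
    then show ?thesis by blast
  qed
  have "card ?F \<le> walk_deg v"
  proof (rule walk_deg_ge_card)
    show "?F \<subseteq> En" using i i0 zi(1) unfolding En_def by fastforce
    show "incident v e" if "e \<in> ?F" for e
      using that i i0 by (auto simp: walk_edge_def incident_edge_of)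
  qed
  moreover have "card ?F = 2 + card ?S"
    using disj inj ne by (subst card_Un_disjoint) (auto simp: card_image)
  ultimately show ?thesis unfolding excess_deg_def by simp
next
  case True
  show ?thesis unfolding True by simp
qed

lemma card_second_at: "card {i. i < L \<and> i \<noteq> l \<and> second i \<and> x i = v} \<le> walk_deg v"
proof -
  let ?S = "{i. i < L \<and> i \<noteq> l \<and> second i \<and> x i = v}"
  have "card (walk_edge x ` ?S) \<le> walk_deg v"
    by (rule walk_deg_ge_card) (auto simp: En_def walk_edge_def incident_edge_of)
  moreover have "inj_on (walk_edge x) ?S" by (rule inj_on_subset[OF inj_second]) auto
  ultimately show ?thesis by (simp add: card_image)
qed


text \<open>An upper bound for the reciprocal of the kernel weight of a step, after the common
  factor \<open>1 - 1 / (2 * L)\<close> and the factor \<open>1 / n\<close> of a fresh vertex have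
  been taken out.\<close>

definition cost :: "nat \<Rightarrow> real" where
  "cost i = (if new i then (if opts i = {} then 1 else 4 * real L)
             else if seen i then real (card (opts i)) else 4 * (real L)\<^sup>2)"

lemma real_L: "real L \<ge> 1" using L_pos by simp

lemma n_pos: "0 < n" using x_less[of 0] by simp

lemma four_L: "4 * real L \<ge> 1" "4 * (real L)\<^sup>2 \<ge> 1" "4 * (real L)\<^sup>2 \<ge> 4 * real L"
  using real_L self_le_power[of "real L" 2] by (linarith, linarith, linarith)

lemma walk_kernel_cost:
  assumes i: "i < L" "i \<noteq> l"
  shows "(1 - 1 / (2 * real L)) * (if new i then 1 / real n else 1)
    \<le> walk_kernel n L l x i (x (Suc i)) * cost i" "cost i \<ge> 1"
proof -
  have L: "real L \<ge> 1" "real n > 0" using real_L n_pos by auto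
  have a: "0 \<le> 1 - 1 / (2 * real L)" "1 - 1 / (2 * real L) \<le> 1" using L by (auto simp: field_simps)
  consider (new) "new i" | (seen) "seen i" "\<not> new i" | (nf) "\<not> new i" "\<not> seen i"
    by auto
  then have "(1 - 1 / (2 * real L)) * (if new i then 1 / real n else 1)
    \<le> walk_kernel n L l x i (x (Suc i)) * cost i \<and> cost i \<ge> 1"
  proof cases
    case new
    then have 1: "x (Suc i) \<notin> x ` {..i}" "x (Suc i) \<notin> old_opts l x i"
      using old_opts_subset[of l x i] unfolding new_def by blast+
    have 2: "walk_kernel n L l x i (x (Suc i)) = (if opts i = {} then 1 - 1 / (2 * real L) else 1 / (4 * real L)) / real n"
      unfolding walk_kernel_def opts_def using 1 by simp
    show ?thesis unfolding 2 cost_def using new a L four_L by (auto simp: divide_right_mono)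
  next
    case seen
    have 1: "x (Suc i) \<in> opts i" by (rule seen_opts[OF seen(1) i(1)])
    then have "card (opts i) > 0" using finite_opts by (auto simp: card_gt_0_iff)
    then show ?thesis using 1 seen unfolding cost_def walk_kernel_def opts_def by auto
  next
    case nf
    then have 1: "x (Suc i) \<in> x ` {..i}" "x (Suc i) \<notin> old_opts l x i"
      unfolding new_def seen_def old_opts_def walk_edge_def by auto
    have 2: "walk_kernel n L l x i (x (Suc i)) = 1 / (4 * (real L)\<^sup>2)"
      unfolding walk_kernel_def using 1 by simp
    show ?thesis unfolding 2 cost_def using nf a L(2) four_L(2) L_pos by (simp add: field_simps)
  qed
  then show "(1 - 1 / (2 * real L)) * (if new i then 1 / real n else 1)
    \<le> walk_kernel n L l x i (x (Suc i)) * cost i" "cost i \<ge> 1" by auto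
qed

lemma walk_kernel_turn:
  "(1 - 1 / (2 * real L)) * (if new l then 1 / real n else 1)
    \<le> walk_kernel n L l x l (x (Suc l)) * (4 * (real L)\<^sup>2)"
proof -
  have l: "l < L" using l_pos L_def by simp
  have L: "real L \<ge> 1" "real n > 0" using real_L n_pos by auto
  have a: "0 \<le> 1 - 1 / (2 * real L)" "1 - 1 / (2 * real L) \<le> 1" using L by (auto simp: field_simps)
  consider (new) "new l" | (seen) "seen l" "\<not> new l" | (nf) "\<not> new l" "\<not> seen l"
    by auto
  then show ?thesis
  proof cases
    case new
    then have 1: "x (Suc l) \<notin> x ` {..l}" "x (Suc l) \<notin> old_opts l x l"
      using old_opts_subset[of l x l] unfolding new_def by blast+
    have 2: "walk_kernel n L l x l (x (Suc l)) = (if opts l = {} then 1 - 1 / (2 * real L) else 1 / (4 * real L)) / real n"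
      unfolding walk_kernel_def opts_def using 1 by simp
    have 3: "1 - 1 / (2 * real L) \<le> (1 - 1 / (2 * real L)) * (4 * (real L)\<^sup>2)"
      using mult_left_mono[OF four_L(2) a(1)] by simp
    have 4: "1 - 1 / (2 * real L) \<le> 1 / (4 * real L) * (4 * (real L)\<^sup>2)"
      using a(2) L(1) by (simp add: power2_eq_square) (use a(2) L(1) in linarith)
    show ?thesis unfolding 2 using new 3 4 L by (auto simp: divide_right_mono)
  next
    case seen
    have 1: "x (Suc l) \<in> opts l" by (rule seen_opts[OF seen(1) l])
    then have pos: "card (opts l) > 0" using finite_opts by (auto simp: card_gt_0_iff)
    have "card (opts l) \<le> Suc l"
      using card_mono[OF _ opts_subset[of l]] card_image_le[of "{..l}" x] by simp
    then have le: "real (card (opts l)) \<le> 4 * (real L)\<^sup>2" using l four_L(3) by linarith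
    have "(1 - 1 / (2 * real L)) * real (card (opts l)) \<le> (1 - 1 / (2 * real L)) * (4 * (real L)\<^sup>2)"
      by (rule mult_left_mono[OF le a(1)])
    then show ?thesis using 1 seen pos unfolding walk_kernel_def opts_def by (simp add: pos_le_divide_eq)
  next
    case nf
    then have 1: "x (Suc l) \<in> x ` {..l}" "x (Suc l) \<notin> old_opts l x l"
      unfolding new_def seen_def old_opts_def walk_edge_def by auto
    have 2: "walk_kernel n L l x l (x (Suc l)) = 1 / (4 * (real L)\<^sup>2)"
      unfolding walk_kernel_def using 1 by simp
    show ?thesis unfolding 2 using nf a L four_L by auto
  qed
qed

lemma prod_if_const:
  fixes k :: real
  assumes "finite S"
  shows "(\<Prod>i\<in>S. if P i then k else 1) = k ^ card {i \<in> S. P i}"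
  using assms by (simp add: prod.If_cases Int_def)

text \<open>A vertex of degree \<open>d\<close> is left at most \<open>d\<close> times on a second
  traversal, at cost at most \<open>d\<close> each. Only the excess \<open>d - 2\<close> sums to a
  multiple of \<open>b\<close>, so the exponent \<open>d\<close> has to be traded for
  \<open>d - 2\<close>: \<open>d\<^sup>2\<close> is at most \<open>9 ^ (d - 2)\<close>, and
  \<open>d \<le> 2 * b + 2 \<le> 2 * L\<close>.\<close>

lemma pow_deg_le:
  assumes "3 \<le> d" "d \<le> 2 * b + 2"
  shows "real d ^ d \<le> (18 * real L) ^ (d - 2)"
proof -
  have sq: "(real (k + 3))\<^sup>2 \<le> 9 ^ (k + 1)" for k :: nat
  proof (induction k)
    case (Suc k)
    have "(real (Suc k + 3))\<^sup>2 \<le> 9 * (real (k + 3))\<^sup>2"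
      by (simp add: power2_eq_square algebra_simps)
    then show ?case using Suc by simp
  qed simp
  obtain k where d: "d = k + 3" using assms(1) by (metis add.commute le_iff_add)
  have "real d ^ d = (real d)\<^sup>2 * real d ^ (d - 2)"
    unfolding d by (simp add: power_add power2_eq_square power3_eq_cube)
  also have "\<dots> \<le> 9 ^ (d - 2) * real d ^ (d - 2)"
    using sq[of k] unfolding d by (intro mult_right_mono) auto
  also have "\<dots> = (9 * real d) ^ (d - 2)" by (simp add: power_mult_distrib)
  also have "\<dots> \<le> (18 * real L) ^ (d - 2)"
  proof (rule power_mono)
    have "d \<le> 2 * L" using assms(2) b_less by simp
    then show "9 * real d \<le> 18 * real L" by linarith
  qed simp
  finally show ?thesis .
qed

text \<open>Every cost above 1 is charged to something: closing a cycle to \<open>b\<close>, a new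
  branch and a second traversal to the excess degree of the vertex left, a later traversal to
  \<tau>. The excess degrees sum to at most \<open>2 * b\<close>, and
  \<open>20736 = 4 * 4 ^ 2 * 18 ^ 2\<close>.\<close>

lemma prod_cost:
  "(\<Prod>i\<in>{..<L} - {l}. cost i) \<le> (20736 * real L ^ 6) ^ b * (2 * real b + 1) ^ \<tau>"
proof -
  let ?S = "{..<L} - {l}"
  define nf where "nf i = (if \<not> new i \<and> \<not> seen i then 4 * (real L)\<^sup>2 else 1)" for i
  define nb where "nb i = (if new i \<and> opts i \<noteq> {} then 4 * real L else 1)" for i
  define sc where "sc i = (if second i then real (card (opts i)) else 1)" for i
  define tc where "tc i = (if seen i \<and> \<not> second i then 2 * real b + 1 else 1)" for i
  have fin: "finite ?S" by simp
  have seen0: "0 < i" if "seen i" for i using that unfolding seen_def by auto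
  have deg: "real (card (opts i)) + 1 \<le> real (walk_deg (x i))" if "seen i" "i \<in> ?S" for i
    using card_opts_le[of i] seen0[OF that(1)] that(2)
    by (metis DiffE insertI1 lessThan_iff of_nat_1 of_nat_add of_nat_mono singletonI)
  have xV: "x i \<in> V" if "i < L" for i using that unfolding V_def by auto
  have sc1: "1 \<le> sc i" if "i \<in> ?S" for i
  proof (cases "second i")
    case True
    then have "x (Suc i) \<in> opts i" using seen_opts[of i] second_seen[of i] that by auto
    then have "card (opts i) > 0" using finite_opts by (auto simp: card_gt_0_iff)
    then show ?thesis unfolding sc_def by simp
  qed (simp add: sc_def)
  have "(\<Prod>i\<in>?S. cost i) \<le> (\<Prod>i\<in>?S. nf i * nb i * sc i * tc i)"
  proof (rule prod_mono, intro conjI)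
    fix i assume i: "i \<in> ?S"
    show "0 \<le> cost i" unfolding cost_def by auto
    have third: "real (card (opts i)) \<le> 2 * real b + 1" if "seen i"
    proof -
      have "walk_deg (x i) \<le> 2 * b + 2" using walk_deg_le xV i by auto
      then have "real (walk_deg (x i)) \<le> real (2 * b + 2)" by (rule of_nat_mono)
      then show ?thesis using deg[OF that i] by simp
    qed
    show "cost i \<le> nf i * nb i * sc i * tc i"
      using third second_seen[of i] new_not_seen[of i] unfolding cost_def nf_def nb_def sc_def tc_def
      by auto
  qed
  also have "\<dots> = (\<Prod>i\<in>?S. nf i) * (\<Prod>i\<in>?S. nb i) * (\<Prod>i\<in>?S. sc i) * (\<Prod>i\<in>?S. tc i)"
    by (simp add: prod.distrib)
  also have "\<dots> \<le> (4 * (real L)\<^sup>2) ^ b * (4 * real L) ^ (2 * b) * (18 * real L) ^ (2 * b)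
       * (2 * real b + 1) ^ \<tau>"
  proof (intro mult_mono)
    have "card {i \<in> ?S. \<not> new i \<and> \<not> seen i} \<le> card {i. i < L \<and> \<not> new i \<and> \<not> seen i}"
      by (intro card_mono) auto
    then show "(\<Prod>i\<in>?S. nf i) \<le> (4 * (real L)\<^sup>2) ^ b"
      unfolding nf_def prod_if_const[OF fin] card_nf by (rule power_increasing[OF _ four_L(2)])
    have "card {i \<in> ?S. seen i \<and> \<not> second i} \<le> card {i. i < L \<and> seen i \<and> \<not> second i}"
      by (intro card_mono) auto
    then show "(\<Prod>i\<in>?S. tc i) \<le> (2 * real b + 1) ^ \<tau>"
      unfolding tc_def prod_if_const[OF fin] card_third by (intro power_increasing) auto
    have "card {i \<in> ?S. new i \<and> opts i \<noteq> {}}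
        = (\<Sum>v\<in>V. card {i. i < L \<and> i \<noteq> l \<and> new i \<and> opts i \<noteq> {} \<and> x i = v})"
    proof -
      have "{i \<in> ?S. new i \<and> opts i \<noteq> {}}
          = (\<Union>v\<in>V. {i. i < L \<and> i \<noteq> l \<and> new i \<and> opts i \<noteq> {} \<and> x i = v})"
        using xV by auto
      then show ?thesis by (simp only:) (rule card_UN_disjoint; use finite_V in auto)
    qed
    also have "\<dots> \<le> (\<Sum>v\<in>V. excess_deg v)" by (intro sum_mono card_newbranch)
    also note sum_excess_deg
    finally show "(\<Prod>i\<in>?S. nb i) \<le> (4 * real L) ^ (2 * b)"
      unfolding nb_def prod_if_const[OF fin] using four_L by (intro power_increasing) auto
    have "(\<Prod>i\<in>?S. sc i) = (\<Prod>v\<in>V. \<Prod>i\<in>{i \<in> ?S. x i = v}. sc i)"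
      by (rule prod.group[symmetric]) (use finite_V xV in auto)
    also have "\<dots> \<le> (\<Prod>v\<in>V. (18 * real L) ^ excess_deg v)"
    proof (rule prod_mono, intro conjI)
      fix v assume v: "v \<in> V"
      let ?T = "{i \<in> ?S. x i = v}"
      show "0 \<le> (\<Prod>i\<in>?T. sc i)" by (intro prod_nonneg) (use sc1 in \<open>force intro: order_trans[of 0 1]\<close>)
      show "(\<Prod>i\<in>?T. sc i) \<le> (18 * real L) ^ excess_deg v"
      \<comment> \<open>At a vertex of degree at most two a second traversal has a single option, so
        all its factors are 1.\<close>
      proof (cases "walk_deg v \<ge> 3")
        case True
        have "(\<Prod>i\<in>?T. sc i) \<le> (\<Prod>i\<in>?T. if second i then real (walk_deg v) else 1)"
        proof (rule prod_mono, intro conjI)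
          fix i assume i: "i \<in> ?T"
          then show "0 \<le> sc i" using sc1[of i] by auto
          show "sc i \<le> (if second i then real (walk_deg v) else 1)"
            using i deg[of i] second_seen[of i] unfolding sc_def by auto
        qed
        also have "\<dots> = real (walk_deg v) ^ card {i \<in> ?T. second i}" by (rule prod_if_const) simp
        also have "\<dots> \<le> real (walk_deg v) ^ walk_deg v"
        proof (rule power_increasing)
          have "{i \<in> ?T. second i} = {i. i < L \<and> i \<noteq> l \<and> second i \<and> x i = v}" by auto
          then show "card {i \<in> ?T. second i} \<le> walk_deg v" using card_second_at by simp
        qed (use True in simp)
        also have "\<dots> \<le> (18 * real L) ^ excess_deg v"
          unfolding excess_deg_def by (rule pow_deg_le[OF True walk_deg_le[OF v]])
        finally show ?thesis .
      next
        case False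
        have "(\<Prod>i\<in>?T. sc i) \<le> (\<Prod>i\<in>?T. 1)"
        proof (rule prod_mono, intro conjI)
          fix i assume i: "i \<in> ?T"
          then show "0 \<le> sc i" using sc1[of i] by auto
          show "sc i \<le> 1"
            using i deg[of i] second_seen[of i] False unfolding sc_def by auto
        qed
        also have "(\<Prod>i\<in>?T. 1) = (1::real)" by simp
        also have "1 \<le> (18 * real L) ^ excess_deg v" by (rule one_le_power) (use real_L in simp)
        finally show ?thesis .
      qed
    qed
    also have "\<dots> = (18 * real L) ^ (\<Sum>v\<in>V. excess_deg v)" by (simp add: power_sum)
    also have "\<dots> \<le> (18 * real L) ^ (2 * b)" using real_L sum_excess_deg by (intro power_increasing) auto
    finally show "(\<Prod>i\<in>?S. sc i) \<le> (18 * real L) ^ (2 * b)" .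
  qed (use sc1 in \<open>force intro!: prod_nonneg mult_nonneg_nonneg intro: order_trans[of 0 1]
         simp: nf_def nb_def tc_def\<close>)+
  also have "(4 * (real L)\<^sup>2) ^ b * (4 * real L) ^ (2 * b) * (18 * real L) ^ (2 * b)
      = (20736 * real L ^ 6) ^ b"
  proof -
    have "(4 * (real L)\<^sup>2) ^ b * (4 * real L) ^ (2 * b) * (18 * real L) ^ (2 * b)
      = ((4 * (real L)\<^sup>2) * (4 * real L)\<^sup>2 * (18 * real L)\<^sup>2) ^ b"
      by (simp only: power_mult power_mult_distrib)
    also have "(4 * (real L)\<^sup>2) * (4 * real L)\<^sup>2 * (18 * real L)\<^sup>2 = 20736 * real L ^ 6"
      by (simp add: power_mult_distrib flip: power_add)
    finally show ?thesis .
  qed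
  finally show ?thesis .
qed

lemma path_mass_ge:
  "1 \<le> 2 * real n ^ (card V - 1) * (4 * (real L)\<^sup>2 * ((20736 * real L ^ 6) ^ b * (2 * real b + 1) ^ \<tau>))
      * (\<Prod>i<L. walk_kernel n L l x i (x (Suc i)))"
proof -
  let ?k = "\<lambda>i. walk_kernel n L l x i (x (Suc i))"
  have l: "l \<in> {..<L}" using l_pos L_def by simp
  have n: "real n > 0" using n_pos by simp
  have k0: "\<And>i. ?k i \<ge> 0" using walk_kernel_nonneg L_pos by simp
  \<comment> \<open>Bernoulli's inequality turns the \<open>L\<close> losses of
    \<open>1 / (2 * L)\<close> into the single factor 2 of the claim.\<close>
  have "1 / 2 \<le> 1 + real L * (- (1 / (2 * real L)))" using real_L by simp
  also have "\<dots> \<le> (1 + (- (1 / (2 * real L)))) ^ L"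
    by (rule Bernoulli_inequality) (use real_L in \<open>simp add: field_simps\<close>)
  finally have half: "1 / 2 \<le> (1 - 1 / (2 * real L)) ^ L" by simp
  have "(\<Prod>i<L. (1 - 1 / (2 * real L)) * (if new i then 1 / real n else 1))
     = (1 - 1 / (2 * real L)) ^ L * (1 / real n) ^ (card V - 1)"
    by (simp add: prod.distrib prod_if_const card_V)
  also have "(1 / real n) ^ (card V - 1) = 1 / real n ^ (card V - 1)" by (simp add: power_one_over)
  finally have eq: "(\<Prod>i<L. (1 - 1 / (2 * real L)) * (if new i then 1 / real n else 1))
     = (1 - 1 / (2 * real L)) ^ L / real n ^ (card V - 1)" by simp
  have a: "0 \<le> 1 - 1 / (2 * real L)" using real_L by (simp add: field_simps)
  have "(\<Prod>i<L. (1 - 1 / (2 * real L)) * (if new i then 1 / real n else 1))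
     \<le> (\<Prod>i<L. ?k i * (if i = l then 4 * (real L)\<^sup>2 else cost i))"
  proof (rule prod_mono, intro conjI)
    fix i assume "i \<in> {..<L}"
    then show "(1 - 1 / (2 * real L)) * (if new i then 1 / real n else 1)
        \<le> ?k i * (if i = l then 4 * (real L)\<^sup>2 else cost i)"
      using walk_kernel_cost(1)[of i] walk_kernel_turn by (cases "i = l") simp_all
  qed (use a in simp)
  also have "\<dots> = (\<Prod>i<L. ?k i) * (4 * (real L)\<^sup>2 * (\<Prod>i\<in>{..<L} - {l}. cost i))"
    using l by (simp add: prod.distrib prod.remove)
  also have "\<dots> \<le> (\<Prod>i<L. ?k i) * (4 * (real L)\<^sup>2 * ((20736 * real L ^ 6) ^ b * (2 * real b + 1) ^ \<tau>))"
    by (intro mult_left_mono prod_cost prod_nonneg) (auto simp: k0)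
  finally have *: "(1 - 1 / (2 * real L)) ^ L / real n ^ (card V - 1)
    \<le> (\<Prod>i<L. ?k i) * (4 * (real L)\<^sup>2 * ((20736 * real L ^ 6) ^ b * (2 * real b + 1) ^ \<tau>))"
    unfolding eq .
  have "1 / 2 / real n ^ (card V - 1) \<le> (1 - 1 / (2 * real L)) ^ L / real n ^ (card V - 1)"
    by (rule divide_right_mono[OF half]) simp
  from this and * have "1 / 2 / real n ^ (card V - 1)
    \<le> (\<Prod>i<L. ?k i) * (4 * (real L)\<^sup>2 * ((20736 * real L ^ 6) ^ b * (2 * real b + 1) ^ \<tau>))" by simp
  then show ?thesis using n by (simp add: field_simps)
qed

text \<open>From \<open>card En = card V - 1 + b\<close> and
  \<open>2 * l = 2 * card En + \<tau>\<close>, each independent cycle yields a factor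
  \<open>1 / n\<close> and each surplus traversal a factor \<open>1 / sqrt \<rho>\<close>. The
  hypothesis \<open>small\<close> says that these gains pay for the costs.\<close>

lemma edge_weight_le:
  fixes p \<rho> :: real
  assumes p: "0 < p" and rho: "\<rho> = real n * p"
    and small: "(20736 * real L ^ 6 / real n) ^ b * ((2 * real b + 1) / sqrt \<rho>) ^ \<tau> \<le> 1"
  shows "p ^ card En \<le> 8 * (real L)\<^sup>2 * \<rho> ^ l * (\<Prod>i<L. walk_kernel n L l x i (x (Suc i)))"
proof -
  let ?W = "\<Prod>i<L. walk_kernel n L l x i (x (Suc i))"
  have n: "real n > 0" using n_pos by simp
  have r: "\<rho> > 0" using rho n p by simp
  have W0: "?W \<ge> 0" by (intro prod_nonneg) (use walk_kernel_nonneg L_pos in auto)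
  have l2: "2 * l = 2 * card En + \<tau>" using L_split L_def by simp
  have "\<rho> ^ card En * sqrt \<rho> ^ \<tau> = sqrt \<rho> ^ (2 * card En + \<tau>)"
    using r by (simp add: power_add power_mult)
  also have "\<dots> = \<rho> ^ l" unfolding l2[symmetric] using r by (simp add: power_mult)
  finally have e1: "\<rho> ^ card En = \<rho> ^ l / sqrt \<rho> ^ \<tau>" using r by (simp add: field_simps)
  have "card En = card V - 1 + b" using card_En_V card_V_pos by simp
  then have e2: "p ^ card En * real n ^ (card V - 1) = \<rho> ^ card En / real n ^ b"
    unfolding rho using n by (simp add: power_mult_distrib power_add)
  have "p ^ card En * 1 \<le> p ^ card En * (2 * real n ^ (card V - 1) *
      (4 * (real L)\<^sup>2 * ((20736 * real L ^ 6) ^ b * (2 * real b + 1) ^ \<tau>)) * ?W)"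
    by (rule mult_left_mono[OF path_mass_ge]) (use p in simp)
  also have "\<dots> = (p ^ card En * real n ^ (card V - 1)) * (8 * (real L)\<^sup>2 *
      ((20736 * real L ^ 6) ^ b * (2 * real b + 1) ^ \<tau>) * ?W)"
    by (simp add: mult_ac)
  also have "\<dots> = 8 * (real L)\<^sup>2 * \<rho> ^ l *
      ((20736 * real L ^ 6 / real n) ^ b * ((2 * real b + 1) / sqrt \<rho>) ^ \<tau>) * ?W"
    unfolding e2 e1 by (simp add: power_divide mult_ac)
  also have "\<dots> \<le> 8 * (real L)\<^sup>2 * \<rho> ^ l * 1 * ?W"
    by (intro mult_right_mono mult_left_mono small) (use r W0 in auto)
  finally show ?thesis by simp
qed

end

section \<open>Moments of the weighted non-backtracking matrix\<close>

definition er_exp :: "nat \<Rightarrow> real \<Rightarrow> ((nat \<times> nat) set \<Rightarrow> real) \<Rightarrow> real" where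
  "er_exp n p g = (\<Sum>E\<in>Pow (pairs n). p ^ card E * (1 - p) ^ (card (pairs n) - card E) * g E)"

lemma finite_pairs: "finite (pairs n)"
  by (rule finite_subset[of _ "{..<n} \<times> {..<n}"]) (auto simp: pairs_def)

lemma edge_of_in_pairs: "a < n \<Longrightarrow> b < n \<Longrightarrow> a \<noteq> b \<Longrightarrow> edge_of a b \<in> pairs n"
  unfolding pairs_def edge_of_def by auto

lemma er_prob_eq_exp: "er_prob n p Q = er_exp n p (\<lambda>E. if Q E then 1 else 0)"
  unfolding er_prob_def er_exp_def by (intro sum.cong) auto

lemma er_exp_mono:
  assumes "0 \<le> p" "p \<le> 1" "\<And>E. E \<subseteq> pairs n \<Longrightarrow> g E \<le> h E"
  shows "er_exp n p g \<le> er_exp n p h"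
  unfolding er_exp_def using assms by (intro sum_mono mult_left_mono) auto

lemma er_exp_cong:
  assumes "\<And>E. E \<subseteq> pairs n \<Longrightarrow> g E = h E"
  shows "er_exp n p g = er_exp n p h"
  unfolding er_exp_def using assms by (intro sum.cong) auto

lemma er_exp_sum: "er_exp n p (\<lambda>E. \<Sum>i\<in>I. g i E) = (\<Sum>i\<in>I. er_exp n p (g i))"
  unfolding er_exp_def sum_distrib_left by (rule sum.swap)

lemma er_exp_cmult: "er_exp n p (\<lambda>E. c * g E) = c * er_exp n p g"
  unfolding er_exp_def sum_distrib_left by (intro sum.cong) auto

lemma er_exp_zero: "er_exp n p (\<lambda>E. 0) = 0"
  unfolding er_exp_def by simp

lemma er_prob_mono:
  assumes "0 \<le> p" "p \<le> 1" "\<And>E. E \<subseteq> pairs n \<Longrightarrow> Q E \<Longrightarrow> R E"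
  shows "er_prob n p Q \<le> er_prob n p R"
  unfolding er_prob_eq_exp by (rule er_exp_mono) (use assms in auto)

lemma er_prob_nonneg:
  assumes "0 \<le> p" "p \<le> 1"
  shows "0 \<le> er_prob n p Q"
  unfolding er_prob_def using assms by (intro sum_nonneg) auto

lemma er_prob_disj:
  assumes "0 \<le> p" "p \<le> 1"
  shows "er_prob n p (\<lambda>E. Q E \<or> R E) \<le> er_prob n p Q + er_prob n p R"
proof -
  have "er_prob n p Q + er_prob n p R
      = er_exp n p (\<lambda>E. (if Q E then 1 else 0) + (if R E then 1 else 0))"
    unfolding er_prob_eq_exp er_exp_def by (simp add: sum.distrib ring_distribs)
  also have "er_prob n p (\<lambda>E. Q E \<or> R E) \<le> \<dots>"
    unfolding er_prob_eq_exp by (rule er_exp_mono) (use assms in auto)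
  finally show ?thesis .
qed

lemma er_prob_Ex:
  assumes "0 \<le> p" "p \<le> 1" "finite I"
  shows "er_prob n p (\<lambda>E. \<exists>i\<in>I. Q i E) \<le> (\<Sum>i\<in>I. er_prob n p (Q i))"
  unfolding er_prob_eq_exp er_exp_sum[symmetric]
proof (rule er_exp_mono)
  fix E assume "E \<subseteq> pairs n"
  show "(if \<exists>i\<in>I. Q i E then 1 else 0) \<le> (\<Sum>i\<in>I. if Q i E then 1 else (0::real))"
  proof (cases "\<exists>i\<in>I. Q i E")
    case True
    then obtain i where "i \<in> I" "Q i E" by auto
    then show ?thesis using member_le_sum[of i I "\<lambda>i. if Q i E then 1 else (0::real)"] assms(3) by auto
  qed (simp add: sum_nonneg)
qed (use assms in auto)

lemma er_markov:
  assumes p: "0 \<le> p" "p \<le> 1" and t: "0 < t" and g: "\<And>E. E \<subseteq> pairs n \<Longrightarrow> 0 \<le> g E"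
  shows "er_prob n p (\<lambda>E. t \<le> g E) \<le> er_exp n p g / t"
proof -
  have "er_prob n p (\<lambda>E. t \<le> g E) \<le> er_exp n p (\<lambda>E. (1 / t) * g E)"
    unfolding er_prob_eq_exp by (rule er_exp_mono) (use p t g in \<open>auto simp: field_simps\<close>)
  then show ?thesis unfolding er_exp_cmult by simp
qed

text \<open>This is the independence of the edges: expanding the product over all pairs gives the
  sum over edge sets.\<close>

lemma er_exp_prod:
  "er_exp n p (\<lambda>E. \<Prod>e\<in>pairs n. if e \<in> E then u e else w e) = (\<Prod>e\<in>pairs n. p * u e + (1 - p) * w e)"
proof -
  have "(\<Prod>e\<in>pairs n. p * u e + (1 - p) * w e)
     = (\<Sum>E\<in>Pow (pairs n). (\<Prod>e\<in>E. p * u e) * (\<Prod>e\<in>pairs n - E. (1 - p) * w e))"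
    by (rule prod_add[OF finite_pairs])
  also have "\<dots> = er_exp n p (\<lambda>E. \<Prod>e\<in>pairs n. if e \<in> E then u e else w e)"
    unfolding er_exp_def
  proof (rule sum.cong[OF refl])
    fix E assume "E \<in> Pow (pairs n)"
    then have E: "E \<subseteq> pairs n" by simp
    then have fin: "finite E" using finite_pairs finite_subset by blast
    have "(\<Prod>e\<in>pairs n. if e \<in> E then u e else w e) = (\<Prod>e\<in>E. u e) * (\<Prod>e\<in>pairs n - E. w e)"
      using E finite_pairs by (simp add: prod.If_cases Int_absorb1 Diff_eq)
    then show "(\<Prod>e\<in>E. p * u e) * (\<Prod>e\<in>pairs n - E. (1 - p) * w e)
      = p ^ card E * (1 - p) ^ (card (pairs n) - card E) * (\<Prod>e\<in>pairs n. if e \<in> E then u e else w e)"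
      using E fin by (simp add: prod.distrib card_Diff_subset mult_ac)
  qed
  finally show ?thesis ..
qed

section \<open>Walk moments of the centered adjacency matrix\<close>

definition centered_adj :: "real \<Rightarrow> (nat \<times> nat) set \<Rightarrow> nat \<Rightarrow> nat \<Rightarrow> real" where
  "centered_adj p E i j = (if i = j then 0 else if edge_of i j \<in> E then 1 - p else - p)"

lemma centered_adj_sym: "centered_adj p E i j = centered_adj p E j i"
  unfolding centered_adj_def by (auto simp: edge_of_commute)

lemma centered_adj_abs: "0 \<le> p \<Longrightarrow> p \<le> 1 \<Longrightarrow> \<bar>centered_adj p E i j\<bar> \<le> 1"
  unfolding centered_adj_def by auto

lemma centered_moment_bound:
  fixes p :: real
  assumes "0 \<le> p" "p \<le> 1" "2 \<le> m"
  shows "\<bar>p * (1 - p) ^ m + (1 - p) * (- p) ^ m\<bar> \<le> p"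
proof -
  obtain k where m: "m = Suc (Suc k)" using assms(3) by (metis Suc_le_D numeral_2_eq_2 Suc_le_mono)
  have "\<bar>p * (1 - p) ^ m + (1 - p) * (- p) ^ m\<bar> \<le> p * (1 - p) ^ m + (1 - p) * p ^ m"
    using assms by (intro order_trans[OF abs_triangle_ineq]) (simp add: abs_mult power_abs)
  also have "\<dots> = p * (1 - p) * ((1 - p) ^ Suc k + p ^ Suc k)"
    unfolding m by (simp add: algebra_simps)
  also have "\<dots> \<le> p * (1 - p) * ((1 - p) + p)"
    by (intro mult_left_mono add_mono)
      (use assms power_decreasing[of 1 "Suc k" p] power_decreasing[of 1 "Suc k" "1 - p"] in auto)
  also have "\<dots> \<le> p * 1" using assms by (simp add: mult_left_le)
  finally show ?thesis by simp
qed

text \<open>Grouping the steps by edges factorizes the expectation. An edge used once contributes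
  its mean 0, and an edge used at least twice contributes at most \<open>p\<close> in absolute
  value, whatever its multiplicity.\<close>

lemma er_exp_walk:
  assumes p: "0 \<le> p" "p \<le> 1" and \<omega>: "\<And>t. t \<le> L \<Longrightarrow> \<omega> t < n"
  shows "er_exp n p (\<lambda>E. \<Prod>t<L. centered_adj p E (\<omega> t) (\<omega> (Suc t)))
    \<le> (if (\<forall>t<L. \<omega> t \<noteq> \<omega> (Suc t)) \<and> (\<forall>t<L. \<exists>s<L. s \<noteq> t \<and> walk_edge \<omega> s = walk_edge \<omega> t)
        then p ^ card (walk_edge \<omega> ` {..<L}) else 0)"
proof (cases "\<forall>t<L. \<omega> t \<noteq> \<omega> (Suc t)")
  case False
  then obtain t where "t < L" "\<omega> t = \<omega> (Suc t)" by auto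
  then have "(\<Prod>t<L. centered_adj p E (\<omega> t) (\<omega> (Suc t))) = 0" for E
    by (intro prod_zero) (auto simp: centered_adj_def)
  then have "er_exp n p (\<lambda>E. \<Prod>t<L. centered_adj p E (\<omega> t) (\<omega> (Suc t))) = 0"
    by (simp only: er_exp_zero)
  then show ?thesis using False by (simp only: simp_thms if_False order_refl)
next
  case True
  define m where "m e = card {t. t < L \<and> walk_edge \<omega> t = e}" for e
  have inp: "walk_edge \<omega> t \<in> pairs n" if "t < L" for t
    unfolding walk_edge_def using that \<omega>[of t] \<omega>[of "Suc t"] True by (intro edge_of_in_pairs) auto
  have "er_exp n p (\<lambda>E. \<Prod>t<L. centered_adj p E (\<omega> t) (\<omega> (Suc t)))
     = er_exp n p (\<lambda>E. \<Prod>e\<in>pairs n. if e \<in> E then (1 - p) ^ m e else (- p) ^ m e)"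
  proof (rule er_exp_cong)
    fix E
    have "(\<Prod>t<L. centered_adj p E (\<omega> t) (\<omega> (Suc t))) = (\<Prod>t<L. if walk_edge \<omega> t \<in> E then 1 - p else - p)"
      using True by (intro prod.cong) (auto simp: centered_adj_def walk_edge_def)
    also have "\<dots> = (\<Prod>e\<in>pairs n. \<Prod>t\<in>{t \<in> {..<L}. walk_edge \<omega> t = e}. if walk_edge \<omega> t \<in> E then 1 - p else - p)"
      by (rule prod.group[symmetric]) (use inp finite_pairs in auto)
    also have "\<dots> = (\<Prod>e\<in>pairs n. if e \<in> E then (1 - p) ^ m e else (- p) ^ m e)"
    proof (rule prod.cong[OF refl])
      fix e
      have "(\<Prod>t\<in>{t \<in> {..<L}. walk_edge \<omega> t = e}. if walk_edge \<omega> t \<in> E then 1 - p else - p)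
         = (\<Prod>t\<in>{t \<in> {..<L}. walk_edge \<omega> t = e}. if e \<in> E then 1 - p else - p)"
        by (intro prod.cong) auto
      then show "(\<Prod>t\<in>{t \<in> {..<L}. walk_edge \<omega> t = e}. if walk_edge \<omega> t \<in> E then 1 - p else - p)
         = (if e \<in> E then (1 - p) ^ m e else (- p) ^ m e)"
        unfolding m_def by simp
    qed
    finally show "(\<Prod>t<L. centered_adj p E (\<omega> t) (\<omega> (Suc t)))
      = (\<Prod>e\<in>pairs n. if e \<in> E then (1 - p) ^ m e else (- p) ^ m e)" .
  qed
  also have "\<dots> = (\<Prod>e\<in>pairs n. p * (1 - p) ^ m e + (1 - p) * (- p) ^ m e)"
    by (rule er_exp_prod)
  finally have eq: "er_exp n p (\<lambda>E. \<Prod>t<L. centered_adj p E (\<omega> t) (\<omega> (Suc t)))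
     = (\<Prod>e\<in>pairs n. p * (1 - p) ^ m e + (1 - p) * (- p) ^ m e)" .
  have m0: "m e = 0 \<longleftrightarrow> e \<notin> walk_edge \<omega> ` {..<L}" for e
    unfolding m_def by (subst card_0_eq) (auto simp: image_iff)
  show ?thesis
  proof (cases "\<forall>t<L. \<exists>s<L. s \<noteq> t \<and> walk_edge \<omega> s = walk_edge \<omega> t")
    case False
    then obtain t where t: "t < L" "\<And>s. s < L \<Longrightarrow> s \<noteq> t \<Longrightarrow> walk_edge \<omega> s \<noteq> walk_edge \<omega> t" by auto
    then have "{s. s < L \<and> walk_edge \<omega> s = walk_edge \<omega> t} = {t}" by auto
    then have "m (walk_edge \<omega> t) = 1" unfolding m_def by simp
    then have "(\<Prod>e\<in>pairs n. p * (1 - p) ^ m e + (1 - p) * (- p) ^ m e) = 0"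
      by (intro prod_zero finite_pairs bexI[OF _ inp[OF t(1)]]) simp
    then show ?thesis unfolding eq using p by simp
  next
    case dbl: True
    have m2: "2 \<le> m e" if "e \<in> walk_edge \<omega> ` {..<L}" for e
    proof -
      obtain t where t: "t < L" "e = walk_edge \<omega> t" using \<open>e \<in> walk_edge \<omega> ` {..<L}\<close> by auto
      then obtain s where s: "s < L" "s \<noteq> t" "walk_edge \<omega> s = walk_edge \<omega> t" using dbl by auto
      have "card {s, t} \<le> m e" unfolding m_def by (rule card_mono) (use s t in auto)
      then show ?thesis using s(2) by simp
    qed
    have "(\<Prod>e\<in>pairs n. p * (1 - p) ^ m e + (1 - p) * (- p) ^ m e)
      \<le> \<bar>\<Prod>e\<in>pairs n. p * (1 - p) ^ m e + (1 - p) * (- p) ^ m e\<bar>" by simp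
    also have "\<dots> \<le> (\<Prod>e\<in>pairs n. if e \<in> walk_edge \<omega> ` {..<L} then p else 1)"
      unfolding abs_prod
    proof (rule prod_mono, intro conjI)
      fix e
      show "\<bar>p * (1 - p) ^ m e + (1 - p) * (- p) ^ m e\<bar> \<le> (if e \<in> walk_edge \<omega> ` {..<L} then p else 1)"
        using centered_moment_bound[OF p m2[of e]] m0[of e] by auto
    qed simp
    also have "\<dots> = p ^ card (walk_edge \<omega> ` {..<L})"
    proof -
      have "pairs n \<inter> walk_edge \<omega> ` {..<L} = walk_edge \<omega> ` {..<L}" using inp by auto
      then show ?thesis using finite_pairs by (simp add: prod.If_cases)
    qed
    finally show ?thesis unfolding eq using True dbl by simp
  qed
qed

section \<open>Powers of the non-backtracking matrix and gluing of paths\<close>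

text \<open>The parameter \<open>l\<close> counts moves between directed edges, so a path has the
  \<open>l + 2\<close> vertices \<open>y 0\<close> to \<open>y (Suc l)\<close>.\<close>

definition nb_paths :: "nat \<Rightarrow> nat \<Rightarrow> (nat \<Rightarrow> nat) set" where
  "nb_paths n l = {y \<in> {..Suc l} \<rightarrow>\<^sub>E {..<n}. \<forall>i. 0 < i \<and> i \<le> l \<longrightarrow> y (i - 1) \<noteq> y (Suc i)}"

definition path_ends :: "nat \<Rightarrow> (nat \<Rightarrow> nat) \<Rightarrow> nat \<times> nat \<times> nat \<times> nat" where
  "path_ends l y = (y 0, y 1, y l, y (Suc l))"

text \<open>Entries of the \<open>l\<close>-th power of the weighted non-backtracking matrix, which is indexed by
  directed edges: row \<open>(a, b)\<close>, column \<open>(c, d)\<close>.\<close>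

definition nb_power :: "nat \<Rightarrow> (nat \<Rightarrow> nat \<Rightarrow> real) \<Rightarrow> nat \<Rightarrow> nat \<times> nat \<times> nat \<times> nat \<Rightarrow> real" where
  "nb_power n X l k = (\<Sum>y\<in>nb_paths n l. if path_ends l y = k then (\<Prod>i<l. X (y (Suc i)) (y (Suc (Suc i)))) else 0)"

definition nb_frobenius :: "nat \<Rightarrow> (nat \<Rightarrow> nat \<Rightarrow> real) \<Rightarrow> nat \<Rightarrow> real" where
  "nb_frobenius n X l = (\<Sum>k\<in>{..<n} \<times> {..<n} \<times> {..<n} \<times> {..<n}. (nb_power n X l k)\<^sup>2)"

lemma nb_pathsD: "y \<in> nb_paths n l \<Longrightarrow> 0 < i \<Longrightarrow> i \<le> l \<Longrightarrow> y (i - 1) \<noteq> y (Suc i)"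
  unfolding nb_paths_def by blast

lemma finite_nb_paths: "finite (nb_paths n l)"
  unfolding nb_paths_def by (rule finite_subset[of _ "{..Suc l} \<rightarrow>\<^sub>E {..<n}"]) (auto intro: finite_PiE)

lemma sum_sq_fibres:
  fixes w :: "'a \<Rightarrow> real"
  assumes "finite K" "key ` S \<subseteq> K"
  shows "(\<Sum>k\<in>K. (\<Sum>y\<in>S. if key y = k then w y else 0)\<^sup>2)
    = (\<Sum>y\<in>S. \<Sum>y'\<in>S. if key y = key y' then w y * w y' else 0)"
proof -
  have "(\<Sum>k\<in>K. (\<Sum>y\<in>S. if key y = k then w y else 0)\<^sup>2)
    = (\<Sum>k\<in>K. \<Sum>y\<in>S. \<Sum>y'\<in>S. (if key y = k then w y else 0) * (if key y' = k then w y' else 0))"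
    by (simp add: power2_eq_square sum_product)
  also have "\<dots> = (\<Sum>y\<in>S. \<Sum>k\<in>K. \<Sum>y'\<in>S. (if key y = k then w y else 0) * (if key y' = k then w y' else 0))"
    by (rule sum.swap)
  also have "\<dots> = (\<Sum>y\<in>S. \<Sum>y'\<in>S. \<Sum>k\<in>K. (if key y = k then w y else 0) * (if key y' = k then w y' else 0))"
    by (intro sum.cong refl sum.swap)
  also have "\<dots> = (\<Sum>y\<in>S. \<Sum>y'\<in>S. if key y = key y' then w y * w y' else 0)"
  proof (intro sum.cong refl)
    fix y y' assume y: "y \<in> S" "y' \<in> S"
    have "(\<Sum>k\<in>K. (if key y = k then w y else 0) * (if key y' = k then w y' else 0))
      = (\<Sum>k\<in>K. if k = key y then (if key y = key y' then w y * w y' else 0) else 0)"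
      by (intro sum.cong refl) auto
    then show "(\<Sum>k\<in>K. (if key y = k then w y else 0) * (if key y' = k then w y' else 0))
      = (if key y = key y' then w y * w y' else 0)"
      using assms y by (auto simp: sum.delta)
  qed
  finally show ?thesis .
qed

text \<open>Follows \<open>y\<close> from \<open>y 1\<close> to \<open>y (Suc l)\<close> and returns
  along \<open>y'\<close>. The vertex \<open>y 0\<close> is dropped because a move is weighted by
  the edge it enters, so the first directed edge carries no weight.\<close>

definition glue :: "nat \<Rightarrow> (nat \<Rightarrow> nat) \<Rightarrow> (nat \<Rightarrow> nat) \<Rightarrow> nat \<Rightarrow> nat" where
  "glue l y y' i = (if i \<le> l then y (Suc i) else if i \<le> 2 * l then y' (2 * l + 1 - i) else undefined)"

lemma glue_upper:
  assumes "path_ends l y = path_ends l y'" "l \<le> i" "i \<le> 2 * l"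
  shows "glue l y y' i = y' (2 * l + 1 - i)"
  using assms unfolding glue_def path_ends_def by (cases "i = l") auto

lemma glue_prod:
  assumes sym: "\<And>i j. X i j = X j i" and path_ends: "path_ends l y = path_ends l y'"
  shows "(\<Prod>i<l. X (y (Suc i)) (y (Suc (Suc i)))) * (\<Prod>i<l. X (y' (Suc i)) (y' (Suc (Suc i))))
    = (\<Prod>t<2 * l. X (glue l y y' t) (glue l y y' (Suc t)))"
proof -
  let ?h = "\<lambda>t. X (glue l y y' t) (glue l y y' (Suc t))"
  have "{..<2 * l} = {..<l} \<union> {l..<2 * l}" by auto
  then have "(\<Prod>t<2 * l. ?h t) = (\<Prod>t<l. ?h t) * (\<Prod>t=l..<2 * l. ?h t)"
    by (simp add: prod.union_disjoint ivl_disj_int)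
  also have "(\<Prod>t<l. ?h t) = (\<Prod>i<l. X (y (Suc i)) (y (Suc (Suc i))))"
    by (intro prod.cong) (auto simp: glue_def)
  also have "(\<Prod>t=l..<2 * l. ?h t) = (\<Prod>i<l. X (y' (Suc i)) (y' (Suc (Suc i))))"
  proof (rule prod.reindex_bij_witness[of _ "\<lambda>i. 2 * l - 1 - i" "\<lambda>t. 2 * l - 1 - t"])
    fix t assume t: "t \<in> {l..<2 * l}"
    have "glue l y y' t = y' (2 * l + 1 - t)" "glue l y y' (Suc t) = y' (2 * l + 1 - Suc t)"
      by (rule glue_upper[OF path_ends]; use t in simp)+
    moreover have "2 * l + 1 - t = Suc (Suc (2 * l - 1 - t))" "2 * l + 1 - Suc t = Suc (2 * l - 1 - t)"
      using t by auto
    ultimately show "X (y' (Suc (2 * l - 1 - t))) (y' (Suc (Suc (2 * l - 1 - t)))) = ?h t"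
      using sym by simp
  qed auto
  finally show ?thesis ..
qed

lemma glue_PiE:
  assumes "y \<in> nb_paths n l" "y' \<in> nb_paths n l"
  shows "glue l y y' \<in> {..2 * l} \<rightarrow>\<^sub>E {..<n}"
proof -
  have "y i < n" "y' i < n" if "i \<le> Suc l" for i
    using assms that unfolding nb_paths_def by (auto simp: PiE_iff)
  then show ?thesis by (auto simp: glue_def PiE_iff extensional_def)
qed

lemma glue_doubled_walk:
  assumes y: "y \<in> nb_paths n l" "y' \<in> nb_paths n l" and path_ends: "path_ends l y = path_ends l y'" and l: "0 < l"
    and noloop: "\<forall>t<2 * l. glue l y y' t \<noteq> glue l y y' (Suc t)"
    and dbl: "\<forall>t<2 * l. \<exists>s<2 * l. s \<noteq> t \<and> walk_edge (glue l y y') s = walk_edge (glue l y y') t"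
  shows "doubled_walk n l (2 * l) (glue l y y')"
proof
  show "glue l y y' i < n" if "i \<le> 2 * l" for i
    using glue_PiE[OF y] that by (auto simp: PiE_iff)
  show "glue l y y' (i - 1) \<noteq> glue l y y' (Suc i)" if i: "0 < i" "i < 2 * l" "i \<noteq> l" for i
  proof (cases "i < l")
    case True
    have "y (Suc i - 1) \<noteq> y (Suc (Suc i))" by (rule nb_pathsD[OF y(1)]) (use True in auto)
    moreover have "glue l y y' (i - 1) = y (Suc i - 1)" "glue l y y' (Suc i) = y (Suc (Suc i))"
      using True i unfolding glue_def by (simp_all add: less_imp_diff_less less_imp_le)
    ultimately show ?thesis by simp
  next
    case False
    have 1: "glue l y y' (i - 1) = y' (2 * l + 1 - (i - 1))" "glue l y y' (Suc i) = y' (2 * l + 1 - Suc i)"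
      by (rule glue_upper[OF path_ends]; use False i in linarith)+
    let ?j = "2 * l + 1 - i"
    have "0 < ?j \<and> ?j \<le> l" using False i by auto
    then have "y' (?j - 1) \<noteq> y' (Suc ?j)" using nb_pathsD[OF y(2), of ?j] by simp
    moreover have "?j - 1 = 2 * l + 1 - Suc i" "Suc ?j = 2 * l + 1 - (i - 1)" using i by auto
    ultimately show ?thesis unfolding 1 by simp
  qed
  show "glue l y y' (2 * l) = glue l y y' 0"
    using l path_ends by (simp add: glue_def path_ends_def)
qed (use l noloop dbl in auto)

text \<open>The dropped vertex \<open>y 0\<close> has to be recorded beside the glued walk; this is
  the source of one factor \<open>n\<close> in the bound on the expected Frobenius norm.\<close>

lemma glue_inj:
  assumes y: "y \<in> nb_paths n l" "y' \<in> nb_paths n l" "z \<in> nb_paths n l" "z' \<in> nb_paths n l"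
    and path_ends: "path_ends l y = path_ends l y'" "path_ends l z = path_ends l z'"
    and eq: "y 0 = z 0" "glue l y y' = glue l z z'"
  shows "y = z \<and> y' = z'"
proof
  have ext: "w i = undefined" if "w \<in> nb_paths n l" "\<not> i \<le> Suc l" for w i
    using that unfolding nb_paths_def by (auto simp: PiE_iff extensional_def)
  show "y = z"
  proof
    fix i show "y i = z i"
    proof (cases "i = 0 \<or> \<not> i \<le> Suc l")
      case False
      then have "y i = glue l y y' (i - 1)" "z i = glue l z z' (i - 1)" by (auto simp: glue_def)
      then show ?thesis using eq by simp
    qed (use eq(1) ext[OF y(1), of i] ext[OF y(3), of i] in metis)
  qed
  show "y' = z'"
  proof
    fix i show "y' i = z' i"
    proof (cases "i = 0 \<or> \<not> i \<le> Suc l")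
      case False
      have "glue l y y' (2 * l + 1 - i) = y' (2 * l + 1 - (2 * l + 1 - i))"
         "glue l z z' (2 * l + 1 - i) = z' (2 * l + 1 - (2 * l + 1 - i))"
        by (rule glue_upper[OF path_ends(1)] glue_upper[OF path_ends(2)]; use False in linarith)+
      moreover have "2 * l + 1 - (2 * l + 1 - i) = i" using False by auto
      ultimately show ?thesis using eq by simp
    next
      case True
      have "y' 0 = z' 0" using path_ends eq(1) by (auto simp: path_ends_def)
      then show ?thesis using True ext[OF y(2), of i] ext[OF y(4), of i] by auto
    qed
  qed
qed

text \<open>The squared Frobenius norm is a sum over pairs of paths with equal ends, and only glued
  pairs that are doubled walks have a nonzero bound. One factor \<open>n\<close> counts the vertex
  \<open>y 0\<close>, the other bounds the total kernel mass of the glued walks.\<close>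

theorem er_exp_nb_frobenius:
  assumes l: "0 < l" and n: "0 < n" and p: "0 < p" "p \<le> 1" and rho: "\<rho> = real n * p"
    and small: "\<And>b \<tau>. b + 1 \<le> 2 * l \<Longrightarrow> \<tau> \<le> 2 * l \<Longrightarrow>
      (20736 * real (2 * l) ^ 6 / real n) ^ b * ((2 * real b + 1) / sqrt \<rho>) ^ \<tau> \<le> 1"
  shows "er_exp n p (\<lambda>E. nb_frobenius n (centered_adj p E) l) \<le> 8 * (real (2 * l))\<^sup>2 * \<rho> ^ l * (real n)\<^sup>2"
proof -
  let ?K = "{..<n} \<times> {..<n} \<times> {..<n} \<times> {..<n}"
  let ?S = "nb_paths n l"
  let ?c = "8 * (real (2 * l))\<^sup>2 * \<rho> ^ l"
  define G where "G \<omega> = (\<Prod>i<2 * l. walk_kernel n (2 * l) l \<omega> i (\<omega> (Suc i)))" for \<omega>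
  have G0: "G \<omega> \<ge> 0" for \<omega> unfolding G_def by (intro prod_nonneg) (use walk_kernel_nonneg l in auto)
  have r: "0 < \<rho>" using rho n p by simp
  have keys: "path_ends l ` ?S \<subseteq> ?K"
    unfolding nb_paths_def path_ends_def by (auto simp: PiE_iff)
  define PP where "PP = {(y, y'). y \<in> ?S \<and> y' \<in> ?S \<and> path_ends l y = path_ends l y'}"
  have finPP: "finite PP"
    by (rule finite_subset[of _ "?S \<times> ?S"]) (auto simp: PP_def finite_nb_paths)
  have "nb_frobenius n (centered_adj p E) l = (\<Sum>(y, y')\<in>PP. \<Prod>t<2 * l. centered_adj p E (glue l y y' t) (glue l y y' (Suc t)))" for E
  proof -
    have "nb_frobenius n (centered_adj p E) l = (\<Sum>y\<in>?S. \<Sum>y'\<in>?S. if path_ends l y = path_ends l y' then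
       (\<Prod>i<l. centered_adj p E (y (Suc i)) (y (Suc (Suc i)))) * (\<Prod>i<l. centered_adj p E (y' (Suc i)) (y' (Suc (Suc i)))) else 0)"
      unfolding nb_frobenius_def nb_power_def by (rule sum_sq_fibres) (use keys in auto)
    also have "\<dots> = (\<Sum>y\<in>?S. \<Sum>y'\<in>?S. if path_ends l y = path_ends l y' then
       (\<Prod>t<2 * l. centered_adj p E (glue l y y' t) (glue l y y' (Suc t))) else 0)"
      by (intro sum.cong refl if_cong glue_prod centered_adj_sym)
    also have "\<dots> = (\<Sum>(y, y')\<in>?S \<times> ?S. if path_ends l y = path_ends l y' then
       (\<Prod>t<2 * l. centered_adj p E (glue l y y' t) (glue l y y' (Suc t))) else 0)"
      by (simp add: sum.cartesian_product)
    also have "\<dots> = (\<Sum>(y, y')\<in>PP. \<Prod>t<2 * l. centered_adj p E (glue l y y' t) (glue l y y' (Suc t)))"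
      by (rule sum.mono_neutral_cong_right) (auto simp: PP_def finite_nb_paths split: if_splits)
    finally show ?thesis .
  qed
  then have "er_exp n p (\<lambda>E. nb_frobenius n (centered_adj p E) l)
    = (\<Sum>(y, y')\<in>PP. er_exp n p (\<lambda>E. \<Prod>t<2 * l. centered_adj p E (glue l y y' t) (glue l y y' (Suc t))))"
    by (simp add: er_exp_sum case_prod_beta)
  also have "\<dots> \<le> (\<Sum>(y, y')\<in>PP. ?c * G (glue l y y'))"
  proof (rule sum_mono, clarify)
    fix y y' assume "(y, y') \<in> PP"
    then have y: "y \<in> ?S" "y' \<in> ?S" "path_ends l y = path_ends l y'" by (auto simp: PP_def)
    let ?w = "glue l y y'"
    have "er_exp n p (\<lambda>E. \<Prod>t<2 * l. centered_adj p E (?w t) (?w (Suc t)))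
      \<le> (if (\<forall>t<2 * l. ?w t \<noteq> ?w (Suc t)) \<and> (\<forall>t<2 * l. \<exists>s<2 * l. s \<noteq> t \<and> walk_edge ?w s = walk_edge ?w t)
        then p ^ card (walk_edge ?w ` {..<2 * l}) else 0)"
      by (rule er_exp_walk) (use p glue_PiE[OF y(1,2)] in \<open>auto simp: PiE_iff\<close>)
    also have "\<dots> \<le> ?c * G ?w"
    proof (cases "(\<forall>t<2 * l. ?w t \<noteq> ?w (Suc t)) \<and> (\<forall>t<2 * l. \<exists>s<2 * l. s \<noteq> t \<and> walk_edge ?w s = walk_edge ?w t)")
      case True
      interpret doubled_walk n l "2 * l" ?w
        by (rule glue_doubled_walk[OF y l]) (use True in auto)
      have "\<tau> \<le> 2 * l" using L_split by linarith
      have "p ^ card En \<le> ?c * G ?w"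
        unfolding G_def using edge_weight_le[OF p(1) rho small[OF b_less \<open>\<tau> \<le> 2 * l\<close>]] by simp
      then show ?thesis using True unfolding En_def by simp
    next
      case False
      have "0 \<le> ?c * G ?w" using r G0 by simp
      then show ?thesis using False by (simp only: if_False)
    qed
    finally show "er_exp n p (\<lambda>E. \<Prod>t<2 * l. centered_adj p E (?w t) (?w (Suc t))) \<le> ?c * G ?w" .
  qed
  also have "\<dots> = ?c * (\<Sum>(y, y')\<in>PP. G (glue l y y'))"
    by (simp add: sum_distrib_left case_prod_beta)
  also have "(\<Sum>(y, y')\<in>PP. G (glue l y y')) = (\<Sum>(a, \<omega>)\<in>(\<lambda>(y, y'). (y 0, glue l y y')) ` PP. G \<omega>)"
  proof (subst sum.reindex)
    show "inj_on (\<lambda>(y, y'). (y 0, glue l y y')) PP"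
      unfolding inj_on_def PP_def using glue_inj by (clarsimp; blast)
  qed (auto simp: case_prod_beta)
  also have "\<dots> \<le> (\<Sum>(a, \<omega>)\<in>{..<n} \<times> ({..2 * l} \<rightarrow>\<^sub>E {..<n}). G \<omega>)"
  proof (rule sum_mono2)
    show "(\<lambda>(y, y'). (y 0, glue l y y')) ` PP \<subseteq> {..<n} \<times> ({..2 * l} \<rightarrow>\<^sub>E {..<n})"
    proof clarify
      fix y y' assume "(y, y') \<in> PP"
      then have y: "y \<in> ?S" "y' \<in> ?S" by (auto simp: PP_def)
      have "y 0 < n" using y(1) unfolding nb_paths_def by (auto simp: PiE_iff)
      then show "y 0 \<in> {..<n} \<and> glue l y y' \<in> {..2 * l} \<rightarrow>\<^sub>E {..<n}" using glue_PiE[OF y] by auto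
    qed
  qed (auto simp: G0 intro: finite_PiE)
  also have "\<dots> = real n * (\<Sum>\<omega>\<in>{..2 * l} \<rightarrow>\<^sub>E {..<n}. G \<omega>)"
    by (simp flip: sum.cartesian_product)
  also have "\<dots> \<le> real n * real n"
  proof (rule mult_left_mono)
    show "(\<Sum>\<omega>\<in>{..2 * l} \<rightarrow>\<^sub>E {..<n}. G \<omega>) \<le> real n"
      unfolding G_def
    proof (rule subprob_path_mass)
      show "(\<Sum>z<n. walk_kernel n (2 * l) l x i z) \<le> 1" if "i < 2 * l" for x i
        by (rule walk_kernel_sum[OF that n])
    qed (use walk_kernel_nonneg l in \<open>auto intro: walk_kernel_cong\<close>)
  qed simp
  finally show ?thesis using r by (simp add: power2_eq_square mult_left_mono)
qed

section \<open>Concentration of the degrees\<close>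

definition degree_in :: "nat \<Rightarrow> (nat \<times> nat) set \<Rightarrow> nat \<Rightarrow> nat" where
  "degree_in n E i = card {j. j < n \<and> j \<noteq> i \<and> edge_of i j \<in> E}"

lemma degree_in_eq: 
  assumes "E \<subseteq> pairs n" "i < n"
  shows "degree_in n E i = card {e \<in> E. incident i e}"
proof -
  have "bij_betw (edge_of i) {j. j < n \<and> j \<noteq> i \<and> edge_of i j \<in> E} {e \<in> E. incident i e}"
  proof (rule bij_betw_imageI)
    show "inj_on (edge_of i) {j. j < n \<and> j \<noteq> i \<and> edge_of i j \<in> E}" by (auto simp: inj_on_def edge_of_eq_iff)
    show "edge_of i ` {j. j < n \<and> j \<noteq> i \<and> edge_of i j \<in> E} = {e \<in> E. incident i e}"
    proof
      show "{e \<in> E. incident i e} \<subseteq> edge_of i ` {j. j < n \<and> j \<noteq> i \<and> edge_of i j \<in> E}"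
      proof clarify
        fix a b assume ab: "(a, b) \<in> E" "incident i (a, b)"
        then have lt: "a < b" "b < n" using assms unfolding pairs_def by auto
        show "(a, b) \<in> edge_of i ` {j. j < n \<and> j \<noteq> i \<and> edge_of i j \<in> E}"
          using ab lt unfolding incident_def by (auto simp: edge_of_def image_iff intro: exI[of _ a] exI[of _ b])
      qed
    qed (auto simp: incident_edge_of)
  qed
  then show ?thesis unfolding degree_in_def by (rule bij_betw_same_card)
qed

text \<open>For negative \<theta> the reason is \<open>exp (- \<theta>) \<ge> 1 - \<theta>\<close>
  together with \<open>(1 - \<theta>) * (1 + \<theta> + \<theta>\<^sup>2) = 1 - \<theta> ^ 3 \<ge>
  1\<close>.\<close>

lemma exp_le_quadratic:
  fixes \<theta> :: real
  assumes "\<bar>\<theta>\<bar> \<le> 1"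
  shows "exp \<theta> \<le> 1 + \<theta> + \<theta>\<^sup>2"
proof (cases "0 \<le> \<theta>")
  case False
  then have t: "- \<theta> > 0" "- \<theta> \<le> 1" using assms by auto
  have "1 + (- \<theta>) \<le> exp (- \<theta>)" by (rule exp_ge_add_one_self)
  then have "1 \<le> exp (- \<theta>) * (1 + \<theta> + \<theta>\<^sup>2)"
  proof -
    have "0 \<le> (- \<theta>) * \<theta>\<^sup>2" by (rule mult_nonneg_nonneg) (use t in auto)
    moreover have "(1 + (- \<theta>)) * (1 + \<theta> + \<theta>\<^sup>2) = 1 + (- \<theta>) * \<theta>\<^sup>2"
      by (simp add: algebra_simps power2_eq_square)
    ultimately have "1 \<le> (1 + (- \<theta>)) * (1 + \<theta> + \<theta>\<^sup>2)" by linarith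
    also have "\<dots> \<le> exp (- \<theta>) * (1 + \<theta> + \<theta>\<^sup>2)"
      by (rule mult_right_mono) (use t exp_ge_add_one_self[of "- \<theta>"] zero_le_power2[of \<theta>] in linarith)+
    finally show ?thesis .
  qed
  then show ?thesis by (simp add: exp_minus field_simps)
qed (use exp_bound[of \<theta>] assms in auto)

lemma card_pairs_incident: "i < n \<Longrightarrow> card {e \<in> pairs n. incident i e} = n - 1"
proof -
  assume i: "i < n"
  have "{j. j < n \<and> j \<noteq> i \<and> edge_of i j \<in> pairs n} = {..<n} - {i}"
    using edge_of_in_pairs i by auto
  then show ?thesis using degree_in_eq[of "pairs n" n i] i unfolding degree_in_def by simp
qed

text \<open>The summand 1 in the exponent absorbs the difference between the \<open>n - 1\<close>
  possible neighbours and the \<open>n\<close> in \<open>n * p\<close>.\<close>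

lemma er_exp_degree_in:
  assumes p: "0 \<le> p" "p \<le> 1" and i: "i < n" and th: "\<bar>\<theta>\<bar> \<le> 1"
  shows "er_exp n p (\<lambda>E. exp (\<theta> * real (degree_in n E i))) \<le> exp (real n * p * (\<theta> + \<theta>\<^sup>2) + 1)"
proof -
  have "er_exp n p (\<lambda>E. exp (\<theta> * real (degree_in n E i)))
     = er_exp n p (\<lambda>E. \<Prod>e\<in>pairs n. if e \<in> E then (if incident i e then exp \<theta> else 1) else 1)"
  proof (rule er_exp_cong)
    fix E assume E: "E \<subseteq> pairs n"
    have "(\<Prod>e\<in>pairs n. if e \<in> E then (if incident i e then exp \<theta> else 1) else 1)
       = (\<Prod>e\<in>pairs n. if e \<in> E \<and> incident i e then exp \<theta> else 1)"
      by (intro prod.cong) auto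
    also have "\<dots> = exp \<theta> ^ card {e \<in> pairs n. e \<in> E \<and> incident i e}"
      using finite_pairs by (simp add: prod.If_cases Int_def)
    also have "{e \<in> pairs n. e \<in> E \<and> incident i e} = {e \<in> E. incident i e}" using E by auto
    finally show "exp (\<theta> * real (degree_in n E i))
      = (\<Prod>e\<in>pairs n. if e \<in> E then (if incident i e then exp \<theta> else 1) else 1)"
      unfolding degree_in_eq[OF E i] by (simp add: exp_of_nat2_mult)
  qed
  also have "\<dots> = (\<Prod>e\<in>pairs n. p * (if incident i e then exp \<theta> else 1) + (1 - p) * 1)"
    by (rule er_exp_prod)
  also have "\<dots> = (\<Prod>e\<in>pairs n. if incident i e then 1 + p * (exp \<theta> - 1) else 1)"
    by (intro prod.cong) (auto simp: algebra_simps)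
  also have "\<dots> = (1 + p * (exp \<theta> - 1)) ^ (n - 1)"
    using finite_pairs card_pairs_incident[OF i] by (simp add: prod.If_cases Int_def)
  also have "\<dots> \<le> exp (p * (exp \<theta> - 1)) ^ (n - 1)"
  proof (rule power_mono)
    have "0 \<le> p * exp \<theta> + (1 - p)" using p by simp
    then show "0 \<le> 1 + p * (exp \<theta> - 1)" by (simp add: algebra_simps)
  qed (rule exp_ge_add_one_self)
  also have "\<dots> = exp (real (n - 1) * (p * (exp \<theta> - 1)))" by (simp add: exp_of_nat_mult)
  also have "\<dots> \<le> exp (real n * p * (\<theta> + \<theta>\<^sup>2) + 1)"
  proof -
    have "real (n - 1) = real n - 1" using i by simp
    then have "real (n - 1) * (p * (exp \<theta> - 1)) = real n * p * (exp \<theta> - 1) + p * (1 - exp \<theta>)"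
      by (simp add: algebra_simps)
    also have "\<dots> \<le> real n * p * (\<theta> + \<theta>\<^sup>2) + 1"
    proof (rule add_mono)
      show "real n * p * (exp \<theta> - 1) \<le> real n * p * (\<theta> + \<theta>\<^sup>2)"
        by (rule mult_left_mono) (use exp_le_quadratic[OF th] p in auto)
      have "p * (1 - exp \<theta>) \<le> p * 1" by (rule mult_left_mono) (use p in auto)
      then show "p * (1 - exp \<theta>) \<le> 1" using p by simp
    qed
    finally show ?thesis by simp
  qed
  finally show ?thesis .
qed

lemma er_degree_in_tail:
  assumes p: "0 \<le> p" "p \<le> 1" and i: "i < n" and d: "0 < \<delta>" "\<delta> \<le> 1" and rho: "\<rho> = real n * p"
  shows "er_prob n p (\<lambda>E. \<delta> * \<rho> < \<bar>real (degree_in n E i) - \<rho>\<bar>) \<le> 2 * exp (1 - \<rho> * \<delta>\<^sup>2 / 4)"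
proof -
  \<comment> \<open>Both tails at once: for \<open>\<theta> = \<delta> / 2\<close> and
    \<open>\<theta> = - \<delta> / 2\<close> the threshold
    \<open>\<rho> + 2 * \<theta> * \<rho>\<close> lies \<open>\<delta> * \<rho>\<close> above or
    below \<rho>, and Markov's inequality leaves the exponent
    \<open>1 - \<rho> * \<theta>\<^sup>2\<close>.\<close>
  have one: "er_prob n p (\<lambda>E. exp (\<theta> * (\<rho> + 2 * \<theta> * \<rho>)) \<le> exp (\<theta> * real (degree_in n E i))) \<le> exp (1 - \<rho> * \<delta>\<^sup>2 / 4)"
    if th: "\<bar>\<theta>\<bar> = \<delta> / 2" for \<theta>
  proof -
    have th2: "\<theta>\<^sup>2 = \<delta>\<^sup>2 / 4"
    proof -
      have "\<theta>\<^sup>2 = \<bar>\<theta>\<bar>\<^sup>2" by simp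
      also have "\<dots> = \<delta>\<^sup>2 / 4" unfolding th by (simp add: power_divide)
      finally show ?thesis .
    qed
    have "er_prob n p (\<lambda>E. exp (\<theta> * (\<rho> + 2 * \<theta> * \<rho>)) \<le> exp (\<theta> * real (degree_in n E i)))
      \<le> er_exp n p (\<lambda>E. exp (\<theta> * real (degree_in n E i))) / exp (\<theta> * (\<rho> + 2 * \<theta> * \<rho>))"
      by (rule er_markov) (use p in auto)
    also have "\<dots> \<le> exp (\<rho> * (\<theta> + \<theta>\<^sup>2) + 1) / exp (\<theta> * (\<rho> + 2 * \<theta> * \<rho>))"
      unfolding rho by (intro divide_right_mono er_exp_degree_in p i) (use th d in auto)
    also have "\<dots> = exp (1 - \<rho> * \<theta>\<^sup>2)"
      by (simp flip: exp_diff add: algebra_simps power2_eq_square)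
    finally show ?thesis unfolding th2 by simp
  qed
  have "er_prob n p (\<lambda>E. \<delta> * \<rho> < \<bar>real (degree_in n E i) - \<rho>\<bar>)
    \<le> er_prob n p (\<lambda>E. exp (\<delta> / 2 * (\<rho> + 2 * (\<delta> / 2) * \<rho>)) \<le> exp (\<delta> / 2 * real (degree_in n E i))
        \<or> exp (- \<delta> / 2 * (\<rho> + 2 * (- \<delta> / 2) * \<rho>)) \<le> exp (- \<delta> / 2 * real (degree_in n E i)))"
  proof (rule er_prob_mono[OF p])
    fix E assume "\<delta> * \<rho> < \<bar>real (degree_in n E i) - \<rho>\<bar>"
    then consider "\<rho> + \<delta> * \<rho> \<le> real (degree_in n E i)" | "real (degree_in n E i) \<le> \<rho> - \<delta> * \<rho>" by linarith
    then show "exp (\<delta> / 2 * (\<rho> + 2 * (\<delta> / 2) * \<rho>)) \<le> exp (\<delta> / 2 * real (degree_in n E i))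
        \<or> exp (- \<delta> / 2 * (\<rho> + 2 * (- \<delta> / 2) * \<rho>)) \<le> exp (- \<delta> / 2 * real (degree_in n E i))"
    proof cases
      case 1
      then have "\<delta> * (\<rho> + \<delta> * \<rho>) \<le> \<delta> * real (degree_in n E i)" using d by (intro mult_left_mono) auto
      then show ?thesis by (simp add: algebra_simps)
    next
      case 2
      then have "\<delta> * real (degree_in n E i) \<le> \<delta> * (\<rho> - \<delta> * \<rho>)" using d by (intro mult_left_mono) auto
      then show ?thesis by (simp add: algebra_simps)
    qed
  qed
  also have "\<dots> \<le> exp (1 - \<rho> * \<delta>\<^sup>2 / 4) + exp (1 - \<rho> * \<delta>\<^sup>2 / 4)"
    by (intro order_trans[OF er_prob_disj[OF p]] add_mono one) (use d in auto)
  finally show ?thesis by simp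
qed

section \<open>The Ihara-Bass identity and the quadratic form of the centered matrix\<close>

definition quad_form :: "nat \<Rightarrow> (nat \<Rightarrow> nat \<Rightarrow> real) \<Rightarrow> (nat \<Rightarrow> real) \<Rightarrow> real" where
  "quad_form n M x = (\<Sum>i<n. \<Sum>j<n. M i j * (x i * x j))"

lemma quad_form_scale: "quad_form n M (\<lambda>i. c * x i) = c\<^sup>2 * quad_form n M x"
  unfolding quad_form_def sum_distrib_left by (intro sum.cong refl) (simp add: power2_eq_square)

lemma quad_form_cong: "(\<And>i. i < n \<Longrightarrow> x i = y i) \<Longrightarrow> quad_form n M x = quad_form n M y"
  unfolding quad_form_def by (intro sum.cong refl) auto

lemma quad_form_uminus: "quad_form n (\<lambda>i j. - M i j) x = - quad_form n M x"
  unfolding quad_form_def by (simp add: sum_negf)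

lemma quad_form_add:
  assumes sym: "\<And>i j. i < n \<Longrightarrow> j < n \<Longrightarrow> M i j = M j i"
  shows "quad_form n M (\<lambda>i. x i + s * w i)
    = quad_form n M x + 2 * s * (\<Sum>i<n. w i * (\<Sum>j<n. M i j * x j)) + s\<^sup>2 * quad_form n M w"
proof -
  have sw: "(\<Sum>i<n. \<Sum>j<n. M i j * (x i * w j)) = (\<Sum>i<n. \<Sum>j<n. M i j * (w i * x j))"
    by (subst sum.swap) (intro sum.cong refl, auto simp: sym)
  have "quad_form n M (\<lambda>i. x i + s * w i) = quad_form n M x
      + s * (\<Sum>i<n. \<Sum>j<n. M i j * (w i * x j)) + s * (\<Sum>i<n. \<Sum>j<n. M i j * (x i * w j)) + s\<^sup>2 * quad_form n M w"
    unfolding quad_form_def sum_distrib_left sum.distrib[symmetric]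
    by (intro sum.cong refl) (simp add: algebra_simps power2_eq_square)
  moreover have "(\<Sum>i<n. \<Sum>j<n. M i j * (w i * x j)) = (\<Sum>i<n. w i * (\<Sum>j<n. M i j * x j))"
    unfolding sum_distrib_left by (intro sum.cong refl) auto
  ultimately show ?thesis using sw by simp
qed

lemma psd_kernel:
  assumes sym: "\<And>i j. i < n \<Longrightarrow> j < n \<Longrightarrow> M i j = M j i"
    and psd: "\<And>x. 0 \<le> quad_form n M x" and zero: "quad_form n M y = 0" and i: "i < n"
  shows "(\<Sum>j<n. M i j * y j) = 0"
proof (rule ccontr)
  define g where "g = (\<Sum>j<n. M i j * y j)"
  define e where "e = (\<lambda>k. if k = i then 1 else 0 :: real)"
  assume "(\<Sum>j<n. M i j * y j) \<noteq> 0"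
  then have g: "g \<noteq> 0" unfolding g_def .
  have e1: "(\<Sum>k<n. e k * (\<Sum>j<n. M k j * y j)) = g"
  proof -
    have "(\<Sum>k<n. e k * (\<Sum>j<n. M k j * y j)) = (\<Sum>k<n. if k = i then g else 0)"
      unfolding e_def g_def by (intro sum.cong refl) auto
    then show ?thesis using i by simp
  qed
  have e2: "quad_form n M e = M i i"
  proof -
    have "quad_form n M e = (\<Sum>k<n. \<Sum>j<n. if k = i then (if j = i then M i i else 0) else 0)"
      unfolding quad_form_def e_def by (intro sum.cong refl) auto
    also have "\<dots> = (\<Sum>k<n. if k = i then M i i else 0)"
      by (intro sum.cong refl) (use i in auto)
    finally show ?thesis using i by simp
  qed
  define m where "m = M i i"
  have m: "0 \<le> m" using psd[of e] e2 m_def by simp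
  \<comment> \<open>The minimizer of \<open>2 * s * g + s\<^sup>2 * m\<close> would be
    \<open>- g / m\<close>. Using \<open>m + 1\<close> still gives a negative value and also covers
    a vanishing diagonal entry.\<close>
  define s where "s = - g / (m + 1)"
  have gs: "g = - s * (m + 1)" unfolding s_def using m by simp
  then have s: "s \<noteq> 0" using g by auto
  have "0 \<le> quad_form n M (\<lambda>k. y k + s * e k)" by (rule psd)
  also have "\<dots> = 2 * s * g + s\<^sup>2 * m"
    using quad_form_add[of n M y s e] sym zero e1 e2 m_def by simp
  also have "\<dots> = - (s\<^sup>2 * (m + 2))"
    unfolding gs by (simp add: algebra_simps power2_eq_square)
  also have "\<dots> < 0" using s m by simp
  finally show False by simp
qed

text \<open>Since \<open>n\<close> is a variable and not a type, vectors are functions on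
  \<open>nat\<close> that vanish from \<open>n\<close> on. Such a sphere is closed in a product of
  intervals, which is compact by Tychonoff.\<close>

lemma compact_unit_sphere:
  "compact {x :: nat \<Rightarrow> real. (\<forall>i\<ge>n. x i = 0) \<and> (\<Sum>i<n. (x i)\<^sup>2) = 1}" (is "compact ?S")
proof -
  have "compact (Pi\<^sub>E UNIV (\<lambda>_::nat. {-1..1::real}))"
    using compactin_PiE[of "\<lambda>_. euclidean" UNIV "\<lambda>_::nat. {-1..1::real}"]
    by (simp add: euclidean_product_topology)
  moreover have "closed ?S"
  proof -
    have "?S = (\<Inter>i\<in>{n..}. {x. x i = 0}) \<inter> {x. (\<Sum>i<n. (x i)\<^sup>2) = 1}" by auto
    moreover have "closed {x :: nat \<Rightarrow> real. x i = 0}" for i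
      by (intro closed_Collect_eq continuous_intros continuous_on_product_coordinates)
    moreover have "closed {x :: nat \<Rightarrow> real. (\<Sum>i<n. (x i)\<^sup>2) = 1}"
      by (intro closed_Collect_eq continuous_intros continuous_on_product_coordinates)
    ultimately show ?thesis by (auto intro!: closed_INT closed_Int)
  qed
  moreover have "?S \<subseteq> Pi\<^sub>E UNIV (\<lambda>_::nat. {-1..1::real})"
  proof (clarsimp simp: PiE_iff)
    fix x :: "nat \<Rightarrow> real" and i assume x: "\<forall>i\<ge>n. x i = 0" "(\<Sum>i<n. (x i)\<^sup>2) = 1"
    have "(x i)\<^sup>2 \<le> 1"
    proof (cases "i < n")
      case True
      then show ?thesis using member_le_sum[of i "{..<n}" "\<lambda>i. (x i)\<^sup>2"] x(2) by simp
    qed (use x in simp)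
    then show "- 1 \<le> x i \<and> x i \<le> 1" by (auto simp: abs_square_le_1 abs_le_iff)
  qed
  ultimately show ?thesis
    using compact_Int_closed[of "Pi\<^sub>E UNIV (\<lambda>_::nat. {-1..1::real})" ?S] by (simp only: Int_absorb1)
qed

lemma normalize_to_sphere:
  assumes "\<exists>i<n. x i \<noteq> 0"
  shows "\<exists>c u. c \<noteq> 0 \<and> u \<in> {x :: nat \<Rightarrow> real. (\<forall>i\<ge>n. x i = 0) \<and> (\<Sum>i<n. (x i)\<^sup>2) = 1} \<and>
    (\<forall>i<n. x i = c * u i)"
proof -
  define N where "N = (\<Sum>i<n. (x i)\<^sup>2)"
  obtain i where i: "i < n" "x i \<noteq> 0" using assms by auto
  have "(x i)\<^sup>2 \<le> N" unfolding N_def by (rule member_le_sum) (use i in auto)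
  moreover have "0 < (x i)\<^sup>2" using i by simp
  ultimately have N: "0 < N" by linarith
  define u where "u i = (if i < n then x i / sqrt N else 0)" for i
  have "(\<Sum>i<n. (u i)\<^sup>2) = (\<Sum>i<n. (x i)\<^sup>2 / N)"
    unfolding u_def by (intro sum.cong refl) (use N in \<open>simp add: power_divide\<close>)
  also have "\<dots> = 1" using N by (simp add: N_def flip: sum_divide_distrib)
  finally have "u \<in> {x :: nat \<Rightarrow> real. (\<forall>i\<ge>n. x i = 0) \<and> (\<Sum>i<n. (x i)\<^sup>2) = 1}"
    by (simp add: u_def)
  moreover have "x i = sqrt N * u i" if "i < n" for i using that N by (simp add: u_def)
  ultimately show ?thesis using N by (intro exI[of _ "sqrt N"] exI[of _ u]) auto
qed

text \<open>A symmetric matrix path that ends positive definite and never becomes singular is positive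
  definite throughout: at the last parameter where definiteness fails, the form is semidefinite
  with a zero, which is a kernel vector.\<close>

lemma definite_along_path:
  fixes M :: "real \<Rightarrow> nat \<Rightarrow> nat \<Rightarrow> real"
  assumes ab: "a \<le> b"
    and sym: "\<And>t i j. i < n \<Longrightarrow> j < n \<Longrightarrow> M t i j = M t j i"
    and cont: "\<And>i j. i < n \<Longrightarrow> j < n \<Longrightarrow> continuous_on {a..b} (\<lambda>t. M t i j)"
    and pd: "\<And>x. \<exists>i<n. x i \<noteq> 0 \<Longrightarrow> 0 < quad_form n (M b) x"
    and nonsing: "\<And>t y. t \<in> {a..b} \<Longrightarrow> \<exists>i<n. y i \<noteq> 0 \<Longrightarrow> \<exists>i<n. (\<Sum>j<n. M t i j * y j) \<noteq> 0"
    and x: "\<exists>i<n. x i \<noteq> 0"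
  shows "0 < quad_form n (M a) x"
proof (rule ccontr)
  assume neg: "\<not> 0 < quad_form n (M a) x"
  define S where "S = {x :: nat \<Rightarrow> real. (\<forall>i\<ge>n. x i = 0) \<and> (\<Sum>i<n. (x i)\<^sup>2) = 1}"
  have nz: "\<exists>i<n. u i \<noteq> 0" if "u \<in> S" for u
  proof (rule ccontr)
    assume "\<not> (\<exists>i<n. u i \<noteq> 0)"
    then have "(\<Sum>i<n. (u i)\<^sup>2) = 0" by simp
    then show False using that unfolding S_def by simp
  qed
  have contq: "continuous_on ({a..b} \<times> S) (\<lambda>(t, u). quad_form n (M t) u)"
    unfolding quad_form_def case_prod_beta
  proof (intro continuous_intros)
    fix i j assume "i \<in> {..<n}" "j \<in> {..<n}"
    then have "continuous_on {a..b} (\<lambda>t. M t i j)" by (intro cont) auto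
    then show "continuous_on ({a..b} \<times> S) (\<lambda>q. M (fst q) i j)"
      by (rule continuous_on_compose2) (auto intro: continuous_intros)
  next
    have "continuous_on ({a..b} \<times> S) (\<lambda>q. snd q i)" for i
      by (rule continuous_on_product_then_coordinatewise[OF continuous_on_snd[OF continuous_on_id]])
    then show "continuous_on ({a..b} \<times> S) (\<lambda>q. snd q i)" "continuous_on ({a..b} \<times> S) (\<lambda>q. snd q i)" for i
      by auto
  qed
  define Z where "Z = {q \<in> {a..b} \<times> S. (\<lambda>(t, u). quad_form n (M t) u) q \<le> 0}"
  have compS: "compact ({a..b} \<times> S)"
    unfolding S_def by (intro compact_Times compact_Icc compact_unit_sphere)
  have "closedin (top_of_set ({a..b} \<times> S)) Z"
    unfolding Z_def using continuous_closedin_preimage[OF contq closed_atMost[of 0]]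
    by (simp add: vimage_def Int_def conj_commute)
  then have "compact Z" using compS closedin_compact by blast
  then have comp: "compact (fst ` Z)" by (intro compact_continuous_image continuous_intros)
  obtain c u where cu: "c \<noteq> 0" "u \<in> S" "\<And>i. i < n \<Longrightarrow> x i = c * u i"
    using normalize_to_sphere[OF x, folded S_def] by auto
  have "quad_form n (M a) x = c\<^sup>2 * quad_form n (M a) u"
    using quad_form_cong[of n x "\<lambda>i. c * u i"] cu(3) quad_form_scale by metis
  then have "c\<^sup>2 * quad_form n (M a) u \<le> 0" using neg by simp
  then have "quad_form n (M a) u \<le> 0" using cu(1) by (simp add: mult_le_0_iff power2_less_eq_zero_iff)
  then have "(a, u) \<in> Z" unfolding Z_def using ab cu(2) by auto
  then have "fst ` Z \<noteq> {}" by auto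
  then obtain t where t: "t \<in> fst ` Z" and tmax: "\<And>s. s \<in> fst ` Z \<Longrightarrow> s \<le> t"
    using compact_attains_sup[OF comp] by auto
  obtain y where y: "t \<in> {a..b}" "y \<in> S" "quad_form n (M t) y \<le> 0"
    using t unfolding Z_def by auto
  \<comment> \<open>A negative value at the last failing parameter would, by the intermediate value
    theorem, lead to a zero of the form at a strictly later one.\<close>
  have psdS: "0 \<le> quad_form n (M t) w" if w: "w \<in> S" for w
  proof (rule ccontr)
    assume "\<not> 0 \<le> quad_form n (M t) w"
    then have lt: "quad_form n (M t) w < 0" by simp
    have "continuous_on {t..b} (\<lambda>s. quad_form n (M s) w)"
      unfolding quad_form_def using y(1)
      by (intro continuous_intros continuous_on_subset[OF cont]) auto
    moreover have "0 \<le> quad_form n (M b) w" using pd[OF nz[OF w]] by simp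
    ultimately obtain s where s: "t \<le> s" "s \<le> b" "quad_form n (M s) w = 0"
      using IVT'[of "\<lambda>s. quad_form n (M s) w" t 0 b] lt y(1) by auto
    then have "(s, w) \<in> Z" unfolding Z_def using y(1) w by auto
    then have "s \<le> t" using tmax[of s] by force
    then show False using s lt by simp
  qed
  have psd: "0 \<le> quad_form n (M t) w" for w
  proof (cases "\<exists>i<n. w i \<noteq> 0")
    case True
    obtain c u where cu: "c \<noteq> 0" "u \<in> S" "\<And>i. i < n \<Longrightarrow> w i = c * u i"
      using normalize_to_sphere[OF True, folded S_def] by auto
    have "quad_form n (M t) w = c\<^sup>2 * quad_form n (M t) u"
      using quad_form_cong[of n w "\<lambda>i. c * u i"] cu(3) quad_form_scale by metis
    then show ?thesis using psdS[OF cu(2)] by simp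
  next
    case False
    then have "quad_form n (M t) w = 0" unfolding quad_form_def by (intro sum.neutral ballI) auto
    then show ?thesis by simp
  qed
  have "quad_form n (M t) y = 0" using psd[of y] y(3) by simp
  then have "\<forall>i<n. (\<Sum>j<n. M t i j * y j) = 0"
    using psd_kernel[of n "M t" y] sym psd by blast
  then show False using nonsing[OF y(1) nz[OF y(2)]] by auto
qed

section \<open>Weighted Ihara-Bass identity\<close>

text \<open>The \<open>n\<close> by \<open>n\<close> matrix of the weighted Ihara-Bass formula:
  where it is singular, \<open>lam\<close> is an eigenvalue of the non-backtracking matrix of
  \<open>X\<close>. It tends to the identity as \<open>lam\<close> grows.\<close>

definition ihara_bass_mat :: "nat \<Rightarrow> (nat \<Rightarrow> nat \<Rightarrow> real) \<Rightarrow> real \<Rightarrow> nat \<Rightarrow> nat \<Rightarrow> real" where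
  "ihara_bass_mat n X lam i j = (if i = j then 1 + (\<Sum>k<n. (X i k)\<^sup>2 / (lam\<^sup>2 - (X i k)\<^sup>2)) else 0)
     - lam * X i j / (lam\<^sup>2 - (X i j)\<^sup>2)"

text \<open>The \<open>l\<close>-th power of the non-backtracking matrix applied to
  \<open>f\<close>, a function on directed edges, and evaluated at the edge
  \<open>(a, b)\<close>.\<close>

definition nb_apply :: "nat \<Rightarrow> (nat \<Rightarrow> nat \<Rightarrow> real) \<Rightarrow> nat \<Rightarrow> (nat \<Rightarrow> nat \<Rightarrow> real) \<Rightarrow> nat \<Rightarrow> nat \<Rightarrow> real" where
  "nb_apply n X l f a b = (\<Sum>y\<in>nb_paths n l. if y 0 = a \<and> y 1 = b
     then (\<Prod>i<l. X (y (Suc i)) (y (Suc (Suc i)))) * f (y l) (y (Suc l)) else 0)"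

lemma nb_apply_0:
  assumes "a < n" "b < n"
  shows "nb_apply n X 0 f a b = f a b"
proof -
  define u where "u = (\<lambda>i::nat. if i = 0 then a else if i = 1 then b else undefined)"
  have "u \<in> nb_paths n 0"
    unfolding nb_paths_def u_def using assms by (auto simp: PiE_iff extensional_def)
  have uniq: "y = u" if "y \<in> nb_paths n 0" "y 0 = a" "y 1 = b" for y
  proof
    fix i show "y i = u i"
      using that unfolding nb_paths_def u_def by (auto simp: PiE_iff extensional_def)
  qed
  have "nb_apply n X 0 f a b = (\<Sum>y\<in>nb_paths n 0. if y = u then f a b else 0)"
    unfolding nb_apply_def
  proof (intro sum.cong refl)
    fix y assume "y \<in> nb_paths n 0"
    then have "y 0 = a \<and> y 1 = b \<longleftrightarrow> y = u" using uniq by (auto simp: u_def)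
    then show "(if y 0 = a \<and> y 1 = b then (\<Prod>i<0. X (y (Suc i)) (y (Suc (Suc i)))) * f (y 0) (y (Suc 0)) else 0)
        = (if y = u then f a b else 0)" by (auto simp: u_def)
  qed
  then show ?thesis using \<open>u \<in> nb_paths n 0\<close> finite_nb_paths by simp
qed

lemma all_pos_le_Suc: "(\<forall>i. 0 < i \<and> i \<le> Suc l \<longrightarrow> P i) \<longleftrightarrow> (\<forall>i. 0 < i \<and> i \<le> l \<longrightarrow> P i) \<and> P (Suc l)"
  unfolding le_Suc_eq using zero_less_Suc by blast

text \<open>The last vertex \<open>z\<close> of a path is restricted only by
  \<open>z \<noteq> y l\<close>, so summing it out produces the eigenvalue equation at the edge
  \<open>(y l, y (Suc l))\<close>.\<close>

lemma nb_apply_Suc: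
  assumes f: "\<And>i j. i < n \<Longrightarrow> j < n \<Longrightarrow> (\<Sum>k<n. if k = i then 0 else X j k * f j k) = lam * f i j"
  shows "nb_apply n X (Suc l) f a b = lam * nb_apply n X l f a b"
proof -
  have fil: "(\<Sum>y\<in>nb_paths n l. g y) = (\<Sum>y\<in>{..Suc l} \<rightarrow>\<^sub>E {..<n}.
      if \<forall>i. 0 < i \<and> i \<le> l \<longrightarrow> y (i - 1) \<noteq> y (Suc i) then g y else 0)" for l and g :: "(nat \<Rightarrow> nat) \<Rightarrow> real"
    unfolding nb_paths_def by (rule sum.inter_filter) (auto intro: finite_PiE)
  have pull: "(\<Sum>z<n. if P then (if Q then c * g z else 0) else 0)
      = (if P then (if Q then c * (\<Sum>z<n. g z) else 0) else 0)" for P Q and c :: real and g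
    by (auto simp: sum_distrib_left)
  have "nb_apply n X (Suc l) f a b = (\<Sum>y\<in>{..Suc l} \<rightarrow>\<^sub>E {..<n}. \<Sum>z<n.
      if \<forall>i. 0 < i \<and> i \<le> l \<longrightarrow> y (i - 1) \<noteq> y (Suc i) then
        (if y 0 = a \<and> y 1 = b then (\<Prod>i<l. X (y (Suc i)) (y (Suc (Suc i))))
           * (if z = y l then 0 else X (y (Suc l)) z * f (y (Suc l)) z) else 0) else 0)"
    unfolding nb_apply_def fil
  proof (subst sum_PiE_atMost_Suc, intro sum.cong refl)
    fix y :: "nat \<Rightarrow> nat" and z
    let ?w = "y(Suc (Suc l) := z)"
    have 1: "(\<forall>i. 0 < i \<and> i \<le> Suc l \<longrightarrow> ?w (i - 1) \<noteq> ?w (Suc i))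
       \<longleftrightarrow> (\<forall>i. 0 < i \<and> i \<le> l \<longrightarrow> y (i - 1) \<noteq> y (Suc i)) \<and> z \<noteq> y l"
    proof -
      have "(\<forall>i. 0 < i \<and> i \<le> Suc l \<longrightarrow> ?w (i - 1) \<noteq> ?w (Suc i))
        \<longleftrightarrow> (\<forall>i. 0 < i \<and> i \<le> l \<longrightarrow> ?w (i - 1) \<noteq> ?w (Suc i)) \<and> ?w (Suc l - 1) \<noteq> ?w (Suc (Suc l))"
        by (rule all_pos_le_Suc)
      also have "(\<forall>i. 0 < i \<and> i \<le> l \<longrightarrow> ?w (i - 1) \<noteq> ?w (Suc i))
        \<longleftrightarrow> (\<forall>i. 0 < i \<and> i \<le> l \<longrightarrow> y (i - 1) \<noteq> y (Suc i))"
      proof -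
        have "?w (i - 1) = y (i - 1)" "?w (Suc i) = y (Suc i)" if "i \<le> l" for i
          using that by auto
        then have "(0 < i \<and> i \<le> l \<longrightarrow> ?w (i - 1) \<noteq> ?w (Suc i)) \<longleftrightarrow> (0 < i \<and> i \<le> l \<longrightarrow> y (i - 1) \<noteq> y (Suc i))" for i
          by simp
        then show ?thesis by simp
      qed
      finally show ?thesis by auto
    qed
    have 2: "(\<Prod>i<Suc l. X (?w (Suc i)) (?w (Suc (Suc i))))
       = (\<Prod>i<l. X (y (Suc i)) (y (Suc (Suc i)))) * X (y (Suc l)) z"
    proof -
      have "(\<Prod>i<l. X (?w (Suc i)) (?w (Suc (Suc i)))) = (\<Prod>i<l. X (y (Suc i)) (y (Suc (Suc i))))"
        by (intro prod.cong) auto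
      then show ?thesis by simp
    qed
    have 3: "?w 0 = y 0" "?w 1 = y 1" "?w (Suc l) = y (Suc l)" "?w (Suc (Suc l)) = z" by auto
    show "(if \<forall>i. 0 < i \<and> i \<le> Suc l \<longrightarrow> ?w (i - 1) \<noteq> ?w (Suc i)
           then if ?w 0 = a \<and> ?w 1 = b
             then (\<Prod>i<Suc l. X (?w (Suc i)) (?w (Suc (Suc i)))) * f (?w (Suc l)) (?w (Suc (Suc l)))
             else 0
           else 0) =
          (if \<forall>i. 0 < i \<and> i \<le> l \<longrightarrow> y (i - 1) \<noteq> y (Suc i) then
        (if y 0 = a \<and> y 1 = b then (\<Prod>i<l. X (y (Suc i)) (y (Suc (Suc i))))
           * (if z = y l then 0 else X (y (Suc l)) z * f (y (Suc l)) z) else 0) else 0)"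
      unfolding 1 2 3 by (auto simp: mult_ac)
  qed
  also have "\<dots> = (\<Sum>y\<in>{..Suc l} \<rightarrow>\<^sub>E {..<n}. lam *
      (if \<forall>i. 0 < i \<and> i \<le> l \<longrightarrow> y (i - 1) \<noteq> y (Suc i) then
        (if y 0 = a \<and> y 1 = b then (\<Prod>i<l. X (y (Suc i)) (y (Suc (Suc i)))) * f (y l) (y (Suc l)) else 0) else 0))"
  proof (intro sum.cong refl)
    fix y assume y: "y \<in> {..Suc l} \<rightarrow>\<^sub>E {..<n}"
    have h: "(\<Sum>z<n. if z = y l then 0 else X (y (Suc l)) z * f (y (Suc l)) z) = lam * f (y l) (y (Suc l))"
      by (rule f) (use y in \<open>auto simp: PiE_iff\<close>)
    show "(\<Sum>z<n.
      if \<forall>i. 0 < i \<and> i \<le> l \<longrightarrow> y (i - 1) \<noteq> y (Suc i) then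
        (if y 0 = a \<and> y 1 = b then (\<Prod>i<l. X (y (Suc i)) (y (Suc (Suc i))))
           * (if z = y l then 0 else X (y (Suc l)) z * f (y (Suc l)) z) else 0) else 0) = lam *
      (if \<forall>i. 0 < i \<and> i \<le> l \<longrightarrow> y (i - 1) \<noteq> y (Suc i) then
        (if y 0 = a \<and> y 1 = b then (\<Prod>i<l. X (y (Suc i)) (y (Suc (Suc i)))) * f (y l) (y (Suc l)) else 0) else 0)"
      unfolding pull h by auto
  qed
  also have "\<dots> = lam * nb_apply n X l f a b"
    unfolding nb_apply_def fil by (rule sum_distrib_left[symmetric])
  finally show ?thesis .
qed

lemma nb_apply_nb_power:
  "nb_apply n X l f a b = (\<Sum>(c, d)\<in>{..<n} \<times> {..<n}. nb_power n X l (a, b, c, d) * f c d)"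
proof -
  have "(\<Sum>(c, d)\<in>{..<n} \<times> {..<n}. nb_power n X l (a, b, c, d) * f c d)
    = (\<Sum>q\<in>{..<n} \<times> {..<n}. \<Sum>y\<in>nb_paths n l. if path_ends l y = (a, b, fst q, snd q)
        then (\<Prod>i<l. X (y (Suc i)) (y (Suc (Suc i)))) * f (fst q) (snd q) else 0)"
    unfolding nb_power_def by (intro sum.cong refl) (auto simp: sum_distrib_right case_prod_beta intro!: sum.cong)
  also have "\<dots> = (\<Sum>y\<in>nb_paths n l. \<Sum>q\<in>{..<n} \<times> {..<n}. if path_ends l y = (a, b, fst q, snd q)
        then (\<Prod>i<l. X (y (Suc i)) (y (Suc (Suc i)))) * f (fst q) (snd q) else 0)"
    by (rule sum.swap)
  also have "\<dots> = nb_apply n X l f a b"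
    unfolding nb_apply_def
  proof (intro sum.cong refl)
    fix y assume y: "y \<in> nb_paths n l"
    then have yn: "(y l, y (Suc l)) \<in> {..<n} \<times> {..<n}" unfolding nb_paths_def by (auto simp: PiE_iff)
    have "(\<Sum>q\<in>{..<n} \<times> {..<n}. if path_ends l y = (a, b, fst q, snd q)
        then (\<Prod>i<l. X (y (Suc i)) (y (Suc (Suc i)))) * f (fst q) (snd q) else 0)
      = (\<Sum>q\<in>{..<n} \<times> {..<n}. if q = (y l, y (Suc l)) then (if y 0 = a \<and> y 1 = b
        then (\<Prod>i<l. X (y (Suc i)) (y (Suc (Suc i)))) * f (y l) (y (Suc l)) else 0) else 0)"
      by (intro sum.cong refl) (auto simp: path_ends_def)
    then show "(\<Sum>q\<in>{..<n} \<times> {..<n}. if path_ends l y = (a, b, fst q, snd q)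
        then (\<Prod>i<l. X (y (Suc i)) (y (Suc (Suc i)))) * f (fst q) (snd q) else 0)
      = (if y 0 = a \<and> y 1 = b
        then (\<Prod>i<l. X (y (Suc i)) (y (Suc (Suc i)))) * f (y l) (y (Suc l)) else 0)"
      using yn by (simp add: sum.delta)
  qed
  finally show ?thesis ..
qed

text \<open>The hypothesis \<open>f\<close> says that \<open>f\<close> is an eigenvector, so the
  \<open>l\<close>-th power of the matrix scales it by \<open>lam ^ l\<close>. Cauchy-Schwarz in
  each row bounds the squared norm of the result by the squared Frobenius norm times that of
  \<open>f\<close>.\<close>

lemma eigenvalue_le_nb_frobenius:
  assumes f: "\<And>i j. i < n \<Longrightarrow> j < n \<Longrightarrow> (\<Sum>k<n. if k = i then 0 else X j k * f j k) = lam * f i j"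
    and ne: "\<exists>i<n. \<exists>j<n. f i j \<noteq> 0"
  shows "lam ^ (2 * l) \<le> nb_frobenius n X l"
proof -
  let ?P = "{..<n} \<times> {..<n}"
  define F where "F = (\<Sum>(c, d)\<in>?P. (f c d)\<^sup>2)"
  obtain i j where ij: "i < n" "j < n" "f i j \<noteq> 0" using ne by auto
  have "(f i j)\<^sup>2 \<le> F"
    unfolding F_def using member_le_sum[of "(i, j)" ?P "\<lambda>(c, d). (f c d)\<^sup>2"] ij by auto
  moreover have "0 < (f i j)\<^sup>2" using ij by simp
  ultimately have F: "0 < F" by linarith
  have gen: "nb_apply n X l f a b = lam ^ l * f a b" if "a < n" "b < n" for a b
    by (induction l) (auto simp: nb_apply_0[OF that] nb_apply_Suc[OF f])
  have "lam ^ (2 * l) * F = (\<Sum>(a, b)\<in>?P. (lam ^ l * f a b)\<^sup>2)"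
    unfolding F_def sum_distrib_left
    by (intro sum.cong refl) (auto simp: power_mult_distrib power_mult[symmetric] mult.commute[of 2])
  also have "\<dots> = (\<Sum>(a, b)\<in>?P. (\<Sum>(c, d)\<in>?P. nb_power n X l (a, b, c, d) * f c d)\<^sup>2)"
    by (intro sum.cong refl) (auto simp: gen nb_apply_nb_power[symmetric])
  also have "\<dots> \<le> (\<Sum>(a, b)\<in>?P. (\<Sum>(c, d)\<in>?P. (nb_power n X l (a, b, c, d))\<^sup>2) * F)"
    unfolding F_def case_prod_beta by (intro sum_mono Cauchy_Schwarz_ineq_sum)
  also have "\<dots> = nb_frobenius n X l * F"
    unfolding nb_frobenius_def by (simp only: sum_distrib_right sum.cartesian_product' case_prod_conv)
  finally show ?thesis using F by (rule mult_right_le_imp_le)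
qed

text \<open>A kernel vector \<open>y\<close> lifts to directed edges: the kernel equation becomes
  \<open>f2\<close>, and removing the backtracking term from \<open>f2\<close> leaves by
  \<open>f1\<close> exactly the eigenvalue equation. The lift is nonzero because \<open>f2\<close>
  recovers \<open>y\<close>.\<close>

lemma ihara_bass:
  assumes sym: "\<And>i j. X i j = X j i" and bd: "\<And>i j. \<bar>X i j\<bar> \<le> 1" and lam1: "1 < lam"
    and ker: "\<And>i. i < n \<Longrightarrow> (\<Sum>j<n. ihara_bass_mat n X lam i j * y j) = 0" and ne: "\<exists>i<n. y i \<noteq> 0"
  shows "lam ^ (2 * l) \<le> nb_frobenius n X l"
proof -
  \<comment> \<open>the solution of the equations \<open>f1\<close> below for both orientations of the edge\<close>
  define f where "f i j = (lam * y j - X i j * y i) / (lam\<^sup>2 - (X i j)\<^sup>2)" for i j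
  have sq: "(X i j)\<^sup>2 < lam\<^sup>2" for i j
  proof -
    have "(X i j)\<^sup>2 \<le> 1" using bd[of i j] by (simp add: abs_square_le_1)
    also have "1 < lam\<^sup>2" using lam1 by (simp add: one_less_power)
    finally show ?thesis .
  qed
  have f1: "lam * f i j = y j - X i j * f j i" for i j
  proof -
    have "lam\<^sup>2 - (X i j)\<^sup>2 \<noteq> 0" using sq[of i j] by simp
    then show ?thesis unfolding f_def sym[of j i] by (simp add: field_simps power2_eq_square)
  qed
  have f2: "(\<Sum>k<n. X j k * f j k) = y j" if j: "j < n" for j
  proof -
    have "(\<Sum>k<n. ihara_bass_mat n X lam j k * y k) = (\<Sum>k<n. (if k = j then (1 + (\<Sum>k<n. (X j k)\<^sup>2 / (lam\<^sup>2 - (X j k)\<^sup>2))) * y j else 0)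
       - lam * X j k / (lam\<^sup>2 - (X j k)\<^sup>2) * y k)"
      unfolding ihara_bass_mat_def by (intro sum.cong refl) (auto simp: left_diff_distrib)
    also have "\<dots> = y j + (\<Sum>k<n. (X j k)\<^sup>2 / (lam\<^sup>2 - (X j k)\<^sup>2) * y j) - (\<Sum>k<n. lam * X j k / (lam\<^sup>2 - (X j k)\<^sup>2) * y k)"
      using j by (simp add: sum_subtractf distrib_right sum_distrib_right)
    also have "\<dots> = y j - (\<Sum>k<n. X j k * f j k)"
    proof -
      have "X j k * f j k = lam * X j k / (lam\<^sup>2 - (X j k)\<^sup>2) * y k - (X j k)\<^sup>2 / (lam\<^sup>2 - (X j k)\<^sup>2) * y j" for k
        unfolding f_def by (simp add: diff_divide_distrib power2_eq_square algebra_simps)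
      then show ?thesis by (simp add: sum_subtractf)
    qed
    finally show ?thesis using ker[OF j] by simp
  qed
  show ?thesis
  proof (rule eigenvalue_le_nb_frobenius)
    show "(\<Sum>k<n. if k = i then 0 else X j k * f j k) = lam * f i j" if ij: "i < n" "j < n" for i j
    proof -
      have "(\<Sum>k<n. X j k * f j k) = (\<Sum>k<n. if k = i then 0 else X j k * f j k) + X j i * f j i"
        using ij by (simp add: sum.remove[of "{..<n}" i] if_distrib cong: if_cong)
      then show ?thesis using f1[of i j] f2[OF ij(2)] sym[of i j] by simp
    qed
    show "\<exists>i<n. \<exists>j<n. f i j \<noteq> 0"
    proof (rule ccontr)
      assume "\<not> (\<exists>i<n. \<exists>j<n. f i j \<noteq> 0)"
      then have "y j = 0" if "j < n" for j using f2[OF that] that by simp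
      then show False using ne by auto
    qed
  qed
qed

section \<open>From the non-backtracking matrix to the quadratic form\<close>

lemma sum_abs_pair_le:
  fixes w :: "nat \<Rightarrow> nat \<Rightarrow> real"
  assumes sym: "\<And>i j. w i j = w j i" and w0: "\<And>i j. 0 \<le> w i j"
    and row: "\<And>i. i < n \<Longrightarrow> (\<Sum>j<n. w i j) \<le> c"
  shows "(\<Sum>i<n. \<Sum>j<n. w i j * \<bar>x i * x j\<bar>) \<le> c * (\<Sum>i<n. (x i)\<^sup>2)"
proof -
  have am: "\<bar>x i * x j\<bar> \<le> (x i)\<^sup>2 / 2 + (x j)\<^sup>2 / 2" for i j
    using sum_squares_bound[of "\<bar>x i\<bar>" "\<bar>x j\<bar>"] by (simp add: abs_mult)
  have "(\<Sum>i<n. \<Sum>j<n. w i j * \<bar>x i * x j\<bar>)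
    \<le> (\<Sum>i<n. \<Sum>j<n. w i j * ((x i)\<^sup>2 / 2) + w i j * ((x j)\<^sup>2 / 2))"
    unfolding distrib_left[symmetric] by (intro sum_mono mult_left_mono am w0)
  also have "\<dots> = (\<Sum>i<n. \<Sum>j<n. w i j * ((x i)\<^sup>2 / 2)) + (\<Sum>i<n. \<Sum>j<n. w i j * ((x j)\<^sup>2 / 2))"
    by (simp add: sum.distrib)
  also have "(\<Sum>i<n. \<Sum>j<n. w i j * ((x j)\<^sup>2 / 2)) = (\<Sum>i<n. \<Sum>j<n. w i j * ((x i)\<^sup>2 / 2))"
    by (subst sum.swap) (simp add: sym)
  also have "(\<Sum>i<n. \<Sum>j<n. w i j * ((x i)\<^sup>2 / 2)) + (\<Sum>i<n. \<Sum>j<n. w i j * ((x i)\<^sup>2 / 2))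
     = (\<Sum>i<n. (\<Sum>j<n. w i j) * (x i)\<^sup>2)"
    by (simp add: sum_distrib_right flip: sum.distrib)
  also have "\<dots> \<le> (\<Sum>i<n. c * (x i)\<^sup>2)"
    by (intro sum_mono mult_right_mono row) auto
  finally show ?thesis by (simp add: sum_distrib_left)
qed

lemma quad_form_ihara_bass_mat:
  "quad_form n (ihara_bass_mat n X lam) x = (\<Sum>i<n. (x i)\<^sup>2 * (1 + (\<Sum>k<n. (X i k)\<^sup>2 / (lam\<^sup>2 - (X i k)\<^sup>2))))
     - (\<Sum>i<n. \<Sum>j<n. lam * X i j / (lam\<^sup>2 - (X i j)\<^sup>2) * (x i * x j))"
proof -
  have "quad_form n (ihara_bass_mat n X lam) x = (\<Sum>i<n. \<Sum>j<n. (if j = i then (x i)\<^sup>2 * (1 + (\<Sum>k<n. (X i k)\<^sup>2 / (lam\<^sup>2 - (X i k)\<^sup>2))) else 0)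
     - lam * X i j / (lam\<^sup>2 - (X i j)\<^sup>2) * (x i * x j))"
    unfolding quad_form_def ihara_bass_mat_def by (intro sum.cong refl) (auto simp: algebra_simps power2_eq_square)
  then show ?thesis by (simp add: sum_subtractf)
qed

context
  fixes n :: nat and X :: "nat \<Rightarrow> nat \<Rightarrow> real"
  assumes sym: "\<And>i j. X i j = X j i" and bd: "\<And>i j. \<bar>X i j\<bar> \<le> 1"
begin

lemma sq_le1: "(X i j)\<^sup>2 \<le> 1"
  using bd[of i j] by (simp add: abs_square_le_1)

lemma den_ge: "1 < lam \<Longrightarrow> 0 < lam\<^sup>2 - 1" "lam\<^sup>2 - 1 \<le> lam\<^sup>2 - (X i j)\<^sup>2"
  using sq_le1[of i j] by (auto simp: one_less_power)

text \<open>The end point of the continuity argument. The off-diagonal part is at most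
  \<open>n * lam / (lam\<^sup>2 - 1)\<close> times the squared norm, and
  \<open>lam \<ge> n + 2\<close> makes this less than the contribution of the identity.\<close>

lemma ihara_bass_mat_pd_large:
  assumes lam: "real n + 2 \<le> lam" and x: "\<exists>i<n. x i \<noteq> 0"
  shows "0 < quad_form n (ihara_bass_mat n X lam) x"
proof -
  have l1: "1 < lam" using lam by simp
  have d: "0 < lam\<^sup>2 - (X i j)\<^sup>2" for i j using den_ge(1)[OF l1] den_ge(2)[of lam i j] by linarith
  define N where "N = (\<Sum>i<n. (x i)\<^sup>2)"
  obtain i where i: "i < n" "x i \<noteq> 0" using x by auto
  have "(x i)\<^sup>2 \<le> N" unfolding N_def by (rule member_le_sum) (use i in auto)
  then have N: "0 < N" using i(2) by (smt (verit) zero_less_power2)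
  have "(\<Sum>i<n. \<Sum>j<n. lam * X i j / (lam\<^sup>2 - (X i j)\<^sup>2) * (x i * x j))
     \<le> (\<Sum>i<n. \<Sum>j<n. lam / (lam\<^sup>2 - 1) * \<bar>x i * x j\<bar>)"
  proof (intro sum_mono)
    fix i j
    have "lam * X i j / (lam\<^sup>2 - (X i j)\<^sup>2) * (x i * x j) \<le> \<bar>lam * X i j / (lam\<^sup>2 - (X i j)\<^sup>2)\<bar> * \<bar>x i * x j\<bar>"
      by (metis abs_ge_self abs_mult)
    also have "\<dots> \<le> lam / (lam\<^sup>2 - 1) * \<bar>x i * x j\<bar>"
    proof (rule mult_right_mono)
      have "\<bar>lam * X i j / (lam\<^sup>2 - (X i j)\<^sup>2)\<bar> = lam * \<bar>X i j\<bar> / (lam\<^sup>2 - (X i j)\<^sup>2)"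
        using d[of i j] l1 by (simp add: abs_mult)
      also have "\<dots> \<le> lam * 1 / (lam\<^sup>2 - 1)"
        by (intro frac_le mult_left_mono bd den_ge(1)[OF l1] den_ge(2)) (use l1 in auto)
      finally show "\<bar>lam * X i j / (lam\<^sup>2 - (X i j)\<^sup>2)\<bar> \<le> lam / (lam\<^sup>2 - 1)" by simp
    qed simp
    finally show "lam * X i j / (lam\<^sup>2 - (X i j)\<^sup>2) * (x i * x j) \<le> lam / (lam\<^sup>2 - 1) * \<bar>x i * x j\<bar>" .
  qed
  also have "\<dots> \<le> (real n * (lam / (lam\<^sup>2 - 1))) * N"
    unfolding N_def by (rule sum_abs_pair_le) (use den_ge(1)[OF l1] l1 in auto)
  also have "\<dots> < 1 * N"
  proof (rule mult_strict_right_mono[OF _ N])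
    have "real n * lam \<le> (lam - 2) * lam" using lam by (intro mult_right_mono) auto
    also have "\<dots> < lam\<^sup>2 - 1" using l1 by (simp add: power2_eq_square algebra_simps)
    finally show "real n * (lam / (lam\<^sup>2 - 1)) < 1" using den_ge(1)[OF l1] by (simp add: field_simps)
  qed
  also have "1 * N \<le> (\<Sum>i<n. (x i)\<^sup>2 * (1 + (\<Sum>k<n. (X i k)\<^sup>2 / (lam\<^sup>2 - (X i k)\<^sup>2))))"
    unfolding N_def mult_1
  proof (rule sum_mono)
    fix i
    have "0 \<le> (\<Sum>k<n. (X i k)\<^sup>2 / (lam\<^sup>2 - (X i k)\<^sup>2))"
      by (intro sum_nonneg divide_nonneg_nonneg) (use d less_imp_le in auto)
    then show "(x i)\<^sup>2 \<le> (x i)\<^sup>2 * (1 + (\<Sum>k<n. (X i k)\<^sup>2 / (lam\<^sup>2 - (X i k)\<^sup>2)))"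
      by (simp add: distrib_left)
  qed
  finally show ?thesis unfolding quad_form_ihara_bass_mat by simp
qed

text \<open>A singular matrix at some \<open>t \<ge> lam\<close> would give
  \<open>t ^ (2 * l) \<le> nb_frobenius n X l\<close>, against the hypothesis; so definiteness
  persists from large parameters down to \<open>lam\<close>.\<close>

lemma ihara_bass_mat_pd:
  assumes lam: "1 < lam" and nb_frobenius: "nb_frobenius n X l < lam ^ (2 * l)" and x: "\<exists>i<n. x i \<noteq> 0"
  shows "0 < quad_form n (ihara_bass_mat n X lam) x"
proof (rule definite_along_path[where b = "lam + real n + 2"])
  show "ihara_bass_mat n X t i j = ihara_bass_mat n X t j i" for t i j unfolding ihara_bass_mat_def using sym[of i j] by auto
  show "0 < quad_form n (ihara_bass_mat n X (lam + real n + 2)) x" if "\<exists>i<n. x i \<noteq> 0" for x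
    by (rule ihara_bass_mat_pd_large[OF _ that]) (use lam in simp)
  show "continuous_on {lam..lam + real n + 2} (\<lambda>t. ihara_bass_mat n X t i j)" for i j
  proof -
    have "t\<^sup>2 - (X i k)\<^sup>2 \<noteq> 0" if "t \<in> {lam..lam + real n + 2}" for t i k
    proof -
      have "1 < t" using that lam by simp
      then show ?thesis using den_ge(1)[of t] den_ge(2)[of t i k] by linarith
    qed
    then show ?thesis unfolding ihara_bass_mat_def by (cases "i = j") (auto intro!: continuous_intros)
  qed
  show "\<exists>i<n. (\<Sum>j<n. ihara_bass_mat n X t i j * y j) \<noteq> 0"
    if t: "t \<in> {lam..lam + real n + 2}" and y: "\<exists>i<n. y i \<noteq> 0" for t y
  proof (rule ccontr)
    assume "\<not> (\<exists>i<n. (\<Sum>j<n. ihara_bass_mat n X t i j * y j) \<noteq> 0)"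
    then have "t ^ (2 * l) \<le> nb_frobenius n X l"
      by (intro ihara_bass[where y = y] sym bd y) (use t lam in auto)
    moreover have "lam ^ (2 * l) \<le> t ^ (2 * l)" using t lam by (intro power_mono) auto
    ultimately show False using nb_frobenius by simp
  qed
qed (use x in auto)

text \<open>Definiteness bounds the form with entries
  \<open>lam * X i j / (lam\<^sup>2 - (X i j)\<^sup>2)\<close>. These differ from
  \<open>X i j / lam\<close> by a cubic term, which the row sums of squares control because the
  entries are at most 1 in absolute value. For \<open>R\<close> near \<rho> and \<open>lam\<close>
  near \<open>sqrt \<rho>\<close> the constant is close to \<open>2 * sqrt \<rho>\<close>.\<close>

lemma quad_form_le_of_nb_frobenius:
  assumes lam: "1 < lam" and nb_frobenius: "nb_frobenius n X l < lam ^ (2 * l)"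
    and row: "\<And>i. i < n \<Longrightarrow> (\<Sum>j<n. (X i j)\<^sup>2) \<le> R" and R: "0 \<le> R"
  shows "quad_form n X x \<le> (lam + R / (lam - 1)) * (\<Sum>i<n. (x i)\<^sup>2)"
proof (cases "\<exists>i<n. x i \<noteq> 0")
  case False
  then show ?thesis unfolding quad_form_def by simp
next
  case True
  let ?N = "\<Sum>i<n. (x i)\<^sup>2"
  let ?D = "\<lambda>i j. lam\<^sup>2 - (X i j)\<^sup>2"
  have d1: "0 < lam\<^sup>2 - 1" by (rule den_ge(1)[OF lam])
  have d: "0 < ?D i j" for i j using d1 den_ge(2)[of lam i j] by linarith
  have split: "X i j / lam = lam * X i j / ?D i j - (X i j) ^ 3 / (lam * ?D i j)" for i j
  proof -
    have D: "?D i j \<noteq> 0" using d[of i j] by simp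
    have "lam * X i j / ?D i j = lam\<^sup>2 * X i j / (lam * ?D i j)"
      using lam by (simp add: power2_eq_square)
    then have "lam * X i j / ?D i j - (X i j) ^ 3 / (lam * ?D i j) = (X i j * ?D i j) / (lam * ?D i j)"
      by (simp add: power3_eq_cube power2_eq_square right_diff_distrib mult_ac flip: diff_divide_distrib)
    then show ?thesis using D by simp
  qed
  have e1: "quad_form n X x / lam = (\<Sum>i<n. \<Sum>j<n. X i j / lam * (x i * x j))"
    unfolding quad_form_def by (simp add: sum_divide_distrib)
  have e2: "\<dots> = (\<Sum>i<n. \<Sum>j<n. lam * X i j / ?D i j * (x i * x j))
      - (\<Sum>i<n. \<Sum>j<n. (X i j) ^ 3 / (lam * ?D i j) * (x i * x j))"
    unfolding split by (simp only: left_diff_distrib sum_subtractf)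
  have "(\<Sum>i<n. \<Sum>j<n. lam * X i j / ?D i j * (x i * x j))
      \<le> (\<Sum>i<n. (x i)\<^sup>2 * (1 + (\<Sum>k<n. (X i k)\<^sup>2 / ?D i k)))"
    using ihara_bass_mat_pd[OF lam nb_frobenius True] unfolding quad_form_ihara_bass_mat by simp
  also have "\<dots> \<le> (\<Sum>i<n. (x i)\<^sup>2 * (1 + R / (lam\<^sup>2 - 1)))"
  proof (intro sum_mono mult_left_mono add_left_mono)
    fix i assume "i \<in> {..<n}"
    then have i: "i < n" by simp
    have "(\<Sum>k<n. (X i k)\<^sup>2 / ?D i k) \<le> (\<Sum>k<n. (X i k)\<^sup>2 / (lam\<^sup>2 - 1))"
      by (intro sum_mono divide_left_mono den_ge(2) mult_pos_pos d d1) simp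
    also have "\<dots> \<le> R / (lam\<^sup>2 - 1)"
      unfolding sum_divide_distrib[symmetric] by (intro divide_right_mono row i) (use d1 in simp)
    finally show "(\<Sum>k<n. (X i k)\<^sup>2 / ?D i k) \<le> R / (lam\<^sup>2 - 1)" .
  qed simp
  also have "\<dots> = (1 + R / (lam\<^sup>2 - 1)) * ?N"
    by (subst sum_distrib_left) (simp only: mult.commute)
  finally have e3: "(\<Sum>i<n. \<Sum>j<n. lam * X i j / ?D i j * (x i * x j)) \<le> (1 + R / (lam\<^sup>2 - 1)) * ?N" .
  have "- (\<Sum>i<n. \<Sum>j<n. (X i j) ^ 3 / (lam * ?D i j) * (x i * x j))
      \<le> (\<Sum>i<n. \<Sum>j<n. (X i j)\<^sup>2 / (lam * (lam\<^sup>2 - 1)) * \<bar>x i * x j\<bar>)"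
    unfolding sum_negf[symmetric]
  proof (intro sum_mono)
    fix i j
    have "- ((X i j) ^ 3 / (lam * ?D i j) * (x i * x j)) \<le> \<bar>(X i j) ^ 3 / (lam * ?D i j)\<bar> * \<bar>x i * x j\<bar>"
      by (metis abs_ge_minus_self abs_mult)
    also have "\<dots> \<le> (X i j)\<^sup>2 / (lam * (lam\<^sup>2 - 1)) * \<bar>x i * x j\<bar>"
    proof (rule mult_right_mono)
      have "\<bar>(X i j) ^ 3\<bar> = (X i j)\<^sup>2 * \<bar>X i j\<bar>" by (simp add: power3_eq_cube power2_eq_square abs_mult)
      also have "\<dots> \<le> (X i j)\<^sup>2 * 1" by (intro mult_left_mono bd) simp
      finally have "\<bar>(X i j) ^ 3\<bar> / (lam * ?D i j) \<le> (X i j)\<^sup>2 / (lam * (lam\<^sup>2 - 1))"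
        by (intro frac_le mult_left_mono den_ge(2) mult_pos_pos d1) (use lam in auto)
      then show "\<bar>(X i j) ^ 3 / (lam * ?D i j)\<bar> \<le> (X i j)\<^sup>2 / (lam * (lam\<^sup>2 - 1))"
        using d[of i j] lam by (simp add: abs_mult)
    qed simp
    finally show "- ((X i j) ^ 3 / (lam * ?D i j) * (x i * x j)) \<le> (X i j)\<^sup>2 / (lam * (lam\<^sup>2 - 1)) * \<bar>x i * x j\<bar>" .
  qed
  also have "\<dots> \<le> R / (lam * (lam\<^sup>2 - 1)) * ?N"
  proof (rule sum_abs_pair_le)
    show "(\<Sum>j<n. (X i j)\<^sup>2 / (lam * (lam\<^sup>2 - 1))) \<le> R / (lam * (lam\<^sup>2 - 1))" if "i < n" for i
      unfolding sum_divide_distrib[symmetric] by (intro divide_right_mono row that) (use d1 lam in simp)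
    show "0 \<le> (X i j)\<^sup>2 / (lam * (lam\<^sup>2 - 1))" for i j using d1 lam by simp
  qed (simp add: sym)
  finally have e4: "- (\<Sum>i<n. \<Sum>j<n. (X i j) ^ 3 / (lam * ?D i j) * (x i * x j))
    \<le> R / (lam * (lam\<^sup>2 - 1)) * ?N" .
  have "quad_form n X x / lam \<le> (1 + R / (lam\<^sup>2 - 1)) * ?N + R / (lam * (lam\<^sup>2 - 1)) * ?N"
    using e1 e2 e3 e4 by linarith
  then have "quad_form n X x / lam \<le> (1 + R / (lam\<^sup>2 - 1) + R / (lam * (lam\<^sup>2 - 1))) * ?N"
    by (simp only: distrib_right)
  then have "quad_form n X x \<le> lam * ((1 + R / (lam\<^sup>2 - 1) + R / (lam * (lam\<^sup>2 - 1))) * ?N)"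
    using lam by (simp add: pos_divide_le_eq mult.commute)
  also have "\<dots> = (lam * (1 + R / (lam\<^sup>2 - 1) + R / (lam * (lam\<^sup>2 - 1)))) * ?N" by simp
  also have "lam * (1 + R / (lam\<^sup>2 - 1) + R / (lam * (lam\<^sup>2 - 1))) = lam + R / (lam - 1)"
  proof -
    have f: "lam\<^sup>2 - 1 = (lam - 1) * (lam + 1)" by (simp add: power2_eq_square algebra_simps)
    have "lam * (1 + R / (lam\<^sup>2 - 1) + R / (lam * (lam\<^sup>2 - 1))) = lam + R * (lam + 1) / (lam\<^sup>2 - 1)"
      using lam by (simp add: distrib_left add_divide_distrib mult.commute)
    also have "\<dots> = lam + R / (lam - 1)" unfolding f using lam by simp
    finally show ?thesis .
  qed
  finally show ?thesis .
qed

end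

text \<open>The definiteness argument is one-sided; this lets it be repeated for \<open>- X\<close>
  to bound the form from below.\<close>

lemma nb_frobenius_uminus: "nb_frobenius n (\<lambda>i j. - X i j) l = nb_frobenius n X l"
proof -
  have "nb_power n (\<lambda>i j. - X i j) l k = (- 1) ^ l * nb_power n X l k" for k
    unfolding nb_power_def sum_distrib_left by (intro sum.cong refl) (simp add: prod_uminus)
  then show ?thesis unfolding nb_frobenius_def by (simp add: power_mult_distrib flip: power_mult)
qed

lemma abs_quad_form_le_of_nb_frobenius:
  assumes "\<And>i j. X i j = X j i" "\<And>i j. \<bar>X i j\<bar> \<le> 1" "1 < lam" "nb_frobenius n X l < lam ^ (2 * l)"
    "\<And>i. i < n \<Longrightarrow> (\<Sum>j<n. (X i j)\<^sup>2) \<le> R" "0 \<le> R"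
  shows "\<bar>quad_form n X x\<bar> \<le> (lam + R / (lam - 1)) * (\<Sum>i<n. (x i)\<^sup>2)"
proof (rule abs_leI)
  show "quad_form n X x \<le> (lam + R / (lam - 1)) * (\<Sum>i<n. (x i)\<^sup>2)"
    by (rule quad_form_le_of_nb_frobenius) (use assms in auto)
  have "quad_form n (\<lambda>i j. - X i j) x \<le> (lam + R / (lam - 1)) * (\<Sum>i<n. (x i)\<^sup>2)"
    by (rule quad_form_le_of_nb_frobenius) (use assms nb_frobenius_uminus in auto)
  then show "- quad_form n X x \<le> (lam + R / (lam - 1)) * (\<Sum>i<n. (x i)\<^sup>2)" by (simp add: quad_form_uminus)
qed

section \<open>Row sums of the centered matrix in terms of degrees\<close>

lemma centered_adj_row_sum:
  assumes "i < n"
  shows "(\<Sum>j<n. centered_adj p E i j) = real (degree_in n E i) - p * (real n - 1)"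
    and "(\<Sum>j<n. (centered_adj p E i j)\<^sup>2) = real (degree_in n E i) * (1 - 2 * p) + (real n - 1) * p\<^sup>2"
proof -
  have lin: "(\<Sum>j<n. if j = i then 0 else if edge_of i j \<in> E then u else w)
      = real (degree_in n E i) * (u - w) + (real n - 1) * w" for u w :: real
  proof -
    have "(\<Sum>j<n. if j = i then 0 else if edge_of i j \<in> E then u else w)
      = (\<Sum>j<n. (if j \<noteq> i \<and> edge_of i j \<in> E then u - w else 0) + (w - (if j = i then w else 0)))"
      by (intro sum.cong refl) auto
    also have "\<dots> = real (card {j. j < n \<and> j \<noteq> i \<and> edge_of i j \<in> E}) * (u - w) + (real n * w - w)"
      using assms by (simp add: sum.distrib sum_subtractf sum.If_cases Int_def conj_assoc)
    finally show ?thesis unfolding degree_in_def by (simp add: algebra_simps)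
  qed
  have "(\<Sum>j<n. centered_adj p E i j) = (\<Sum>j<n. if j = i then 0 else if edge_of i j \<in> E then 1 - p else - p)"
    by (intro sum.cong refl) (auto simp: centered_adj_def)
  then show "(\<Sum>j<n. centered_adj p E i j) = real (degree_in n E i) - p * (real n - 1)"
    unfolding lin by simp
  have "(\<Sum>j<n. (centered_adj p E i j)\<^sup>2) = (\<Sum>j<n. if j = i then 0 else if edge_of i j \<in> E then (1 - p)\<^sup>2 else p\<^sup>2)"
    by (intro sum.cong refl) (auto simp: centered_adj_def)
  then show "(\<Sum>j<n. (centered_adj p E i j)\<^sup>2) = real (degree_in n E i) * (1 - 2 * p) + (real n - 1) * p\<^sup>2"
    unfolding lin by (simp add: power2_eq_square algebra_simps)
qed

lemma centered_adj_row_sq_le: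
  assumes i: "i < n" and p: "0 \<le> p" "p \<le> 1" and rho: "\<rho> = real n * p"
    and deg: "\<bar>real (degree_in n E i) - \<rho>\<bar> \<le> \<delta> * \<rho>"
  shows "(\<Sum>j<n. (centered_adj p E i j)\<^sup>2) \<le> \<rho> * (1 + \<delta>)"
proof -
  let ?d = "real (degree_in n E i)"
  have "?d * (1 - 2 * p) = \<rho> * (1 - 2 * p) + (?d - \<rho>) * (1 - 2 * p)" by (simp add: algebra_simps)
  also have "(?d - \<rho>) * (1 - 2 * p) \<le> \<bar>?d - \<rho>\<bar> * \<bar>1 - 2 * p\<bar>" by (metis abs_ge_self abs_mult)
  also have "\<dots> \<le> \<delta> * \<rho> * 1" by (rule mult_mono) (use deg p in auto)
  finally have 1: "?d * (1 - 2 * p) \<le> \<rho> * (1 - 2 * p) + \<delta> * \<rho>" by simp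
  have "(real n - 1) * p\<^sup>2 \<le> real n * p\<^sup>2" by (intro mult_right_mono) auto
  also have "\<dots> = \<rho> * p" unfolding rho by (simp add: power2_eq_square)
  finally have 2: "(real n - 1) * p\<^sup>2 \<le> \<rho> * p" .
  have "0 \<le> \<rho> * p" using p rho by simp
  then show ?thesis unfolding centered_adj_row_sum(2)[OF i] using 1 2 by (simp add: algebra_simps)
qed

section \<open>Kernel vectors of the Ihara matrix\<close>

text \<open>Separates the deterministic part: of the randomness only \<open>deg\<close> and
  \<open>form_bound\<close> remain. It is used with \<open>\<delta> = q ^ 3\<close> and
  \<open>a = 2 + q\<^sup>2 + q ^ 3\<close>.\<close>

locale near_regular_graph =
  fixes n :: nat and p \<rho> \<delta> a :: real and E :: "(nat \<times> nat) set"
  assumes n_pos: "0 < n" and p: "0 < p" "p \<le> 1" and rho: "\<rho> = real n * p"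
    and deg: "\<And>i. i < n \<Longrightarrow> \<bar>real (degree_in n E i) - \<rho>\<bar> \<le> \<delta> * \<rho>"
    and form_bound: "\<And>x. \<bar>quad_form n (centered_adj p E) x\<bar> \<le> a * sqrt \<rho> * (\<Sum>i<n. (x i)\<^sup>2)"
begin

definition "d i = real (degree_in n E i)"
definition "A i j = (if i \<noteq> j \<and> edge_of i j \<in> E then 1 else 0 :: real)"

lemma rho_pos: "0 < \<rho>" using rho n_pos p by simp

lemma A_sym: "A i j = A j i" unfolding A_def by (auto simp: edge_of_commute)

lemma sum_A:
  assumes "i < n"
  shows "(\<Sum>j<n. A i j * y j) = (\<Sum>j<n. centered_adj p E i j * y j) + p * (\<Sum>j<n. y j) - p * y i"
proof -
  have "(\<Sum>j<n. A i j * y j) = (\<Sum>j<n. centered_adj p E i j * y j + p * y j - (if j = i then p * y j else 0))"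
    unfolding A_def centered_adj_def by (intro sum.cong refl) (auto simp: algebra_simps)
  then show ?thesis using assms by (simp add: sum.distrib sum_subtractf sum_distrib_left)
qed

lemma d_bounds:
  assumes "i < n"
  shows "1 - \<delta> - 1 / \<rho> \<le> (d i - 1) / \<rho>" "(d i - 1) / \<rho> \<le> 1 + \<delta>"
proof -
  have "\<rho> - \<delta> * \<rho> \<le> d i" "d i \<le> \<rho> + \<delta> * \<rho>" using deg[OF assms] unfolding d_def by auto
  then show "1 - \<delta> - 1 / \<rho> \<le> (d i - 1) / \<rho>" "(d i - 1) / \<rho> \<le> 1 + \<delta>"
    using divide_right_mono[of "\<rho> - \<delta> * \<rho> - 1" "d i - 1" \<rho>] divide_right_mono[of "d i - 1" "\<rho> + \<delta> * \<rho>" \<rho>] rho_pos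
    by (auto simp: diff_divide_distrib add_divide_distrib)
qed

text \<open>This is the case \<open>v = - w\<close>, where the rank one part contributes a
  nonnegative term to the form, so \<open>h1\<close> alone gives definiteness. The summand
  \<open>1 / sqrt \<rho>\<close> in \<open>h1\<close> pays for the diagonal of \<open>p J\<close>,
  which the adjacency matrix lacks.\<close>

lemma real_kernel_neg:
  assumes w: "0 < w" and h1: "a + 1 / sqrt \<rho> < 1 / w + w * (1 - \<delta> - 1 / \<rho>)"
    and ne: "\<exists>i<n. y i \<noteq> 0"
    and ker: "\<And>i. i < n \<Longrightarrow> y i * (1 + w\<^sup>2 / \<rho> * (d i - 1)) + w / sqrt \<rho> * (\<Sum>j<n. A i j * y j) = 0"
  shows False
proof -
  define N where "N = (\<Sum>i<n. (y i)\<^sup>2)"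
  obtain k where k: "k < n" "y k \<noteq> 0" using ne by auto
  have "(y k)\<^sup>2 \<le> N" unfolding N_def by (rule member_le_sum) (use k in auto)
  moreover have "0 < (y k)\<^sup>2" using k by simp
  ultimately have N: "0 < N" by linarith
  define s where "s = (\<Sum>j<n. y j)"
  \<comment> \<open>The kernel equation is divided by \<open>w\<close>, which makes its diagonal
    close to \<open>1 / w + w\<close>.\<close>
  define c where "c i = 1 / w + w * ((d i - 1) / \<rho>)" for i
  have ker': "y i * c i + (1 / sqrt \<rho>) * ((\<Sum>j<n. centered_adj p E i j * y j) + p * s - p * y i) = 0"
    if i: "i < n" for i
  proof -
    have "w * (y i * c i + (1 / sqrt \<rho>) * (\<Sum>j<n. A i j * y j)) = 0"
      using ker[OF i] w by (simp add: c_def distrib_left power2_eq_square mult_ac)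
    then show ?thesis using w unfolding sum_A[OF i] s_def by simp
  qed
  have "0 = (\<Sum>i<n. y i * (y i * c i + (1 / sqrt \<rho>) * ((\<Sum>j<n. centered_adj p E i j * y j) + p * s - p * y i)))"
    using ker' by simp
  also have "\<dots> = (\<Sum>i<n. (y i)\<^sup>2 * c i + (1 / sqrt \<rho>) * (\<Sum>j<n. centered_adj p E i j * (y i * y j))
      + (p * s / sqrt \<rho>) * y i - (p / sqrt \<rho>) * (y i)\<^sup>2)"
    by (intro sum.cong refl)
      (simp add: sum_distrib_left algebra_simps power2_eq_square add_divide_distrib diff_divide_distrib)
  also have "\<dots> = (\<Sum>i<n. (y i)\<^sup>2 * c i) + (1 / sqrt \<rho>) * quad_form n (centered_adj p E) y + (p * s / sqrt \<rho>) * s - (p / sqrt \<rho>) * N"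
    unfolding quad_form_def N_def s_def
    by (simp only: sum.distrib sum_subtractf sum_distrib_left[symmetric])
  finally have eq: "(\<Sum>i<n. (y i)\<^sup>2 * c i) + (1 / sqrt \<rho>) * quad_form n (centered_adj p E) y + (p * s / sqrt \<rho>) * s - (p / sqrt \<rho>) * N = 0" by simp
  have "(\<Sum>i<n. (y i)\<^sup>2 * (1 / w + w * (1 - \<delta> - 1 / \<rho>))) \<le> (\<Sum>i<n. (y i)\<^sup>2 * c i)"
    unfolding c_def by (intro sum_mono mult_left_mono add_left_mono d_bounds) (use w in auto)
  then have t1: "(1 / w + w * (1 - \<delta> - 1 / \<rho>)) * N \<le> (\<Sum>i<n. (y i)\<^sup>2 * c i)"
    unfolding N_def sum_distrib_right[symmetric] by (simp only: mult.commute)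
  have "- (a * sqrt \<rho> * N) \<le> quad_form n (centered_adj p E) y" using form_bound[of y] unfolding N_def by auto
  then have "(1 / sqrt \<rho>) * (- (a * sqrt \<rho> * N)) \<le> (1 / sqrt \<rho>) * quad_form n (centered_adj p E) y"
    using rho_pos by (intro mult_left_mono) auto
  then have t2: "- (a * N) \<le> (1 / sqrt \<rho>) * quad_form n (centered_adj p E) y" using rho_pos by simp
  have t3: "0 \<le> (p * s / sqrt \<rho>) * s"
  proof -
    have sq: "(p * s / sqrt \<rho>) * s = p * s\<^sup>2 / sqrt \<rho>" by (simp add: power2_eq_square)
    show ?thesis unfolding sq using p rho_pos by simp
  qed
  have t4: "(p / sqrt \<rho>) * N \<le> (1 / sqrt \<rho>) * N"
    using p rho_pos N by (intro mult_right_mono divide_right_mono) auto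
  have "(1 / w + w * (1 - \<delta> - 1 / \<rho>)) * N \<le> (a + 1 / sqrt \<rho>) * N"
    using eq t1 t2 t3 t4 unfolding distrib_right by linarith
  moreover have "(a + 1 / sqrt \<rho>) * N < (1 / w + w * (1 - \<delta> - 1 / \<rho>)) * N"
    by (rule mult_strict_right_mono[OF h1 N])
  ultimately show False by simp
qed

text \<open>For positive \<open>w\<close> the only obstruction to definiteness is the rank one perturbation by the
  all-ones matrix; testing against the all-ones vector shows that it is too large to produce a
  kernel.\<close>

lemma real_kernel_pos:
  assumes w: "0 < w" and h1: "a + 1 / sqrt \<rho> < 1 / w + w * (1 - \<delta> - 1 / \<rho>)"
    and h2: "1 / w + w * (1 + \<delta>) + \<delta> * sqrt \<rho> < sqrt \<rho>"
    and ne: "\<exists>i<n. y i \<noteq> 0"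
    and ker: "\<And>i. i < n \<Longrightarrow> y i * (1 + w\<^sup>2 / \<rho> * (d i - 1)) - w / sqrt \<rho> * (\<Sum>j<n. A i j * y j) = 0"
  shows False
proof -
  define c where "c i = 1 / w + w * ((d i - 1) / \<rho>) + p / sqrt \<rho>" for i
  \<comment> \<open>The Ihara matrix divided by \<open>w\<close>, with the rank one part added back;
    \<open>p / sqrt \<rho>\<close> in \<open>c\<close> corrects the diagonal. A kernel vector
    \<open>y\<close> is then mapped by \<open>Y\<close> to a constant vector with entries
    \<open>p * s / sqrt \<rho>\<close>.\<close>
  define Y where "Y i j = (if i = j then c i else 0) - centered_adj p E i j / sqrt \<rho>" for i j
  define s where "s = (\<Sum>j<n. y j)"
  have Ysym: "Y i j = Y j i" for i j unfolding Y_def by (auto simp: centered_adj_sym)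
  have Yrow: "(\<Sum>j<n. Y i j * x j) = c i * x i - (\<Sum>j<n. centered_adj p E i j * x j) / sqrt \<rho>" if "i < n" for i x
  proof -
    have "(\<Sum>j<n. Y i j * x j) = (\<Sum>j<n. (if j = i then c i * x i else 0) - centered_adj p E i j * x j / sqrt \<rho>)"
      unfolding Y_def by (intro sum.cong refl) (auto simp: left_diff_distrib)
    then show ?thesis using that by (simp add: sum_subtractf sum_divide_distrib)
  qed
  have qfY: "quad_form n Y x = (\<Sum>i<n. x i * (\<Sum>j<n. Y i j * x j))" for x
    unfolding quad_form_def by (simp add: sum_distrib_left mult_ac)
  have qfY': "quad_form n Y x = (\<Sum>i<n. (x i)\<^sup>2 * c i) - quad_form n (centered_adj p E) x / sqrt \<rho>" for x
  proof -
    have "quad_form n Y x = (\<Sum>i<n. (x i)\<^sup>2 * c i - (\<Sum>j<n. centered_adj p E i j * (x i * x j)) / sqrt \<rho>)"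
      unfolding qfY
    proof (intro sum.cong refl)
      fix i assume "i \<in> {..<n}"
      then have i: "i < n" by simp
      show "x i * (\<Sum>j<n. Y i j * x j) = (x i)\<^sup>2 * c i - (\<Sum>j<n. centered_adj p E i j * (x i * x j)) / sqrt \<rho>"
        unfolding Yrow[OF i] by (simp add: right_diff_distrib sum_distrib_left power2_eq_square mult_ac)
    qed
    then show ?thesis unfolding quad_form_def by (simp add: sum_subtractf sum_divide_distrib)
  qed
  have psd: "(1 / w + w * (1 - \<delta> - 1 / \<rho>) - a) * (\<Sum>i<n. (x i)\<^sup>2) \<le> quad_form n Y x" for x
  proof -
    have "(\<Sum>i<n. (x i)\<^sup>2 * (1 / w + w * (1 - \<delta> - 1 / \<rho>))) \<le> (\<Sum>i<n. (x i)\<^sup>2 * c i)"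
    proof (intro sum_mono mult_left_mono)
      fix i assume "i \<in> {..<n}"
      then have "w * (1 - \<delta> - 1 / \<rho>) \<le> w * ((d i - 1) / \<rho>)"
        by (intro mult_left_mono d_bounds) (use w in auto)
      moreover have "0 \<le> p / sqrt \<rho>" using p rho_pos by simp
      ultimately show "1 / w + w * (1 - \<delta> - 1 / \<rho>) \<le> c i" unfolding c_def by linarith
    qed auto
    then have t1: "(1 / w + w * (1 - \<delta> - 1 / \<rho>)) * (\<Sum>i<n. (x i)\<^sup>2) \<le> (\<Sum>i<n. (x i)\<^sup>2 * c i)"
      unfolding sum_distrib_right[symmetric] by (simp only: mult.commute)
    have "quad_form n (centered_adj p E) x / sqrt \<rho> \<le> a * sqrt \<rho> * (\<Sum>i<n. (x i)\<^sup>2) / sqrt \<rho>"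
      using form_bound[of x] rho_pos by (intro divide_right_mono) auto
    then have "quad_form n (centered_adj p E) x / sqrt \<rho> \<le> a * (\<Sum>i<n. (x i)\<^sup>2)" using rho_pos by simp
    then show ?thesis unfolding qfY' left_diff_distrib using t1 by linarith
  qed
  have pos: "0 < 1 / w + w * (1 - \<delta> - 1 / \<rho>) - a"
  proof -
    have "0 < 1 / sqrt \<rho>" using rho_pos by simp
    then show ?thesis using h1 by linarith
  qed
  have psd0: "0 \<le> quad_form n Y x" for x
    by (rule order_trans[OF mult_nonneg_nonneg psd]) (use pos in \<open>auto intro: sum_nonneg\<close>)
  have Yy: "(\<Sum>j<n. Y i j * y j) = p / sqrt \<rho> * s" if i: "i < n" for i
  proof -
    have "w * (y i * (1 / w + w * ((d i - 1) / \<rho>)) - (1 / sqrt \<rho>) * (\<Sum>j<n. A i j * y j)) = 0"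
      using ker[OF i] w by (simp add: distrib_left right_diff_distrib diff_divide_distrib power2_eq_square mult_ac)
    then have "y i * (1 / w + w * ((d i - 1) / \<rho>)) = (1 / sqrt \<rho>) * (\<Sum>j<n. A i j * y j)"
      using w by simp
    then show ?thesis unfolding Yrow[OF i] c_def sum_A[OF i] s_def
      by (simp add: algebra_simps add_divide_distrib diff_divide_distrib)
  qed
  have qy: "quad_form n Y y = p / sqrt \<rho> * s\<^sup>2"
  proof -
    have "quad_form n Y y = (\<Sum>i<n. y i * (p / sqrt \<rho> * s))" unfolding qfY by (simp add: Yy)
    also have "\<dots> = s * (p / sqrt \<rho> * s)" unfolding s_def by (rule sum_distrib_right[symmetric])
    finally show ?thesis by (simp add: power2_eq_square)
  qed
  have "s \<noteq> 0"
  proof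
    assume "s = 0"
    obtain k where k: "k < n" "y k \<noteq> 0" using ne by auto
    have "(y k)\<^sup>2 \<le> (\<Sum>i<n. (y i)\<^sup>2)" by (rule member_le_sum) (use k in auto)
    moreover have "0 < (y k)\<^sup>2" using k by simp
    ultimately have "0 < (\<Sum>i<n. (y i)\<^sup>2)" by linarith
    then have "0 < (1 / w + w * (1 - \<delta> - 1 / \<rho>) - a) * (\<Sum>i<n. (y i)\<^sup>2)"
      using pos by (intro mult_pos_pos)
    then show False using psd[of y] qy \<open>s = 0\<close> by simp
  qed
  \<comment> \<open>Cauchy-Schwarz for the form of \<open>Y\<close> by completing the square:
    \<open>n / s\<close> is the coefficient of the projection of the all-ones vector onto
    \<open>y\<close>. The outcome forces the form at the all-ones vector to be at least
    \<open>n * sqrt \<rho>\<close>, while near-regularity and \<open>h2\<close> make it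
    smaller.\<close>
  have "0 \<le> quad_form n Y (\<lambda>i. 1 + (- (real n / s)) * y i)" by (rule psd0)
  also have "\<dots> = quad_form n Y (\<lambda>i. 1) + 2 * (- (real n / s)) * (\<Sum>i<n. y i * (\<Sum>j<n. Y i j * 1)) + (- (real n / s))\<^sup>2 * quad_form n Y y"
    by (rule quad_form_add) (rule Ysym)
  also have "(\<Sum>i<n. y i * (\<Sum>j<n. Y i j * 1)) = (\<Sum>j<n. \<Sum>i<n. Y j i * y i)"
  proof -
    have "(\<Sum>i<n. y i * (\<Sum>j<n. Y i j * 1)) = (\<Sum>i<n. \<Sum>j<n. Y j i * y i)"
      unfolding sum_distrib_left by (intro sum.cong refl) (simp add: Ysym mult.commute)
    also have "\<dots> = (\<Sum>j<n. \<Sum>i<n. Y j i * y i)" by (rule sum.swap)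
    finally show ?thesis .
  qed
  also have "\<dots> = real n * (p / sqrt \<rho> * s)" by (simp add: Yy)
  also have "quad_form n Y (\<lambda>i. 1) + 2 * (- (real n / s)) * (real n * (p / sqrt \<rho> * s)) + (- (real n / s))\<^sup>2 * quad_form n Y y
     = quad_form n Y (\<lambda>i. 1) - (real n)\<^sup>2 * p / sqrt \<rho>"
    unfolding qy using \<open>s \<noteq> 0\<close> by (simp add: power2_eq_square)
  also have "(real n)\<^sup>2 * p / sqrt \<rho> = real n * sqrt \<rho>"
  proof -
    have "(real n)\<^sup>2 * p = real n * \<rho>" unfolding rho by (simp add: power2_eq_square)
    then have "(real n)\<^sup>2 * p / sqrt \<rho> = real n * (\<rho> / sqrt \<rho>)" by simp
    then show ?thesis using rho_pos by (simp only: real_div_sqrt less_imp_le)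
  qed
  finally have ge: "real n * sqrt \<rho> \<le> quad_form n Y (\<lambda>i. 1)" by simp
  have "quad_form n Y (\<lambda>i. 1) = (\<Sum>i<n. c i - (\<Sum>j<n. centered_adj p E i j) / sqrt \<rho>)"
    unfolding qfY
  proof (intro sum.cong refl)
    fix i assume "i \<in> {..<n}"
    then show "1 * (\<Sum>j<n. Y i j * 1) = c i - (\<Sum>j<n. centered_adj p E i j) / sqrt \<rho>"
      using Yrow[of i "\<lambda>_. 1"] by simp
  qed
  also have "\<dots> \<le> (\<Sum>i<n. 1 / w + w * (1 + \<delta>) + \<delta> * sqrt \<rho>)"
  proof (rule sum_mono)
    fix i assume "i \<in> {..<n}"
    then have i: "i < n" by simp
    have "c i - (\<Sum>j<n. centered_adj p E i j) / sqrt \<rho> = 1 / w + w * ((d i - 1) / \<rho>) + (\<rho> - d i) / sqrt \<rho>"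
      unfolding c_def centered_adj_row_sum[OF i] d_def rho by (simp add: algebra_simps add_divide_distrib diff_divide_distrib)
    also have "\<dots> \<le> 1 / w + w * (1 + \<delta>) + \<delta> * sqrt \<rho>"
    proof (intro add_mono order_refl mult_left_mono d_bounds(2)[OF i])
      have "(\<rho> - d i) / sqrt \<rho> \<le> \<delta> * \<rho> / sqrt \<rho>"
        using deg[OF i] rho_pos unfolding d_def by (intro divide_right_mono) auto
      also have "\<delta> * \<rho> / sqrt \<rho> = \<delta> * (\<rho> / sqrt \<rho>)" by simp
      also have "\<rho> / sqrt \<rho> = sqrt \<rho>" using rho_pos by (simp add: real_div_sqrt)
      finally show "(\<rho> - d i) / sqrt \<rho> \<le> \<delta> * sqrt \<rho>" .
    qed (use w in simp)
    finally show "c i - (\<Sum>j<n. centered_adj p E i j) / sqrt \<rho> \<le> 1 / w + w * (1 + \<delta>) + \<delta> * sqrt \<rho>" .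
  qed
  also have "\<dots> = real n * (1 / w + w * (1 + \<delta>) + \<delta> * sqrt \<rho>)" by simp
  also have "\<dots> < real n * sqrt \<rho>" by (rule mult_strict_left_mono[OF h2]) (use n_pos in simp)
  finally show False using ge by simp
qed

text \<open>Pairing a kernel vector with itself gives a quadratic equation for \<open>v\<close> with real coefficients,
  so a nonreal \<open>v\<close> would have modulus close to 1.\<close>

lemma kernel_param_real:
  fixes z :: "nat \<Rightarrow> complex" and v :: complex
  assumes v: "v \<noteq> 0" and ne: "\<exists>i<n. z i \<noteq> 0"
    and ker: "\<And>i. i < n \<Longrightarrow> z i * (1 + v\<^sup>2 / of_real \<rho> * of_real (d i - 1))
       - v / of_real (sqrt \<rho>) * (\<Sum>j<n. of_real (A i j) * z j) = 0"
    and h3: "\<And>b. 1 - \<delta> - 1 / \<rho> \<le> b \<Longrightarrow> b \<le> 1 + \<delta> \<Longrightarrow> b * (cmod v)\<^sup>2 \<noteq> 1"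
  shows "Im v = 0"
proof (rule ccontr)
  assume im: "Im v \<noteq> 0"
  define N where "N = (\<Sum>i<n. (cmod (z i))\<^sup>2)"
  obtain k where k: "k < n" "z k \<noteq> 0" using ne by auto
  have "(cmod (z k))\<^sup>2 \<le> N" unfolding N_def by (rule member_le_sum) (use k in auto)
  moreover have "0 < (cmod (z k))\<^sup>2" using k by simp
  ultimately have N: "0 < N" by linarith
  define S where "S = (\<Sum>i<n. \<Sum>j<n. of_real (A i j) * (cnj (z i) * z j))"
  define B where "B = (\<Sum>i<n. (cmod (z i))\<^sup>2 * ((d i - 1) / \<rho>))"
  have "cnj S = (\<Sum>i<n. \<Sum>j<n. of_real (A i j) * (z i * cnj (z j)))" unfolding S_def by simp
  also have "\<dots> = S" unfolding S_def by (subst sum.swap) (intro sum.cong refl, simp add: A_sym mult_ac)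
  finally have S: "S \<in> \<real>" by (simp add: Reals_cnj_iff)
  then obtain \<sigma> where \<sigma>: "S = of_real \<sigma>" by (auto elim: Reals_cases)
  have "0 = (\<Sum>i<n. cnj (z i) * (z i * (1 + v\<^sup>2 / of_real \<rho> * of_real (d i - 1))
       - v / of_real (sqrt \<rho>) * (\<Sum>j<n. of_real (A i j) * z j)))"
    using ker by simp
  also have "\<dots> = (\<Sum>i<n. of_real ((cmod (z i))\<^sup>2) + v\<^sup>2 * of_real ((cmod (z i))\<^sup>2 * ((d i - 1) / \<rho>))
       - v / of_real (sqrt \<rho>) * (\<Sum>j<n. of_real (A i j) * (cnj (z i) * z j)))"
  proof (intro sum.cong refl)
    fix i
    have zz: "cnj (z i) * z i = of_real ((cmod (z i))\<^sup>2)"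
      by (metis complex_norm_square mult.commute of_real_power)
    have "cnj (z i) * (z i * (1 + v\<^sup>2 / of_real \<rho> * of_real (d i - 1))
       - v / of_real (sqrt \<rho>) * (\<Sum>j<n. of_real (A i j) * z j))
      = (cnj (z i) * z i) * (1 + v\<^sup>2 / of_real \<rho> * of_real (d i - 1))
       - v / of_real (sqrt \<rho>) * (cnj (z i) * (\<Sum>j<n. of_real (A i j) * z j))"
      by (simp only: right_diff_distrib mult_ac)
    also have "cnj (z i) * (\<Sum>j<n. of_real (A i j) * z j) = (\<Sum>j<n. of_real (A i j) * (cnj (z i) * z j))"
      by (simp add: sum_distrib_left mult_ac)
    finally show "cnj (z i) * (z i * (1 + v\<^sup>2 / of_real \<rho> * of_real (d i - 1))
       - v / of_real (sqrt \<rho>) * (\<Sum>j<n. of_real (A i j) * z j))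
      = of_real ((cmod (z i))\<^sup>2) + v\<^sup>2 * of_real ((cmod (z i))\<^sup>2 * ((d i - 1) / \<rho>))
       - v / of_real (sqrt \<rho>) * (\<Sum>j<n. of_real (A i j) * (cnj (z i) * z j))"
      unfolding zz by (simp add: distrib_left)
  qed
  also have "\<dots> = of_real N + v\<^sup>2 * of_real B - v / of_real (sqrt \<rho>) * S"
    unfolding N_def B_def S_def by (simp add: sum.distrib sum_subtractf sum_distrib_left)
  finally have eq: "of_real N + v\<^sup>2 * of_real B - v * of_real (\<sigma> / sqrt \<rho>) = 0" unfolding \<sigma> by simp
  define t where "t = \<sigma> / sqrt \<rho>"
  have "Im (of_real N + v\<^sup>2 * of_real B - v * of_real t) = 0" using eq unfolding t_def by simp
  then have "Im v * (2 * Re v * B - t) = 0" by (simp add: power2_eq_square algebra_simps)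
  then have t: "t = 2 * Re v * B" using im by simp
  have "Re (of_real N + v\<^sup>2 * of_real B - v * of_real t) = 0" using eq unfolding t_def by simp
  then have "N = B * ((Re v)\<^sup>2 + (Im v)\<^sup>2)" unfolding t by (simp add: power2_eq_square algebra_simps)
  then have eq2: "N = B * (cmod v)\<^sup>2" by (simp add: cmod_power2)
  have "(\<Sum>i<n. (cmod (z i))\<^sup>2 * (1 - \<delta> - 1 / \<rho>)) \<le> B" "B \<le> (\<Sum>i<n. (cmod (z i))\<^sup>2 * (1 + \<delta>))"
    unfolding B_def by (intro sum_mono mult_left_mono d_bounds; simp)+
  then have "(1 - \<delta> - 1 / \<rho>) * N \<le> B" "B \<le> (1 + \<delta>) * N"
    unfolding N_def by (simp_all add: sum_distrib_left mult.commute)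
  \<comment> \<open>The quotient \<open>B / N\<close> is a weighted average of the numbers
    \<open>(d i - 1) / \<rho>\<close>, hence lies in the range excluded by
    \<open>h3\<close>.\<close>
  then have "B / N * (cmod v)\<^sup>2 \<noteq> 1" using N by (intro h3) (auto simp: field_simps)
  moreover have "B / N * (cmod v)\<^sup>2 = N / N" by (subst (2) eq2) simp
  ultimately show False using N by simp
qed

lemma no_kernel:
  fixes z :: "nat \<Rightarrow> complex" and v :: complex
  assumes v: "v \<noteq> 0"
    and h1: "a + 1 / sqrt \<rho> < 1 / cmod v + cmod v * (1 - \<delta> - 1 / \<rho>)"
    and h2: "1 / cmod v + cmod v * (1 + \<delta>) + \<delta> * sqrt \<rho> < sqrt \<rho>"
    and h3: "\<And>b. 1 - \<delta> - 1 / \<rho> \<le> b \<Longrightarrow> b \<le> 1 + \<delta> \<Longrightarrow> b * (cmod v)\<^sup>2 \<noteq> 1"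
    and ne: "\<exists>i<n. z i \<noteq> 0"
    and ker: "\<And>i. i < n \<Longrightarrow> z i * (1 + v\<^sup>2 / of_real \<rho> * of_real (d i - 1))
       - v / of_real (sqrt \<rho>) * (\<Sum>j<n. of_real (A i j) * z j) = 0"
  shows False
proof -
  have im: "Im v = 0" by (rule kernel_param_real[OF v ne ker h3])
  define u where "u = Re v"
  have vu: "v = of_real u" unfolding u_def using im by (simp add: complex_eq_iff)
  have u0: "u \<noteq> 0" using v vu by auto
  have cv: "cmod v = \<bar>u\<bar>" unfolding vu by simp
  have eq: "z i * of_real (1 + u\<^sup>2 / \<rho> * (d i - 1)) - of_real (u / sqrt \<rho>) * (\<Sum>j<n. of_real (A i j) * z j) = 0"
    if "i < n" for i using ker[OF that] unfolding vu by simp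
  have re: "Re (z i) * (1 + u\<^sup>2 / \<rho> * (d i - 1)) - u / sqrt \<rho> * (\<Sum>j<n. A i j * Re (z j)) = 0" if "i < n" for i
    using arg_cong[OF eq[OF that], of Re] by (simp only: minus_complex.simps times_complex.simps Re_complex_of_real Im_complex_of_real Re_sum Im_sum zero_complex.simps mult_zero_right mult_zero_left diff_zero)
  have imz: "Im (z i) * (1 + u\<^sup>2 / \<rho> * (d i - 1)) - u / sqrt \<rho> * (\<Sum>j<n. A i j * Im (z j)) = 0" if "i < n" for i
    using arg_cong[OF eq[OF that], of Im] by (simp only: minus_complex.simps times_complex.simps Re_complex_of_real Im_complex_of_real Re_sum Im_sum zero_complex.simps mult_zero_right mult_zero_left diff_zero add_0_left add_0_right)
  \<comment> \<open>For real \<open>v\<close> the system has real coefficients, so real and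
    imaginary part of \<open>z\<close> solve it separately and one of them is nonzero.\<close>
  have "\<exists>y :: nat \<Rightarrow> real. (\<exists>i<n. y i \<noteq> 0) \<and>
    (\<forall>i<n. y i * (1 + u\<^sup>2 / \<rho> * (d i - 1)) - u / sqrt \<rho> * (\<Sum>j<n. A i j * y j) = 0)"
  proof (cases "\<exists>i<n. Re (z i) \<noteq> 0")
    case True
    then show ?thesis using re by (intro exI[of _ "\<lambda>i. Re (z i)"]) blast
  next
    case False
    then have "\<exists>i<n. Im (z i) \<noteq> 0" using ne by (auto simp: complex_eq_iff)
    then show ?thesis using imz by (intro exI[of _ "\<lambda>i. Im (z i)"]) blast
  qed
  then obtain y :: "nat \<Rightarrow> real" where y: "\<exists>i<n. y i \<noteq> 0"
    "\<And>i. i < n \<Longrightarrow> y i * (1 + u\<^sup>2 / \<rho> * (d i - 1)) - u / sqrt \<rho> * (\<Sum>j<n. A i j * y j) = 0" by blast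
  show False
  proof (cases "0 < u")
    case True
    show False by (rule real_kernel_pos[OF True _ _ y]) (use h1 h2 True cv in auto)
  next
    case False
    then have w: "0 < - u" using u0 by simp
    show False
    proof (rule real_kernel_neg[OF w _ y(1)])
      show "a + 1 / sqrt \<rho> < 1 / - u + - u * (1 - \<delta> - 1 / \<rho>)" using h1 w cv by simp
      show "y i * (1 + (- u)\<^sup>2 / \<rho> * (d i - 1)) + - u / sqrt \<rho> * (\<Sum>j<n. A i j * y j) = 0" if "i < n" for i
        using y(2)[OF that] by simp
    qed
  qed
qed

lemma mult_mat_vec_index_sum:
  assumes "M \<in> carrier_mat n n" "x \<in> carrier_vec n" "i < n"
  shows "(M *\<^sub>v x) $ i = (\<Sum>j<n. M $$ (i, j) * x $ j)"
  using assms by (auto simp: scalar_prod_def atLeast0LessThan intro!: sum.cong)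

lemma zeta_inv_nonzero:
  assumes E: "E \<subseteq> pairs n" and v: "v \<noteq> 0"
    and h1: "a + 1 / sqrt \<rho> < 1 / cmod v + cmod v * (1 - \<delta> - 1 / \<rho>)"
    and h2: "1 / cmod v + cmod v * (1 + \<delta>) + \<delta> * sqrt \<rho> < sqrt \<rho>"
    and h3: "\<And>b. 1 - \<delta> - 1 / \<rho> \<le> b \<Longrightarrow> b \<le> 1 + \<delta> \<Longrightarrow> b * (cmod v)\<^sup>2 \<noteq> 1"
    and h4: "(cmod v)\<^sup>2 \<noteq> \<rho>"
  shows "zeta_inv n \<rho> E v \<noteq> 0"
proof
  assume zero: "zeta_inv n \<rho> E v = 0"
  let ?u = "v / complex_of_real (sqrt \<rho>)"
  let ?M = "1\<^sub>m n + (?u\<^sup>2) \<cdot>\<^sub>m (deg_mat n E - 1\<^sub>m n) - ?u \<cdot>\<^sub>m adj_mat n E"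
  have "v\<^sup>2 \<noteq> of_real \<rho>"
  proof
    assume "v\<^sup>2 = of_real \<rho>"
    then have "cmod (v\<^sup>2) = \<rho>" using rho_pos by simp
    then show False using h4 by (simp add: norm_power)
  qed
  \<comment> \<open>The integer power in \<open>zeta_inv\<close> then has a nonzero base and cannot
    vanish for either sign of its exponent, which leaves the determinant.\<close>
  then have "1 - v\<^sup>2 / complex_of_real \<rho> \<noteq> 0" using rho_pos by (simp add: field_simps)
  then have det: "det ?M = 0" using zero unfolding zeta_inv_def Let_def by auto
  have carr: "deg_mat n E \<in> carrier_mat n n" "adj_mat n E \<in> carrier_mat n n"
    unfolding deg_mat_def adj_mat_def by auto
  have M: "?M \<in> carrier_mat n n" using carr by auto
  obtain x where x: "x \<in> carrier_vec n" "x \<noteq> 0\<^sub>v n" "?M *\<^sub>v x = 0\<^sub>v n"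
    using det_0_iff_vec_prod_zero[OF M] det by auto
  have adj: "adj_mat n E $$ (i, j) = of_real (A i j)" if "i < n" "j < n" for i j
  proof -
    have "((i, j) \<in> E \<or> (j, i) \<in> E) \<longleftrightarrow> i \<noteq> j \<and> edge_of i j \<in> E"
      using E unfolding pairs_def edge_of_def by (auto simp: min_def max_def)
    then show ?thesis unfolding adj_mat_def A_def using that by simp
  qed
  have degm: "deg_mat n E $$ (i, j) = (if i = j then of_real (d i) else 0)" if "i < n" "j < n" for i j
  proof -
    have "(\<Sum>k<n. adj_mat n E $$ (i, k)) = of_real (\<Sum>k<n. A i k)" using adj that by simp
    also have "(\<Sum>k<n. A i k) = d i"
      unfolding A_def d_def degree_in_def by (simp add: sum.If_cases Int_def conj_commute neq_commute eq_commute)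
    finally show ?thesis unfolding deg_mat_def using that by auto
  qed
  show False
  proof (rule no_kernel[OF v h1 h2 h3])
    show "\<exists>i<n. x $ i \<noteq> 0" using x(1,2) by (metis carrier_vecD dim_vec eq_vecI index_zero_vec)
    fix i assume i: "i < n"
    have "0 = (?M *\<^sub>v x) $ i" using x(3) i by simp
    also have "\<dots> = (\<Sum>j<n. ?M $$ (i, j) * x $ j)"
      by (rule mult_mat_vec_index_sum[OF M x(1) i])
    also have "\<dots> = (\<Sum>j<n. (if j = i then x $ i * (1 + ?u\<^sup>2 * of_real (d i - 1)) else 0) - ?u * (of_real (A i j) * x $ j))"
      by (intro sum.cong refl) (use i carr in \<open>auto simp: adj degm algebra_simps\<close>)
    also have "\<dots> = x $ i * (1 + ?u\<^sup>2 * of_real (d i - 1)) - ?u * (\<Sum>j<n. of_real (A i j) * x $ j)"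
      using i by (simp add: sum_subtractf sum_distrib_left)
    also have "?u\<^sup>2 = v\<^sup>2 / of_real \<rho>" using rho_pos by (simp add: power_divide flip: of_real_power)
    finally show "x $ i * (1 + v\<^sup>2 / of_real \<rho> * of_real (d i - 1)) - ?u * (\<Sum>j<n. of_real (A i j) * x $ j) = 0" by simp
  qed
qed

end

section \<open>Failure probabilities\<close>

text \<open>The map \<open>1 / w + w\<close> has its minimum 2 at \<open>w = 1\<close>. After
  multiplication by \<open>w\<close> the claim compares \<open>(w - 1)\<^sup>2\<close>, which
  exceeds \<open>4 * q\<^sup>2\<close>, with error terms led by \<open>q\<^sup>2 * w\<close>. Here
  \<open>s\<close> stands for the degree deviation plus \<open>1 / \<rho>\<close>.\<close>

lemma joukowski_gap:
  fixes q w s :: real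
  assumes q: "0 < q" "q \<le> 1 / 32" and w: "0 < w" "2 * q < \<bar>w - 1\<bar>" and s: "s \<le> q ^ 3 + q ^ 8"
  shows "2 + q\<^sup>2 + q ^ 3 + q ^ 4 < 1 / w + w * (1 - s)"
proof -
  define t where "t = \<bar>w - 1\<bar>"
  have t: "2 * q < t" "w \<le> 1 + t" "0 < t" using w q unfolding t_def by auto
  have t2: "t\<^sup>2 = (w - 1)\<^sup>2" unfolding t_def by simp
  have q3: "q ^ 3 \<le> q\<^sup>2 / 32" "q ^ 4 \<le> q\<^sup>2 / 32"
  proof -
    have "q\<^sup>2 * q \<le> q\<^sup>2 * (1 / 32)" by (rule mult_left_mono[OF q(2)]) simp
    then show 1: "q ^ 3 \<le> q\<^sup>2 / 32" by (simp add: power3_eq_cube power2_eq_square)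
    have "q ^ 4 = q ^ 3 * q" by (simp add: power_numeral_reduce)
    also have "\<dots> \<le> q ^ 3 * 1" by (intro mult_left_mono) (use q in auto)
    finally show "q ^ 4 \<le> q\<^sup>2 / 32" using 1 by simp
  qed
  have q8: "q ^ 8 \<le> q ^ 3" by (intro power_decreasing) (use q in auto)
  have qt: "q\<^sup>2 \<le> t\<^sup>2 / 4"
  proof -
    have "(2 * q)\<^sup>2 \<le> t\<^sup>2" by (rule power_mono) (use t q in auto)
    then show ?thesis by (simp add: power_mult_distrib)
  qed
  have qt1: "q\<^sup>2 * t \<le> t\<^sup>2 / 32"
  proof -
    have "q\<^sup>2 * t = q * (q * t)" by (simp add: power2_eq_square)
    also have "\<dots> \<le> 1 / 32 * (t * t)" by (intro mult_mono) (use q t in auto)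
    finally show ?thesis by (simp add: power2_eq_square)
  qed
  \<comment> \<open>The constant \<open>17 / 16\<close> is \<open>1 + 1 / 32 + 1 / 32\<close>, from
    \<open>q3\<close>.\<close>
  have "(q\<^sup>2 + q ^ 3 + q ^ 4) * w \<le> (17 / 16 * q\<^sup>2) * (1 + t)"
    by (intro mult_mono) (use q3 t w q in auto)
  also have "\<dots> = 17 / 16 * q\<^sup>2 + 17 / 16 * (q\<^sup>2 * t)" by (simp add: algebra_simps)
  also have "\<dots> \<le> 17 / 16 * (t\<^sup>2 / 4) + 17 / 16 * (t\<^sup>2 / 32)" using qt qt1 by linarith
  finally have 1: "(q\<^sup>2 + q ^ 3 + q ^ 4) * w \<le> 17 / 16 * (t\<^sup>2 / 4) + 17 / 16 * (t\<^sup>2 / 32)" .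
  have "s * w\<^sup>2 \<le> (2 * q ^ 3) * w\<^sup>2" by (rule mult_right_mono) (use s q8 in auto)
  also have "\<dots> \<le> (2 * q ^ 3) * (2 + 2 * t\<^sup>2)"
  proof (rule mult_left_mono)
    have "w\<^sup>2 \<le> (1 + t)\<^sup>2" by (rule power_mono) (use t w in auto)
    also have "\<dots> \<le> 2 + 2 * t\<^sup>2" using sum_squares_bound[of 1 t] by (simp add: power2_eq_square algebra_simps)
    finally show "w\<^sup>2 \<le> 2 + 2 * t\<^sup>2" .
  qed (use q in simp)
  also have "\<dots> = 4 * q ^ 3 + 4 * q ^ 3 * t\<^sup>2" by (simp add: algebra_simps)
  also have "\<dots> \<le> 4 * (t\<^sup>2 / 128) + 4 * (1 / 32) * t\<^sup>2"
  proof (intro add_mono mult_right_mono mult_left_mono)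
    show "q ^ 3 \<le> t\<^sup>2 / 128" using q3 qt by simp
    have "q ^ 3 \<le> q ^ 1" by (intro power_decreasing) (use q in auto)
    then show "q ^ 3 \<le> 1 / 32" using q by simp
  qed auto
  finally have 2: "s * w\<^sup>2 \<le> 4 * (t\<^sup>2 / 128) + 4 * (1 / 32) * t\<^sup>2" .
  have "0 < t\<^sup>2" using t by simp
  then have "(q\<^sup>2 + q ^ 3 + q ^ 4) * w + s * w\<^sup>2 < (w - 1)\<^sup>2" using 1 2 unfolding t2[symmetric] by linarith
  then have "(2 + q\<^sup>2 + q ^ 3 + q ^ 4) * w < (1 / w + w * (1 - s)) * w"
    using w(1) by (simp add: algebra_simps power2_eq_square)
  then show ?thesis using w(1) by (simp add: mult_less_cancel_right)
qed

text \<open>With \<open>r = sqrt \<rho>\<close> this is the expansion of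
  \<open>1 + q + 1 / (1 + q)\<close>, which is 2 plus \<open>q\<^sup>2\<close> up to order
  \<open>q ^ 3\<close>. The 1 subtracted in the denominator is at most
  \<open>r * q ^ 4\<close>.\<close>

lemma edge_bound:
  fixes q r :: real
  assumes q: "0 < q" "q \<le> 1 / 32" and r: "1 / r \<le> q ^ 4" "0 < r"
  shows "r * (1 + q) + r\<^sup>2 * (1 + q ^ 3) / (r * (1 + q) - 1) \<le> (2 + q\<^sup>2 + q ^ 3) * r"
proof -
  have q4: "q ^ 4 \<le> q" using power_decreasing[of 1 4 q] q by simp
  have den: "0 < 1 + q - q ^ 4" using q4 by simp
  have rq: "r * (1 + q - q ^ 4) \<le> r * (1 + q) - 1"
  proof -
    have "1 \<le> r * q ^ 4" using r by (simp add: field_simps)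
    then show ?thesis by (simp add: algebra_simps)
  qed
  have den': "0 < r * (1 + q - q ^ 4)" using den r by simp
  have "r\<^sup>2 * (1 + q ^ 3) / (r * (1 + q) - 1) \<le> r\<^sup>2 * (1 + q ^ 3) / (r * (1 + q - q ^ 4))"
    by (rule divide_left_mono[OF rq]) (use q den' rq in \<open>auto intro!: mult_pos_pos\<close>)
  also have "\<dots> = r * ((1 + q ^ 3) / (1 + q - q ^ 4))" using r by (simp add: power2_eq_square)
  also have "\<dots> \<le> r * (1 - q + q\<^sup>2 + q ^ 3)"
  proof (rule mult_left_mono)
    have "(1 - q + q\<^sup>2 + q ^ 3) * (1 + q - q ^ 4) = 1 + q ^ 3 + q ^ 3 * (1 + q\<^sup>2 - q ^ 3 - q ^ 4)"
      by (simp add: algebra_simps power_numeral_reduce)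
    moreover have "0 \<le> q ^ 3 * (1 + q\<^sup>2 - q ^ 3 - q ^ 4)"
    proof (rule mult_nonneg_nonneg)
      have "q ^ 3 \<le> q\<^sup>2" by (intro power_decreasing) (use q in auto)
      moreover have "q ^ 4 \<le> 1" using q4 q by simp
      ultimately show "0 \<le> 1 + q\<^sup>2 - q ^ 3 - q ^ 4" by simp
    qed (use q in simp)
    ultimately show "(1 + q ^ 3) / (1 + q - q ^ 4) \<le> 1 - q + q\<^sup>2 + q ^ 3"
      using den by (simp add: pos_divide_le_eq)
  qed (use r in simp)
  finally show ?thesis by (simp add: algebra_simps)
qed

text \<open>Here \<open>q\<close> stands for \<open>\<chi> powr (- 1 / 8)\<close>, so that \<open>\<epsilon> = 2 * q\<close>.\<close>

lemma no_zero:
  fixes n :: nat and p \<rho> q \<kappa> :: real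
  assumes n: "0 < n" and p: "0 < p" "p \<le> 1" and rho: "\<rho> = real n * p"
    and q: "0 < q" "q \<le> 1 / 32" and qrho: "1 / sqrt \<rho> \<le> q ^ 4" and kappa: "0 < \<kappa>" "\<kappa> < 1"
    and qk: "2 * q ^ 4 + 2 * q ^ 3 \<le> \<kappa>"
    and E: "E \<subseteq> pairs n"
    and deg: "\<And>i. i < n \<Longrightarrow> \<bar>real (degree_in n E i) - \<rho>\<bar> \<le> q ^ 3 * \<rho>"
    and nb_frobenius: "nb_frobenius n (centered_adj p E) l < (sqrt \<rho> * (1 + q)) ^ (2 * l)"
    and v: "v \<in> D1 (2 * q) (1 / (sqrt \<rho> * (1 - \<kappa>))) \<union> D2 (2 * q) (1 / (sqrt \<rho> * (1 - \<kappa>)))"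
  shows "zeta_inv n \<rho> E v \<noteq> 0"
proof -
  define r where "r = sqrt \<rho>"
  define w where "w = cmod v"
  have rho0: "0 < \<rho>" using rho n p by simp
  have r0: "0 < r" unfolding r_def using rho0 by simp
  have rr: "\<rho> = r\<^sup>2" unfolding r_def using rho0 by simp
  have qr: "1 / r \<le> q ^ 4" using qrho r_def by simp
  have q4: "q ^ 4 \<le> 1 / 32" "q ^ 3 \<le> 1 / 32"
    using power_decreasing[of 1 4 q] power_decreasing[of 1 3 q] q by auto
  have r1: "32 \<le> r"
  proof -
    have "1 \<le> r * q ^ 4" using qr r0 by (simp add: field_simps)
    also have "\<dots> \<le> r * (1 / 32)" by (intro mult_left_mono) (use q4 r0 in auto)
    finally show ?thesis by simp
  qed
  have irho: "1 / \<rho> \<le> q ^ 8"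
  proof -
    have "(1 / r)\<^sup>2 \<le> (q ^ 4)\<^sup>2" by (rule power_mono) (use qr r0 in auto)
    then show ?thesis unfolding rr by (simp add: power_divide flip: power_mult)
  qed
  have q8: "q ^ 8 \<le> q ^ 3" by (intro power_decreasing) (use q in auto)
  have lam: "1 < r * (1 + q)"
  proof -
    have "r * 1 \<le> r * (1 + q)" by (intro mult_left_mono) (use q r0 in auto)
    then show ?thesis using r1 by linarith
  qed
  define a where "a = 2 + q\<^sup>2 + q ^ 3"
  interpret near_regular_graph n p \<rho> "q ^ 3" a E
  proof
    fix x
    have "\<bar>quad_form n (centered_adj p E) x\<bar> \<le> (r * (1 + q) + \<rho> * (1 + q ^ 3) / (r * (1 + q) - 1)) * (\<Sum>i<n. (x i)\<^sup>2)"
    proof (rule abs_quad_form_le_of_nb_frobenius[OF centered_adj_sym centered_adj_abs lam])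
      show "nb_frobenius n (centered_adj p E) l < (r * (1 + q)) ^ (2 * l)" using nb_frobenius unfolding r_def .
      show "(\<Sum>j<n. (centered_adj p E i j)\<^sup>2) \<le> \<rho> * (1 + q ^ 3)" if "i < n" for i
        by (rule centered_adj_row_sq_le[OF that _ p(2) rho deg[OF that]]) (use p in simp)
    qed (use p q rho0 in auto)
    also have "\<dots> \<le> (a * r) * (\<Sum>i<n. (x i)\<^sup>2)"
      unfolding a_def rr by (intro mult_right_mono edge_bound q qr r0) (auto intro: sum_nonneg)
    finally show "\<bar>quad_form n (centered_adj p E) x\<bar> \<le> a * sqrt \<rho> * (\<Sum>i<n. (x i)\<^sup>2)" unfolding r_def .
  qed (use n p rho deg in auto)
  have k0: "0 < r * (1 - \<kappa>)" using r0 kappa by simp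
  have cases: "(1 / (r * (1 - \<kappa>)) < w \<and> w < 1 - 2 * q) \<or> (1 + 2 * q < w \<and> w < r * (1 - \<kappa>))"
    using v unfolding D1_def D2_def w_def r_def by auto
  then have w: "0 < w" "2 * q < \<bar>w - 1\<bar>"
  proof -
    have "0 < 1 / (r * (1 - \<kappa>))" using k0 by simp
    then show "0 < w" using cases q by linarith
    show "2 * q < \<bar>w - 1\<bar>" using cases q by linarith
  qed
  show ?thesis
  proof (rule zeta_inv_nonzero[OF E])
    show "v \<noteq> 0" using w(1) unfolding w_def by auto
    show "a + 1 / sqrt \<rho> < 1 / cmod v + cmod v * (1 - q ^ 3 - 1 / \<rho>)"
    proof -
      have "a + 1 / sqrt \<rho> \<le> 2 + q\<^sup>2 + q ^ 3 + q ^ 4" unfolding a_def using qrho by simp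
      also have "\<dots> < 1 / w + w * (1 - (q ^ 3 + 1 / \<rho>))"
        by (rule joukowski_gap[OF q w]) (use irho in simp)
      finally show ?thesis unfolding w_def by (simp add: diff_diff_add)
    qed
    show "1 / cmod v + cmod v * (1 + q ^ 3) + q ^ 3 * sqrt \<rho> < sqrt \<rho>"
      unfolding w_def[symmetric] r_def[symmetric]
    proof -
      \<comment> \<open>On the first domain \<open>1 / w\<close>, on the second \<open>w\<close>, is
        below \<open>r * (1 - \<kappa>)\<close>. The spare \<open>r * \<kappa>\<close> pays for the
        remaining terms, where constants are bounded through
        \<open>1 \<le> r * q ^ 4\<close>.\<close>
      have rk: "r * (2 * q ^ 4 + 2 * q ^ 3) \<le> r * \<kappa>" by (rule mult_left_mono[OF qk]) (use r0 in simp)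
      have rq: "1 \<le> r * q ^ 4" using qr r0 by (simp add: field_simps)
      have rq3: "0 < r * q ^ 3" using r0 q by simp
      from cases show "1 / w + w * (1 + q ^ 3) + q ^ 3 * r < r"
      proof
        assume c: "1 / (r * (1 - \<kappa>)) < w \<and> w < 1 - 2 * q"
        then have "1 / w < r * (1 - \<kappa>)" using k0 w(1) by (simp add: field_simps)
        moreover have "w * (1 + q ^ 3) \<le> 1 * 2" by (intro mult_mono) (use c q q4 w in auto)
        ultimately show ?thesis using rk rq rq3 by (simp add: algebra_simps)
      next
        assume c: "1 + 2 * q < w \<and> w < r * (1 - \<kappa>)"
        then have "1 < w" using q by simp
        then have "1 / w < 1" by simp
        moreover have "w * (1 + q ^ 3) \<le> r * (1 - \<kappa>) + r * q ^ 3"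
        proof -
          have "w * q ^ 3 \<le> r * q ^ 3"
          proof (rule mult_right_mono)
            have "r * (1 - \<kappa>) \<le> r * 1" by (intro mult_left_mono) (use kappa r0 in auto)
            then show "w \<le> r" using c by simp
          qed (use q in simp)
          then show ?thesis using c by (simp add: algebra_simps)
        qed
        ultimately show ?thesis using rk rq rq3 by (simp add: algebra_simps)
      qed
    qed
    show "b * (cmod v)\<^sup>2 \<noteq> 1" if b: "1 - q ^ 3 - 1 / \<rho> \<le> b" "b \<le> 1 + q ^ 3" for b
      unfolding w_def[symmetric]
    proof -
      have qq: "q ^ 3 \<le> q / 32"
      proof -
        have "q ^ 3 \<le> q\<^sup>2" by (intro power_decreasing) (use q in auto)
        also have "q\<^sup>2 = q * q" by (simp add: power2_eq_square)
        also have "\<dots> \<le> q * (1 / 32)" by (intro mult_left_mono) (use q in auto)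
        finally show ?thesis by simp
      qed
      have b0: "0 \<le> b" "1 - q / 16 \<le> b" "b \<le> 1 + q / 32" using b irho q8 q4 qq q by linarith+
      from cases show "b * w\<^sup>2 \<noteq> 1"
      proof
        assume c: "1 / (r * (1 - \<kappa>)) < w \<and> w < 1 - 2 * q"
        have "w\<^sup>2 \<le> w * (1 - 2 * q)" unfolding power2_eq_square by (intro mult_left_mono) (use c w in auto)
        also have "\<dots> \<le> 1 * (1 - 2 * q)" by (intro mult_right_mono) (use c q in auto)
        finally have "b * w\<^sup>2 \<le> (1 + q / 32) * (1 - 2 * q)" by (intro mult_mono) (use b0 q in auto)
        also have "\<dots> < 1" using q by (simp add: algebra_simps) (use q in \<open>smt (verit) mult_pos_pos\<close>)
        finally show ?thesis by simp
      next
        assume c: "1 + 2 * q < w \<and> w < r * (1 - \<kappa>)"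
        have "1 < (1 - q / 16) * (1 + 2 * q)"
        proof -
          have "q * q \<le> q * (1 / 32)" by (intro mult_left_mono) (use q in auto)
          then show ?thesis using q by (simp add: algebra_simps)
        qed
        also have "\<dots> \<le> b * w\<^sup>2"
        proof (rule mult_mono)
          have "1 * w \<le> w * w" by (intro mult_right_mono) (use c q in auto)
          then show "1 + 2 * q \<le> w\<^sup>2" using c by (simp add: power2_eq_square)
        qed (use b0 q in auto)
        finally show ?thesis by simp
      qed
    qed
    show "(cmod v)\<^sup>2 \<noteq> \<rho>"
    proof -
      have "w < r"
      proof -
        have "r * (1 - \<kappa>) \<le> r * 1" by (intro mult_left_mono) (use kappa r0 in auto)
        then show ?thesis using cases r1 q by linarith
      qed
      then have "w\<^sup>2 < r\<^sup>2" by (intro power_strict_mono) (use w in auto)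
      then show ?thesis unfolding rr w_def by simp
    qed
  qed
qed

section \<open>Choice of the walk length and summation of the failure probabilities\<close>

lemma ln_le_4_powr: "0 < m \<Longrightarrow> ln m \<le> 4 * m powr (1 / 4)" for m :: real
proof -
  assume m: "0 < m"
  have "ln (m powr (1 / 4)) \<le> m powr (1 / 4)" using ln_bound[of "m powr (1/4)"] m by simp
  then show ?thesis using m by (simp add: ln_powr)
qed

text \<open>The first factor is at most \<open>n powr (- b / 8)\<close>. The second is at most 1
  unless \<open>2 * b + 1\<close> exceeds \<open>sqrt \<rho>\<close>; in that case \<open>b\<close>
  is so large that the first factor outweighs even \<open>(2 * b + 1) ^ L\<close>.\<close>

lemma excess_weight_small:
  fixes n L b \<tau> :: nat and q \<rho> :: real
  assumes n: "3 \<le> n" and q: "0 < q" "q \<le> 1 / 32" and qrho: "1 / sqrt \<rho> \<le> q ^ 4" and rho: "0 < \<rho>"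
    and L: "real L \<le> 13 * ln (real n) / q"
    and L6: "20736 * real L ^ 6 \<le> real n powr (7 / 8)"
    and tau: "\<tau> \<le> L"
  shows "(20736 * real L ^ 6 / real n) ^ b * ((2 * real b + 1) / sqrt \<rho>) ^ \<tau> \<le> 1"
proof -
  have n0: "0 < real n" using n by simp
  have lnn: "0 \<le> ln (real n)" using n by simp
  have "20736 * real L ^ 6 / real n \<le> real n powr (7 / 8) / real n" by (rule divide_right_mono[OF L6]) simp
  also have "\<dots> = real n powr (- (1 / 8))" using powr_diff[of "real n" "7 / 8" 1] n0 by simp
  finally have "(20736 * real L ^ 6 / real n) ^ b \<le> (real n powr (- (1 / 8))) ^ b" by (intro power_mono) auto
  also have "\<dots> = exp (- (real b / 8) * ln (real n))"
    using n0 by (simp add: powr_def mult_ac flip: exp_of_nat_mult)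
  finally have 1: "(20736 * real L ^ 6 / real n) ^ b \<le> exp (- (real b / 8) * ln (real n))" .
  have s0: "0 < sqrt \<rho>" using rho by simp
  have q4: "q ^ 4 \<le> 1" using q by (simp add: power_le_one)
  have s1: "1 \<le> sqrt \<rho> * q ^ 4" using qrho s0 by (simp add: field_simps)
  have s2: "1 \<le> sqrt \<rho>"
  proof -
    have "sqrt \<rho> * q ^ 4 \<le> sqrt \<rho> * 1" by (intro mult_left_mono q4) (use s0 in simp)
    then show ?thesis using s1 by linarith
  qed
  have 2: "((2 * real b + 1) / sqrt \<rho>) ^ \<tau> \<le> exp ((real b / 8) * ln (real n))"
  proof (cases "2 * real b + 1 \<le> sqrt \<rho>")
    case True
    then have "((2 * real b + 1) / sqrt \<rho>) ^ \<tau> \<le> 1" using s0 by (intro power_le_one) auto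
    also have "1 \<le> exp ((real b / 8) * ln (real n))" using lnn by simp
    finally show ?thesis .
  next
    case False
    define m where "m = 2 * real b + 1"
    have m: "sqrt \<rho> < m" "1 \<le> m" using False m_def by auto
    have mq: "1 \<le> m * q ^ 4"
    proof -
      have "sqrt \<rho> * q ^ 4 \<le> m * q ^ 4" by (intro mult_right_mono) (use m q in auto)
      then show ?thesis using s1 by simp
    qed
    \<comment> \<open>The fourth root matches \<open>1 / sqrt \<rho> \<le> q ^ 4\<close>: from
      \<open>m > sqrt \<rho>\<close> follows \<open>1 / q \<le> t\<close>, so
      \<open>L * ln m\<close> is at most \<open>52 * t\<^sup>2 * ln n\<close>, which is small
      against \<open>m * ln n = t ^ 4 * ln n\<close>.\<close>
    define t where "t = m powr (1 / 4)"
    have t0: "0 < t" unfolding t_def using m by simp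
    have t4: "t ^ 4 = m" unfolding t_def using m by (simp add: powr_power)
    have tq: "1 \<le> t * q"
    proof (rule ccontr)
      assume "\<not> 1 \<le> t * q"
      then have "(t * q) ^ 4 < 1" using t0 q by (intro power_Suc_less_one[of _ 3, simplified]) auto
      then show False using mq unfolding power_mult_distrib t4 by simp
    qed
    have t32: "32 \<le> t"
    proof -
      have "t * q \<le> t * (1 / 32)" by (intro mult_left_mono) (use q t0 in auto)
      then show ?thesis using tq by simp
    qed
    have "((2 * real b + 1) / sqrt \<rho>) ^ \<tau> \<le> m ^ \<tau>"
      unfolding m_def[symmetric]
    proof (rule power_mono)
      have "m / sqrt \<rho> \<le> m / 1" by (rule divide_left_mono[OF s2]) (use m s0 in auto)
      then show "m / sqrt \<rho> \<le> m" by simp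
      show "0 \<le> m / sqrt \<rho>" using m s0 by (intro divide_nonneg_pos) auto
    qed
    also have "\<dots> \<le> m ^ L" by (rule power_increasing[OF tau]) (use m in simp)
    also have "\<dots> = exp (real L * ln m)" using m by (simp add: exp_of_nat_mult)
    also have "\<dots> \<le> exp ((real b / 8) * ln (real n))"
    proof -
      have lnm: "ln m \<le> 4 * t" unfolding t_def using m by (intro ln_le_4_powr) auto
      have iq: "1 / q \<le> t" using tq q by (simp add: field_simps)
      have "real L * ln m \<le> (13 * ln (real n) / q) * (4 * t)"
        by (intro mult_mono L lnm) (use m lnn q in auto)
      also have "\<dots> = (1 / q) * (52 * t * ln (real n))" by simp
      also have "\<dots> \<le> t * (52 * t * ln (real n))" by (intro mult_right_mono iq) (use t0 lnn in auto)
      also have "\<dots> = (52 * t\<^sup>2) * ln (real n)" by (simp add: power2_eq_square)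
      also have "\<dots> \<le> (real b / 8) * ln (real n)"
      proof (rule mult_right_mono[OF _ lnn])
        have t2: "1024 \<le> t\<^sup>2" using power_mono[OF t32, of 2] by simp
        have "m = t\<^sup>2 * t\<^sup>2" unfolding t4[symmetric] by (simp flip: power_add)
        also have "\<dots> \<ge> 1024 * t\<^sup>2" by (intro mult_right_mono t2) simp
        finally have "1024 * t\<^sup>2 \<le> 2 * real b + 1" unfolding m_def .
        then show "52 * t\<^sup>2 \<le> real b / 8" using t2 by simp
      qed
      finally show ?thesis by simp
    qed
    finally show ?thesis .
  qed
  have "(20736 * real L ^ 6 / real n) ^ b * ((2 * real b + 1) / sqrt \<rho>) ^ \<tau>
    \<le> exp (- (real b / 8) * ln (real n)) * exp ((real b / 8) * ln (real n))"
    by (intro mult_mono 1 2) (use s0 in auto)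
  also have "\<dots> = 1" by (simp flip: exp_add)
  finally show ?thesis .
qed

text \<open>The constant 20 is 12 for an irregular degree plus 8 for a large Frobenius norm.\<close>

lemma zero_prob_bound:
  fixes n :: nat and p \<rho> q \<kappa> :: real
  assumes n: "3 \<le> n" and p: "0 < p" "p \<le> 1" and rho: "\<rho> = real n * p"
    and q: "0 < q" "q \<le> 1 / 32" and qrho: "\<rho> * q ^ 8 = ln (real n)"
    and kappa: "0 < \<kappa>" "\<kappa> < 1" and qk: "2 * q ^ 4 + 2 * q ^ 3 \<le> \<kappa>"
    and big: "20736 * (13 * ln (real n)) ^ 6 \<le> real n powr (1 / 8)"
    and D: "D \<subseteq> D1 (2 * q) (1 / (sqrt \<rho> * (1 - \<kappa>))) \<union> D2 (2 * q) (1 / (sqrt \<rho> * (1 - \<kappa>)))"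
  shows "er_prob n p (\<lambda>E. \<exists>v\<in>D. zeta_inv n \<rho> E v = 0) \<le> 20 / (real n)\<^sup>2"
proof -
  have n0: "0 < real n" "0 < n" using n by auto
  have rho0: "0 < \<rho>" using rho n p by simp
  have ln1: "1 \<le> ln (real n)"
  proof -
    have "exp 1 \<le> real n" using n exp_le by linarith
    then show ?thesis using n0 by (simp add: ln_ge_iff)
  qed
  have q8: "0 < q ^ 8" using q by simp
  have qr: "1 / sqrt \<rho> \<le> q ^ 4"
  proof -
    have "1 \<le> \<rho> * q ^ 8" using qrho ln1 by simp
    then have "sqrt 1 \<le> sqrt (\<rho> * q ^ 8)" by (rule real_sqrt_le_mono)
    also have "sqrt (\<rho> * q ^ 8) = sqrt \<rho> * q ^ 4"
    proof -
      have "sqrt (q ^ 8) = q ^ 4" by (rule real_sqrt_unique) (use q in \<open>simp_all flip: power_mult\<close>)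
      then show ?thesis by (simp add: real_sqrt_mult)
    qed
    finally show ?thesis using rho0 by (simp add: field_simps)
  qed
  define u where "u = ln (real n) / q"
  \<comment> \<open>Chosen so that \<open>(1 + q) ^ (2 * l) \<ge> n ^ 6\<close>, by
    \<open>exp (q / 2) \<le> 1 + q\<close>. The moment bound contributes at most
    \<open>8 * n ^ 4\<close> against this, as \<open>2 * l \<le> n\<close>.\<close>
  define l where "l = nat \<lceil>6 * u\<rceil>"
  have u32: "32 \<le> u"
  proof -
    have "32 * 1 \<le> (1 / q) * ln (real n)" by (intro mult_mono ln1) (use q in \<open>auto simp: field_simps\<close>)
    then show ?thesis unfolding u_def by simp
  qed
  have l_ge: "6 * u \<le> real l" unfolding l_def by linarith
  have l_le: "real l \<le> 6 * u + 1" unfolding l_def using u32 by linarith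
  have "0 < real l" using l_ge u32 by linarith
  then have l0: "0 < l" by simp
  have L: "real (2 * l) \<le> 13 * ln (real n) / q"
    using l_le u32 unfolding u_def by simp
  \<comment> \<open>From \<open>\<rho> \<le> n\<close> follows \<open>1 \<le> n * q ^ 8\<close>.
    Thus the factor \<open>1 / q ^ 6\<close> in \<open>L ^ 6\<close> costs at most
    \<open>n powr (3 / 4)\<close>, and \<open>big\<close> lets the logarithms fit into another
    \<open>n powr (1 / 8)\<close>.\<close>
  have q6: "1 \<le> q ^ 6 * real n powr (3 / 4)"
  proof -
    have "ln (real n) \<le> real n * q ^ 8"
    proof -
      have "\<rho> \<le> real n" unfolding rho using p n0 by (simp add: mult_left_le)
      then show ?thesis using qrho q8 by (metis mult_right_mono less_imp_le)
    qed
    then have "1 \<le> real n * q ^ 8" using ln1 by simp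
    then have "1 powr (3 / 4) \<le> (real n * q ^ 8) powr (3 / 4)" by (intro powr_mono2) auto
    also have "\<dots> = real n powr (3 / 4) * (q ^ 8) powr (3 / 4)" using q by (simp add: powr_mult)
    also have "(q ^ 8) powr (3 / 4) = q ^ 6"
    proof -
      have "(q ^ 8) powr (3 / 4) = (q powr (real 8)) powr (3 / 4)" by (simp only: powr_realpow[OF q(1)])
      also have "\<dots> = q powr (real 8 * (3 / 4))" by (rule powr_powr)
      also have "real 8 * (3 / 4) = real 6" by simp
      also have "q powr (real 6) = q ^ 6" by (rule powr_realpow[OF q(1)])
      finally show ?thesis .
    qed
    finally show ?thesis by (simp add: mult.commute)
  qed
  have L6: "20736 * real (2 * l) ^ 6 \<le> real n powr (7 / 8)"
  proof -
    have "20736 * real (2 * l) ^ 6 \<le> 20736 * (13 * ln (real n) / q) ^ 6"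
      by (intro mult_left_mono power_mono L) auto
    also have "\<dots> = 20736 * (13 * ln (real n)) ^ 6 * (1 / q ^ 6)" by (simp add: power_divide)
    also have "\<dots> \<le> real n powr (1 / 8) * real n powr (3 / 4)"
      by (intro mult_mono big) (use q6 q in \<open>auto simp: field_simps\<close>)
    also have "\<dots> = real n powr (7 / 8)" by (simp flip: powr_add)
    finally show ?thesis .
  qed
  have Ln: "real (2 * l) \<le> real n"
  proof -
    have "real (2 * l) = real (2 * l) ^ 1" by simp
    also have "\<dots> \<le> real (2 * l) ^ 6" using l0 by (intro power_increasing) auto
    also have "\<dots> \<le> 20736 * real (2 * l) ^ 6" by simp
    also have "\<dots> \<le> real n powr (7 / 8)" by (rule L6)
    also have "\<dots> \<le> real n powr 1" by (intro powr_mono) (use n in auto)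
    finally show ?thesis using n0 by simp
  qed
  let ?lam = "sqrt \<rho> * (1 + q)"
  have p': "0 \<le> p" using p by simp
  have "er_prob n p (\<lambda>E. \<exists>v\<in>D. zeta_inv n \<rho> E v = 0)
    \<le> er_prob n p (\<lambda>E. (\<exists>i\<in>{..<n}. q ^ 3 * \<rho> < \<bar>real (degree_in n E i) - \<rho>\<bar>) \<or> ?lam ^ (2 * l) \<le> nb_frobenius n (centered_adj p E) l)"
  proof (rule er_prob_mono[OF p' p(2)])
    fix E assume E: "E \<subseteq> pairs n" and z: "\<exists>v\<in>D. zeta_inv n \<rho> E v = 0"
    show "(\<exists>i\<in>{..<n}. q ^ 3 * \<rho> < \<bar>real (degree_in n E i) - \<rho>\<bar>) \<or> ?lam ^ (2 * l) \<le> nb_frobenius n (centered_adj p E) l"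
    proof (rule ccontr)
      assume neg: "\<not> ?thesis"
      obtain v where v: "v \<in> D" "zeta_inv n \<rho> E v = 0" using z by auto
      have "zeta_inv n \<rho> E v \<noteq> 0"
      proof (rule no_zero[OF n0(2) p rho q qr kappa qk E])
        show "\<bar>real (degree_in n E i) - \<rho>\<bar> \<le> q ^ 3 * \<rho>" if "i < n" for i using neg that by (auto simp: not_less)
        show "nb_frobenius n (centered_adj p E) l < ?lam ^ (2 * l)" using neg by (simp add: not_le)
        show "v \<in> D1 (2 * q) (1 / (sqrt \<rho> * (1 - \<kappa>))) \<union> D2 (2 * q) (1 / (sqrt \<rho> * (1 - \<kappa>)))"
          using v(1) D by blast
      qed
      then show False using v by simp
    qed
  qed
  also have "\<dots> \<le> er_prob n p (\<lambda>E. \<exists>i\<in>{..<n}. q ^ 3 * \<rho> < \<bar>real (degree_in n E i) - \<rho>\<bar>)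
     + er_prob n p (\<lambda>E. ?lam ^ (2 * l) \<le> nb_frobenius n (centered_adj p E) l)"
    by (rule er_prob_disj[OF p' p(2)])
  finally have split: "er_prob n p (\<lambda>E. \<exists>v\<in>D. zeta_inv n \<rho> E v = 0)
    \<le> er_prob n p (\<lambda>E. \<exists>i\<in>{..<n}. q ^ 3 * \<rho> < \<bar>real (degree_in n E i) - \<rho>\<bar>)
     + er_prob n p (\<lambda>E. ?lam ^ (2 * l) \<le> nb_frobenius n (centered_adj p E) l)" .
  have irregular: "er_prob n p (\<lambda>E. \<exists>i\<in>{..<n}. q ^ 3 * \<rho> < \<bar>real (degree_in n E i) - \<rho>\<bar>) \<le> 12 / (real n)\<^sup>2"
  proof -
    have "er_prob n p (\<lambda>E. \<exists>i\<in>{..<n}. q ^ 3 * \<rho> < \<bar>real (degree_in n E i) - \<rho>\<bar>)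
      \<le> (\<Sum>i<n. er_prob n p (\<lambda>E. q ^ 3 * \<rho> < \<bar>real (degree_in n E i) - \<rho>\<bar>))"
      by (rule er_prob_Ex[OF p' p(2)]) simp
    also have "\<dots> \<le> (\<Sum>i<n. 2 * exp (1 - \<rho> * (q ^ 3)\<^sup>2 / 4))"
      by (intro sum_mono er_degree_in_tail[OF p' p(2) _ _ _ rho]) (use q in \<open>auto intro: power_le_one\<close>)
    also have "\<dots> = real n * (2 * exp (1 - \<rho> * (q ^ 3)\<^sup>2 / 4))" by simp
    also have "\<dots> \<le> real n * (2 * exp (1 - 3 * ln (real n)))"
    proof -
      \<comment> \<open>So the Chernoff exponent is \<open>ln n / (4 * q\<^sup>2)\<close>, more than
        the \<open>3 * ln n\<close> used here; one of the three powers of \<open>n\<close> is spent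
        on the union bound over vertices.\<close>
      have e: "\<rho> * (q ^ 3)\<^sup>2 * q\<^sup>2 = ln (real n)"
        unfolding qrho[symmetric] by (simp flip: power_mult power_add)
      have q2: "q\<^sup>2 \<le> 1 / 12"
      proof -
        have "q\<^sup>2 \<le> (1 / 32)\<^sup>2" by (rule power_mono) (use q in auto)
        then show ?thesis by (simp add: power2_eq_square)
      qed
      have "ln (real n) \<le> \<rho> * (q ^ 3)\<^sup>2 * (1 / 12)"
        unfolding e[symmetric] by (intro mult_left_mono q2) (use rho0 in simp)
      then have "3 * ln (real n) \<le> \<rho> * (q ^ 3)\<^sup>2 / 4" by simp
      then show ?thesis by (intro mult_left_mono) auto
    qed
    also have "exp (1 - 3 * ln (real n)) = exp 1 / real n ^ 3"
    proof -
      have "exp (3 * ln (real n)) = real n ^ 3" using n0 by (simp add: exp_of_nat_mult[of 3, simplified])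
      then show ?thesis by (simp add: exp_diff)
    qed
    also have "real n * (2 * (exp 1 / real n ^ 3)) = 2 * exp 1 / (real n)\<^sup>2"
      using n0 by (simp add: power3_eq_cube power2_eq_square)
    also have "\<dots> \<le> 12 / (real n)\<^sup>2" by (intro divide_right_mono) (use exp_le in auto)
    finally show ?thesis .
  qed
  have "er_prob n p (\<lambda>E. ?lam ^ (2 * l) \<le> nb_frobenius n (centered_adj p E) l) \<le> 8 / (real n)\<^sup>2"
  proof -
    have lam0: "0 < ?lam ^ (2 * l)" using rho0 q by simp
    have "er_prob n p (\<lambda>E. ?lam ^ (2 * l) \<le> nb_frobenius n (centered_adj p E) l) \<le> er_exp n p (\<lambda>E. nb_frobenius n (centered_adj p E) l) / ?lam ^ (2 * l)"
      by (rule er_markov[OF p' p(2) lam0]) (auto simp: nb_frobenius_def intro: sum_nonneg)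
    also have "\<dots> \<le> 8 * (real (2 * l))\<^sup>2 * \<rho> ^ l * (real n)\<^sup>2 / ?lam ^ (2 * l)"
    proof (intro divide_right_mono er_exp_nb_frobenius[OF l0 n0(2) p rho])
      fix b \<tau> :: nat assume "\<tau> \<le> 2 * l"
      then show "(20736 * real (2 * l) ^ 6 / real n) ^ b * ((2 * real b + 1) / sqrt \<rho>) ^ \<tau> \<le> 1"
        by (rule excess_weight_small[OF n q qr rho0 L L6])
    qed (use lam0 in simp)
    also have "\<dots> = 8 * (real (2 * l))\<^sup>2 * (real n)\<^sup>2 / (1 + q) ^ (2 * l)"
    proof -
      have "?lam ^ (2 * l) = \<rho> ^ l * (1 + q) ^ (2 * l)"
        using rho0 by (simp add: power_mult_distrib power_mult)
      then show ?thesis using rho0 by simp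
    qed
    also have "\<dots> \<le> 8 * (real n)\<^sup>2 * (real n)\<^sup>2 / real n ^ 6"
    proof (rule frac_le)
      show "8 * (real (2 * l))\<^sup>2 * (real n)\<^sup>2 \<le> 8 * (real n)\<^sup>2 * (real n)\<^sup>2"
        by (intro mult_mono power_mono Ln) auto
      have "exp (q / 2) \<le> 1 + q"
      proof -
        have "exp (q / 2) \<le> 1 + q / 2 + (q / 2)\<^sup>2" by (rule exp_bound) (use q in auto)
        also have "(q / 2)\<^sup>2 \<le> q / 2"
        proof -
          have "(q / 2) * (q / 2) \<le> (q / 2) * 1" by (intro mult_left_mono) (use q in auto)
          then show ?thesis by (simp add: power2_eq_square)
        qed
        finally show ?thesis by simp
      qed
      then have "exp (q / 2) ^ (2 * l) \<le> (1 + q) ^ (2 * l)" by (intro power_mono) auto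
      moreover have "real n ^ 6 \<le> exp (q / 2) ^ (2 * l)"
      proof -
        have "real n ^ 6 = exp (6 * ln (real n))" using n0 by (simp add: exp_of_nat_mult[of 6, simplified])
        also have "6 * ln (real n) \<le> real (2 * l) * (q / 2)" using l_ge q unfolding u_def by (simp add: field_simps)
        then have "exp (6 * ln (real n)) \<le> exp (real (2 * l) * (q / 2))" by simp
        also have "\<dots> = exp (q / 2) ^ (2 * l)" by (simp only: exp_of_nat_mult)
        finally show ?thesis .
      qed
      ultimately show "real n ^ 6 \<le> (1 + q) ^ (2 * l)" by linarith
    qed (use n0 in auto)
    also have "\<dots> = 8 / (real n)\<^sup>2"
      using n0 by (simp add: field_simps flip: power_add)
    finally show ?thesis .
  qed
  with split irregular show ?thesis by simp
qed

theorem theorem2p1: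
  fixes \<chi> :: "nat \<Rightarrow> real" and \<rho> :: "nat \<Rightarrow> real" and \<kappa> :: real
    and \<epsilon> \<epsilon>' :: "nat \<Rightarrow> real"
  assumes chi_pos: "\<And>n. n \<ge> 2 \<Longrightarrow> \<chi> n > 0"
    and chi_lim: "filterlim \<chi> at_top sequentially"
    and rho_def: "\<And>n. \<rho> n = \<chi> n * ln (real n)"
    and rho_bounds: "\<And>n. n \<ge> 2 \<Longrightarrow> 0 < \<rho> n \<and> \<rho> n < real n"
    and kappa: "0 < \<kappa>" "\<kappa> < 1"
    and eps_def: "\<And>n. \<epsilon> n = 2 / \<chi> n powr (1 / 8)"
    and eps'_def: "\<And>n. \<epsilon>' n = 1 / (sqrt (\<rho> n) * (1 - \<kappa>))"
  shows "summable (\<lambda>n. if n \<ge> 2 then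
            er_prob n (\<rho> n / real n) (\<lambda>E. \<exists>v\<in>D1 (\<epsilon> n) (\<epsilon>' n). zeta_inv n (\<rho> n) E v = 0)
          else 0)
       \<and> summable (\<lambda>n. if n \<ge> 2 then
            er_prob n (\<rho> n / real n) (\<lambda>E. \<exists>v\<in>D2 (\<epsilon> n) (\<epsilon>' n). zeta_inv n (\<rho> n) E v = 0)
          else 0)"
proof -
  \<comment> \<open>With this choice \<open>\<epsilon> n = 2 * q n\<close> and
    \<open>\<chi> n * q n ^ 8 = 1\<close>, hence \<open>\<rho> n * q n ^ 8 = ln n\<close>.\<close>
  define q where "q n = \<chi> n powr (- (1 / 8))" for n
  have q_lim: "q \<longlonglongrightarrow> 0"
    unfolding q_def by (rule tendsto_neg_powr[OF _ chi_lim]) simp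
  have "(\<lambda>n. 2 * q n ^ 4 + 2 * q n ^ 3) \<longlonglongrightarrow> 2 * 0 ^ 4 + 2 * 0 ^ 3"
    by (intro tendsto_intros q_lim)
  then have "\<forall>\<^sub>F n in sequentially. 2 * q n ^ 4 + 2 * q n ^ 3 < \<kappa>"
    by (rule order_tendstoD(2)) (use kappa in simp)
  moreover have "\<forall>\<^sub>F n in sequentially. q n < 1 / 32"
    by (rule order_tendstoD(2)[OF q_lim]) simp
  moreover have "\<forall>\<^sub>F n::nat in sequentially. 20736 * (13 * ln (real n)) ^ 6 \<le> real n powr (1 / 8)"
    by real_asymp
  moreover have "\<forall>\<^sub>F n::nat in sequentially. 3 \<le> n" by (rule eventually_ge_at_top)
  ultimately have bound: "\<forall>\<^sub>F n in sequentially. \<forall>D \<in> {D1 (\<epsilon> n) (\<epsilon>' n), D2 (\<epsilon> n) (\<epsilon>' n)}.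
     norm (if n \<ge> 2 then er_prob n (\<rho> n / real n) (\<lambda>E. \<exists>v\<in>D. zeta_inv n (\<rho> n) E v = 0) else 0)
       \<le> 40 * (1 / real n - 1 / real (Suc n))"
  proof eventually_elim
    case (elim n)
    have n: "3 \<le> n" "2 \<le> n" using elim by auto
    have chi: "0 < \<chi> n" using chi_pos n by simp
    have q0: "0 < q n" unfolding q_def using chi by simp
    have q8: "q n ^ 8 = 1 / \<chi> n"
    proof -
      have "q n ^ 8 = \<chi> n powr (real 8 * - (1 / 8))" unfolding q_def by (rule powr_power) (use chi in simp)
      also have "real 8 * - (1 / 8) = - 1" by simp
      finally show ?thesis using chi by (simp add: powr_minus_divide)
    qed
    have p: "0 < \<rho> n / real n" "\<rho> n / real n \<le> 1" using rho_bounds[OF n(2)] n by (auto simp: field_simps)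
    have e: "\<epsilon> n = 2 * q n" unfolding eps_def q_def by (simp add: powr_minus_divide)
    have telescope: "20 / (real n)\<^sup>2 \<le> 40 * (1 / real n - 1 / real (Suc n))"
    proof -
      have "20 / (real n)\<^sup>2 = 40 / (real n * (2 * real n))" by (simp add: power2_eq_square)
      also have "\<dots> \<le> 40 / (real n * (real n + 1))"
        by (intro divide_left_mono mult_left_mono mult_pos_pos) (use n in auto)
      also have "\<dots> = 40 * (1 / real n - 1 / real (Suc n))" using n by (simp add: field_simps)
      finally show ?thesis .
    qed
    show ?case
    proof
      fix D assume D: "D \<in> {D1 (\<epsilon> n) (\<epsilon>' n), D2 (\<epsilon> n) (\<epsilon>' n)}"
      have "er_prob n (\<rho> n / real n) (\<lambda>E. \<exists>v\<in>D. zeta_inv n (\<rho> n) E v = 0) \<le> 20 / (real n)\<^sup>2"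
      proof (rule zero_prob_bound[OF n(1) p _ q0 _ _ kappa])
        show "\<rho> n * q n ^ 8 = ln (real n)" unfolding q8 rho_def using chi by simp
        show "D \<subseteq> D1 (2 * q n) (1 / (sqrt (\<rho> n) * (1 - \<kappa>))) \<union> D2 (2 * q n) (1 / (sqrt (\<rho> n) * (1 - \<kappa>)))"
          using D unfolding e eps'_def by auto
      qed (use elim n in auto)
      moreover have "0 \<le> er_prob n (\<rho> n / real n) (\<lambda>E. \<exists>v\<in>D. zeta_inv n (\<rho> n) E v = 0)"
        by (rule er_prob_nonneg) (use p in auto)
      ultimately show "norm (if n \<ge> 2 then er_prob n (\<rho> n / real n) (\<lambda>E. \<exists>v\<in>D. zeta_inv n (\<rho> n) E v = 0) else 0)
       \<le> 40 * (1 / real n - 1 / real (Suc n))"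
        using n telescope by simp
    qed
  qed
  have sm: "summable (\<lambda>n. 40 * (1 / real n - 1 / real (Suc n)))"
    by (intro summable_mult telescope_summable'[OF lim_1_over_n])
  show ?thesis
  proof
    show "summable (\<lambda>n. if n \<ge> 2 then
            er_prob n (\<rho> n / real n) (\<lambda>E. \<exists>v\<in>D1 (\<epsilon> n) (\<epsilon>' n). zeta_inv n (\<rho> n) E v = 0) else 0)"
      by (rule summable_comparison_test_ev[OF _ sm], rule eventually_mono[OF bound]) blast
    show "summable (\<lambda>n. if n \<ge> 2 then
            er_prob n (\<rho> n / real n) (\<lambda>E. \<exists>v\<in>D2 (\<epsilon> n) (\<epsilon>' n). zeta_inv n (\<rho> n) E v = 0) else 0)"
      by (rule summable_comparison_test_ev[OF _ sm], rule eventually_mono[OF bound]) blast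
  qed
qed

end
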